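(* Let $(\overline{\mathfrak g}:=\mathfrak h[1]\oplus\mathfrak g,\delta)$ be a differential graded Lie algebra concentrated in degrees $-1$ and $0$, let $(M,\pi)$ be a Poisson manifold, let $\Psi:(\overline{\mathfrak g},\delta)\to(\mathfrak X(T^*[1]M),[X_\pi,\cdot\,])$, $X_\pi:=\{\pi,\cdot\,\}$, be a morphism of differential graded Lie algebras, and let $J^\sharp:\overline{\mathfrak g}[-1]\to C^\infty(T^*[1]M)$ be a moment map for this $\overline{\mathfrak g}$-action. Put $$Q_{\overline{\mathfrak g}}=J^\sharp_1(u^i)u^*_i+J^\sharp_0(v^j)v^*_j-\tfrac12c^{ij}_ku^*_iu^*_ju^k-d^{mn}_pu^*_mv^*_nv^p,\qquad \Pi:=\pi-a^i_jv^*_iu^j,$$ where $(a^i_j)$ is the matrix of $\delta:\mathfrak h\to\mathfrak g$, $\delta(v^i)=a^i_ju^j$. Then $S^{(\infty)}=Q_{\overline{\mathfrak g}}+\Pi$ satisfies $\{S^{(\infty)},S^{(\infty)}\}=0$, and it induces the structure of a differential graded Poisson algebra on $$\mathcal K_{\mathfrak g,\mathfrak h}=C^\infty(M)\otimes\bigwedge^\bullet\mathfrak g^*\otimes\bigwedge^\bullet\mathfrak h$$ with differential $\ell_1(f)=\{Q_{\overline{\mathfrak g}},f\}$ and Poisson bracket $\ell_2(f,g)=(-1)^{f}\{\{\Pi,f\},g\}$.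
   Context: Repeated indices are summed. $C^\infty(T^*[1]M)=\mathfrak X^\bullet(M)$ with the Schouten bracket $\{\cdot,\cdot\}$ of degree $-1$ (normalized by $\{X,f\}=X(f)$, $\{X,Y\}=[X,Y]$); $\mathfrak X(T^*[1]M)$ is the graded Lie algebra of graded derivations of $\mathfrak X^\bullet(M)$. $\mathfrak g$ is a finite-dimensional real Lie algebra in degree $0$, $\mathfrak h$ a finite-dimensional $\mathfrak g$-module placed in degree $-1$; $\delta:\mathfrak h\to\mathfrak g$ is the differential. Moment map: linear maps $J_1^\sharp:\mathfrak g\to\mathfrak X(M)$, $J^\sharp_0:\mathfrak h\to C^\infty(M)$ with $\{J_1^\sharp u,J_1^\sharp u'\}=J_1^\sharp[u,u']$, $\{J_1^\sharp u,J_0^\sharp v\}=J_0^\sharp(u\cdot v)$, and $\Psi(u)=\{J_1^\sharp(u),\cdot\,\}$, $\Psi(v)=\{J_0^\sharp(v),\cdot\,\}$. $\{u^i\}$ and $\{v^j\}$ are bases of $\mathfrak g$ and $\mathfrak h[1]$ with dual bases $\{u^*_i\}$, $\{v^*_j\}$; $[u^i,u^j]=c^{ij}_ku^k$, $u^m\cdot v^n=d^{mn}_pv^p$. BFV algebra: $\mathcal A=\mathfrak X^\bullet(M)\otimes S^\bullet(\overline{\mathfrak g}^*[-1])\otimes S^\bullet(\overline{\mathfrak g})$ is the graded commutative algebra in which $r$-vector fields have degree $r$, $u^*_i$ degree $1$, $v^*_j$ degree $2$, $u^i$ degree $0$, $v^j$ degree $-1$. It carries the degree $-1$ Poisson bracket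 extending the Schouten bracket, with $\{u_i^*,u^j\}=\delta_i^j$, $\{v^*_i,v^j\}=\delta_i^j$ and all other brackets between generators zero, satisfying $\{a,b\}=-(-1)^{(|a|-1)(|b|-1)}\{b,a\}$ and $\{a,bc\}=\{a,b\}c+(-1)^{(|a|-1)|b|}b\{a,c\}$. $\mathcal K_{\mathfrak g,\mathfrak h}\subset\mathcal A$ is the subalgebra generated by $C^\infty(M)$, the $u^*_i$ and the $v^j$, graded by total ghost number ($u_i^*$ of degree $1$, $v^j$ of degree $-1$); $(-1)^f$ means $(-1)^{\deg f}$. A differential graded Poisson algebra is a graded commutative algebra with a degree $1$ differential that is a derivation of the product and of a degree $0$ graded Poisson bracket. *)

theory Defs
  imports
    "HOL-Analysis.Analysis"
    "HOL-Library.Function_Algebras"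
    "HOL-Library.Multiset"
begin

section \<open>Pointwise real vector space structure on functions\<close>

instantiation "fun" :: (type, scaleR) scaleR
begin

definition scaleR_fun_def: "r *\<^sub>R f = (\<lambda>x. r *\<^sub>R f x)"

instance ..

end

lemma scaleR_fun_apply [simp]: "(r *\<^sub>R f) x = r *\<^sub>R f x"
  by (simp add: scaleR_fun_def)

instance "fun" :: (type, real_vector) real_vector
  by standard (simp_all add: fun_eq_iff algebra_simps)


section \<open>Graded algebraic structures\<close>

text \<open>A graded real vector space is given by the family of its homogeneous components, and all
  operations are operations on homogeneous elements. Operations whose formula involves Koszul signs
  take the degrees of their arguments as parameters.\<close>

definition koszul :: "int \<Rightarrow> real" where
  "koszul k = (if even k then 1 else -1)"

definition graded_space :: "(int \<Rightarrow> 'a::real_vector set) \<Rightarrow> bool" where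
  "graded_space V \<longleftrightarrow> (\<forall>k. subspace (V k))"

definition lin_on :: "'a::real_vector set \<Rightarrow> ('a \<Rightarrow> 'b::real_vector) \<Rightarrow> bool" where
  "lin_on V f \<longleftrightarrow>
     (\<forall>x\<in>V. \<forall>y\<in>V. f (x + y) = f x + f y) \<and> (\<forall>r. \<forall>x\<in>V. f (r *\<^sub>R x) = r *\<^sub>R f x)"

definition bilin_on ::
    "'a::real_vector set \<Rightarrow> 'b::real_vector set \<Rightarrow> ('a \<Rightarrow> 'b \<Rightarrow> 'c::real_vector) \<Rightarrow> bool" where
  "bilin_on V W f \<longleftrightarrow> (\<forall>x\<in>V. lin_on W (f x)) \<and> (\<forall>y\<in>W. lin_on V (\<lambda>x. f x y))"

text \<open>Graded Lie algebras with a bracket of degree \<open>n\<close>, i.e. such that shifting degrees by \<open>n\<close> gives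
  an ordinary graded Lie algebra.\<close>

definition graded_lie_algebra ::
    "int \<Rightarrow> (int \<Rightarrow> 'a::real_vector set) \<Rightarrow> (int \<Rightarrow> int \<Rightarrow> 'a \<Rightarrow> 'a \<Rightarrow> 'a) \<Rightarrow> bool" where
  "graded_lie_algebra n L br \<longleftrightarrow>
     graded_space L \<and>
     (\<forall>k l. bilin_on (L k) (L l) (br k l)) \<and>
     (\<forall>k l. \<forall>x\<in>L k. \<forall>y\<in>L l. br k l x y \<in> L (k + l + n)) \<and>
     (\<forall>k l. \<forall>x\<in>L k. \<forall>y\<in>L l.
        br k l x y = - (koszul ((k + n) * (l + n)) *\<^sub>R br l k y x)) \<and>
     (\<forall>k l m. \<forall>x\<in>L k. \<forall>y\<in>L l. \<forall>z\<in>L m.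
        br k (l + m + n) x (br l m y z) =
          br (k + l + n) m (br k l x y) z
          + koszul ((k + n) * (l + n)) *\<^sub>R br l (k + m + n) y (br k m x z))"

definition dg_lie_algebra ::
    "(int \<Rightarrow> 'a::real_vector set) \<Rightarrow> (int \<Rightarrow> int \<Rightarrow> 'a \<Rightarrow> 'a \<Rightarrow> 'a) \<Rightarrow> (int \<Rightarrow> 'a \<Rightarrow> 'a) \<Rightarrow> bool" where
  "dg_lie_algebra L br d \<longleftrightarrow>
     graded_lie_algebra 0 L br \<and>
     (\<forall>k. lin_on (L k) (d k)) \<and>
     (\<forall>k. \<forall>x\<in>L k. d k x \<in> L (k + 1)) \<and>
     (\<forall>k. \<forall>x\<in>L k. d (k + 1) (d k x) = 0) \<and>
     (\<forall>k l. \<forall>x\<in>L k. \<forall>y\<in>L l.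
        d (k + l) (br k l x y) =
          br (k + 1) l (d k x) y + koszul k *\<^sub>R br k (l + 1) x (d l y))"

definition dgla_morphism ::
    "(int \<Rightarrow> 'a::real_vector set) \<Rightarrow> (int \<Rightarrow> int \<Rightarrow> 'a \<Rightarrow> 'a \<Rightarrow> 'a) \<Rightarrow> (int \<Rightarrow> 'a \<Rightarrow> 'a) \<Rightarrow>
     (int \<Rightarrow> 'b::real_vector set) \<Rightarrow> (int \<Rightarrow> int \<Rightarrow> 'b \<Rightarrow> 'b \<Rightarrow> 'b) \<Rightarrow> (int \<Rightarrow> 'b \<Rightarrow> 'b) \<Rightarrow>
     ('a \<Rightarrow> 'b) \<Rightarrow> bool" where
  "dgla_morphism L br d L' br' d' \<Psi> \<longleftrightarrow>
     (\<forall>k. lin_on (L k) \<Psi>) \<and>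
     (\<forall>k. \<forall>x\<in>L k. \<Psi> x \<in> L' k) \<and>
     (\<forall>k l. \<forall>x\<in>L k. \<forall>y\<in>L l. \<Psi> (br k l x y) = br' k l (\<Psi> x) (\<Psi> y)) \<and>
     (\<forall>k. \<forall>x\<in>L k. \<Psi> (d k x) = d' k (\<Psi> x))"

definition graded_comm_algebra ::
    "(int \<Rightarrow> 'a::real_vector set) \<Rightarrow> ('a \<Rightarrow> 'a \<Rightarrow> 'a) \<Rightarrow> 'a \<Rightarrow> bool" where
  "graded_comm_algebra A mul e \<longleftrightarrow>
     graded_space A \<and>
     (\<forall>k l. bilin_on (A k) (A l) mul) \<and>
     (\<forall>k l. \<forall>x\<in>A k. \<forall>y\<in>A l. mul x y \<in> A (k + l)) \<and>
     (\<forall>k l m. \<forall>x\<in>A k. \<forall>y\<in>A l. \<forall>z\<in>A m. mul (mul x y) z = mul x (mul y z)) \<and>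
     e \<in> A 0 \<and>
     (\<forall>k. \<forall>x\<in>A k. mul e x = x \<and> mul x e = x) \<and>
     (\<forall>k l. \<forall>x\<in>A k. \<forall>y\<in>A l. mul x y = koszul (k * l) *\<^sub>R mul y x)"

definition graded_poisson_bracket ::
    "int \<Rightarrow> (int \<Rightarrow> 'a::real_vector set) \<Rightarrow> ('a \<Rightarrow> 'a \<Rightarrow> 'a) \<Rightarrow>
     (int \<Rightarrow> int \<Rightarrow> 'a \<Rightarrow> 'a \<Rightarrow> 'a) \<Rightarrow> bool" where
  "graded_poisson_bracket n A mul br \<longleftrightarrow>
     graded_lie_algebra n A br \<and>
     (\<forall>k l m. \<forall>x\<in>A k. \<forall>y\<in>A l. \<forall>z\<in>A m.
        br k (l + m) x (mul y z) =
          mul (br k l x y) z + koszul ((k + n) * l) *\<^sub>R mul y (br k m x z))"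

definition dg_poisson_algebra ::
    "(int \<Rightarrow> 'a::real_vector set) \<Rightarrow> ('a \<Rightarrow> 'a \<Rightarrow> 'a) \<Rightarrow> 'a \<Rightarrow> ('a \<Rightarrow> 'a) \<Rightarrow>
     (int \<Rightarrow> int \<Rightarrow> 'a \<Rightarrow> 'a \<Rightarrow> 'a) \<Rightarrow> bool" where
  "dg_poisson_algebra A mul e d br \<longleftrightarrow>
     graded_comm_algebra A mul e \<and>
     (\<forall>k. lin_on (A k) d) \<and>
     (\<forall>k. \<forall>x\<in>A k. d x \<in> A (k + 1)) \<and>
     (\<forall>k. \<forall>x\<in>A k. d (d x) = 0) \<and>
     (\<forall>k l. \<forall>x\<in>A k. \<forall>y\<in>A l. d (mul x y) = mul (d x) y + koszul k *\<^sub>R mul x (d y)) \<and>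
     graded_poisson_bracket 0 A mul br \<and>
     (\<forall>k l. \<forall>x\<in>A k. \<forall>y\<in>A l.
        d (br k l x y) = br (k + 1) l (d x) y + koszul k *\<^sub>R br k (l + 1) x (d y))"


section \<open>Smooth manifolds\<close>

text \<open>On open subsets of finite-dimensional spaces this is the usual notion of a \<open>C\<^sup>k\<close> function: all
  iterated directional derivatives up to order \<open>k\<close> exist and are continuous, the derivatives of
  order less than \<open>k\<close> being Frechet differentiable.\<close>

primrec Ck_on :: "nat \<Rightarrow> 'e::real_normed_vector set \<Rightarrow> ('e \<Rightarrow> 'f::real_normed_vector) \<Rightarrow> bool" where
  "Ck_on 0 U f \<longleftrightarrow> continuous_on U f"
| "Ck_on (Suc k) U f \<longleftrightarrow>
     (\<exists>D. (\<forall>x\<in>U. (f has_derivative D x) (at x)) \<and> (\<forall>w. Ck_on k U (\<lambda>x. D x w)))"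

definition smooth_on :: "'e::real_normed_vector set \<Rightarrow> ('e \<Rightarrow> 'f::real_normed_vector) \<Rightarrow> bool" where
  "smooth_on U f \<longleftrightarrow> (\<forall>k. Ck_on k U f)"

text \<open>The manifold is the whole type \<open>'m\<close>; the model space \<open>'e\<close> is any finite-dimensional
  normed space (it may be zero-dimensional, unlike a \<open>euclidean_space\<close>).\<close>

type_synonym ('m, 'e) chart = "'m set \<times> ('m \<Rightarrow> 'e)"

definition smooth_manifold ::
    "('m::{t2_space, second_countable_topology}, 'e::real_normed_vector) chart set \<Rightarrow> bool" where
  "smooth_manifold \<A> \<longleftrightarrow>
     (\<exists>B::'e set. finite B \<and> span B = UNIV) \<and>
     (\<Union>(U, \<phi>)\<in>\<A>. U) = UNIV \<and>
     (\<forall>(U, \<phi>)\<in>\<A>. open U \<and> open (\<phi> ` U) \<and> homeomorphism U (\<phi> ` U) \<phi> (inv_into U \<phi>)) \<and>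
     (\<forall>(U, \<phi>)\<in>\<A>. \<forall>(V, \<psi>)\<in>\<A>. smooth_on (\<phi> ` (U \<inter> V)) (\<psi> \<circ> inv_into U \<phi>))"

definition smooth_functions :: "('m, 'e::real_normed_vector) chart set \<Rightarrow> ('m \<Rightarrow> real) set" where
  "smooth_functions \<A> = {f. \<forall>(U, \<phi>)\<in>\<A>. smooth_on (\<phi> ` U) (f \<circ> inv_into U \<phi>)}"


section \<open>Multivector fields\<close>

text \<open>An \<open>r\<close>-vector field is an alternating \<open>r\<close>-derivation of \<open>C\<^sup>\<infinity>(M)\<close>, here a function on lists of
  smooth functions. A function on lists of arbitrary length encodes an inhomogeneous multivector
  field: its component of degree \<open>r\<close> is its restriction to lists of length \<open>r\<close>. The value is \<open>0\<close> on
  lists that contain a non-smooth function. In degree \<open>0\<close> the only argument is the empty list.\<close>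

type_synonym 'm mv = "('m \<Rightarrow> real) list \<Rightarrow> 'm \<Rightarrow> real"

definition multivector_fields ::
    "('m, 'e::real_normed_vector) chart set \<Rightarrow> int \<Rightarrow> 'm mv set" where
  "multivector_fields \<A> r = {P.
     (\<forall>fs. \<not> (int (length fs) = r \<and> set fs \<subseteq> smooth_functions \<A>) \<longrightarrow> P fs = 0) \<and>
     (\<forall>fs. set fs \<subseteq> smooth_functions \<A> \<longrightarrow> P fs \<in> smooth_functions \<A>) \<and>
     (\<forall>fs gs. lin_on (smooth_functions \<A>) (\<lambda>f. P (fs @ f # gs))) \<and>
     (\<forall>fs f g hs. P (fs @ f # g # hs) = - P (fs @ g # f # hs)) \<and>
     (\<forall>fs gs. \<forall>f\<in>smooth_functions \<A>. \<forall>g\<in>smooth_functions \<A>.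
        P (fs @ (f * g) # gs) = f * P (fs @ g # gs) + g * P (fs @ f # gs))}"

definition all_multivector_fields ::
    "('m, 'e::real_normed_vector) chart set \<Rightarrow> 'm mv set" where
  "all_multivector_fields \<A> = span (\<Union>r. multivector_fields \<A> r)"

definition mv_of_fun :: "('m \<Rightarrow> real) \<Rightarrow> 'm mv" where
  "mv_of_fun f = (\<lambda>fs. if fs = [] then f else 0)"

definition shuffle_sign :: "nat \<Rightarrow> nat set \<Rightarrow> real" where
  "shuffle_sign n S = (-1) ^ card {(i, j). i \<in> S \<and> j \<in> {..<n} - S \<and> j < i}"

text \<open>Shuffle sums, a shuffle of \<open>fs\<close> being given by the set of positions of its first block.\<close>

definition wedge :: "'m mv \<Rightarrow> 'm mv \<Rightarrow> 'm mv" where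
  "wedge P Q = (\<lambda>fs. \<Sum>S\<in>Pow {..<length fs}.
     shuffle_sign (length fs) S *\<^sub>R (P (nths fs S) * Q (nths fs (- S))))"

text \<open>For \<open>P\<close> of degree \<open>p\<close> and \<open>Q\<close> of degree \<open>q\<close> this is
  \<open>(-1)\<^bsup>(p-1)(q-1)\<^esup> P \<circ> Q - Q \<circ> P\<close>, where \<open>P \<circ> Q\<close> is the shuffle sum of
  \<open>P(Q(\<dots>), \<dots>)\<close>. The overall sign is the one for which \<open>{X, f} = X(f)\<close>, \<open>{X, Y} = [X, Y]\<close> and
  \<open>{P, \<cdot>}\<close> is a derivation of degree \<open>p - 1\<close> acting from the left.\<close>

definition schouten :: "'m mv \<Rightarrow> 'm mv \<Rightarrow> 'm mv" where
  "schouten P Q = (\<lambda>fs. \<Sum>S\<in>Pow {..<length fs}.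
     let T = {..<length fs} - S in
     shuffle_sign (length fs) S *\<^sub>R
       ((-1) ^ (card T * (card S + 1)) *\<^sub>R P (Q (nths fs S) # nths fs T)
        - Q (P (nths fs S) # nths fs T)))"

definition poisson_structure ::
    "('m, 'e::real_normed_vector) chart set \<Rightarrow> 'm mv \<Rightarrow> bool" where
  "poisson_structure \<A> \<pi> \<longleftrightarrow> \<pi> \<in> multivector_fields \<A> 2 \<and> schouten \<pi> \<pi> = 0"

text \<open>Graded derivations of the algebra of multivector fields, extended by \<open>0\<close> to the whole type.\<close>

definition derivations ::
    "('m, 'e::real_normed_vector) chart set \<Rightarrow> int \<Rightarrow> ('m mv \<Rightarrow> 'm mv) set" where
  "derivations \<A> k = {D.
     (\<forall>P. P \<notin> all_multivector_fields \<A> \<longrightarrow> D P = 0) \<and>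
     lin_on (all_multivector_fields \<A>) D \<and>
     (\<forall>r. \<forall>P\<in>multivector_fields \<A> r. D P \<in> multivector_fields \<A> (r + k)) \<and>
     (\<forall>r. \<forall>P\<in>multivector_fields \<A> r. \<forall>Q\<in>all_multivector_fields \<A>.
        D (wedge P Q) = wedge (D P) Q + koszul (k * r) *\<^sub>R wedge P (D Q))}"

definition commutator ::
    "int \<Rightarrow> int \<Rightarrow> ('m mv \<Rightarrow> 'm mv) \<Rightarrow> ('m mv \<Rightarrow> 'm mv) \<Rightarrow> 'm mv \<Rightarrow> 'm mv" where
  "commutator k l D E = (D \<circ> E) - koszul (k * l) *\<^sub>R (E \<circ> D)"

definition hamiltonian ::
    "('m, 'e::real_normed_vector) chart set \<Rightarrow> 'm mv \<Rightarrow> 'm mv \<Rightarrow> 'm mv" where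
  "hamiltonian \<A> P = (\<lambda>Q. if Q \<in> all_multivector_fields \<A> then schouten P Q else 0)"


section \<open>The differential graded Lie algebra and the moment map\<close>

text \<open>The graded vector space \<open>\<hh>[1] \<oplus> \<gg>\<close>. That the data below form a differential graded Lie
  algebra on it contains the facts that \<open>\<gg>\<close> is a Lie algebra, that \<open>\<hh>\<close> is a \<open>\<gg>\<close>-module, and that
  \<open>\<delta>\<close> is linear.\<close>

definition gbar :: "int \<Rightarrow> ('h::real_vector \<times> 'g::real_vector) set" where
  "gbar k = (if k = -1 then {(y, 0) |y. True} else if k = 0 then {(0, x) |x. True} else {0})"

definition gbar_bracket ::
    "('g::real_vector \<Rightarrow> 'g \<Rightarrow> 'g) \<Rightarrow> ('g \<Rightarrow> 'h::real_vector \<Rightarrow> 'h) \<Rightarrow>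
     int \<Rightarrow> int \<Rightarrow> 'h \<times> 'g \<Rightarrow> 'h \<times> 'g \<Rightarrow> 'h \<times> 'g" where
  "gbar_bracket lie act k l a b =
     (if k = 0 \<and> l = 0 then (0, lie (snd a) (snd b))
      else if k = 0 \<and> l = -1 then (act (snd a) (fst b), 0)
      else if k = -1 \<and> l = 0 then (- act (snd b) (fst a), 0)
      else 0)"

definition gbar_diff ::
    "('h::real_vector \<Rightarrow> 'g::real_vector) \<Rightarrow> int \<Rightarrow> 'h \<times> 'g \<Rightarrow> 'h \<times> 'g" where
  "gbar_diff \<delta> k a = (if k = -1 then (0, \<delta> (fst a)) else 0)"

definition moment_map ::
    "('m, 'e::real_normed_vector) chart set \<Rightarrow>
     ('g::real_vector \<Rightarrow> 'g \<Rightarrow> 'g) \<Rightarrow> ('g \<Rightarrow> 'h::real_vector \<Rightarrow> 'h) \<Rightarrow>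
     ('h \<times> 'g \<Rightarrow> 'm mv \<Rightarrow> 'm mv) \<Rightarrow> ('g \<Rightarrow> 'm mv) \<Rightarrow> ('h \<Rightarrow> 'm \<Rightarrow> real) \<Rightarrow> bool" where
  "moment_map \<A> lie act \<Psi> J1 J0 \<longleftrightarrow>
     linear J1 \<and> (\<forall>x. J1 x \<in> multivector_fields \<A> 1) \<and>
     linear J0 \<and> (\<forall>y. J0 y \<in> smooth_functions \<A>) \<and>
     (\<forall>x x'. schouten (J1 x) (J1 x') = J1 (lie x x')) \<and>
     (\<forall>x y. schouten (J1 x) (mv_of_fun (J0 y)) = mv_of_fun (J0 (act x y))) \<and>
     (\<forall>x. \<Psi> (0, x) = hamiltonian \<A> (J1 x)) \<and>
     (\<forall>y. \<Psi> (y, 0) = hamiltonian \<A> (mv_of_fun (J0 y)))"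

definition is_basis :: "nat \<Rightarrow> (nat \<Rightarrow> 'a::real_vector) \<Rightarrow> bool" where
  "is_basis n b \<longleftrightarrow>
     inj_on b {..<n} \<and> independent (b ` {..<n}) \<and> span (b ` {..<n}) = UNIV"


section \<open>The BFV algebra\<close>

text \<open>With respect to bases of \<open>\<gg>\<close> (of size \<open>p\<close>) and of \<open>\<hh>[1]\<close> (of size \<open>q\<close>), the graded symmetric
  algebras are spanned by the monomials in the generators \<open>u\<^sup>*\<^sub>i, v\<^sup>*\<^sub>j, u\<^sup>i, v\<^sup>j\<close> in which no generator
  of odd degree is repeated.\<close>

datatype gen = UStar nat | VStar nat | UGen nat | VGen nat

fun gen_deg :: "gen \<Rightarrow> int" where
  "gen_deg (UStar i) = 1"
| "gen_deg (VStar j) = 2"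
| "gen_deg (UGen i) = 0"
| "gen_deg (VGen j) = -1"

definition generators :: "nat \<Rightarrow> nat \<Rightarrow> gen set" where
  "generators p q = UStar ` {..<p} \<union> VStar ` {..<q} \<union> UGen ` {..<p} \<union> VGen ` {..<q}"

definition mono_deg :: "gen multiset \<Rightarrow> int" where
  "mono_deg m = (\<Sum>x\<in>#m. gen_deg x)"

definition monomials :: "nat \<Rightarrow> nat \<Rightarrow> gen multiset set" where
  "monomials p q =
     {m. set_mset m \<subseteq> generators p q \<and> (\<forall>x\<in>#m. odd (gen_deg x) \<longrightarrow> count m x = 1)}"

text \<open>A monomial denotes the product of its generators in the order in which those of odd degree
  appear as \<open>u\<^sup>*\<^sub>0, u\<^sup>*\<^sub>1, \<dots>, v\<^sup>0, v\<^sup>1, \<dots>\<close>; those of even degree are central.\<close>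

fun odd_before :: "gen \<Rightarrow> gen \<Rightarrow> bool" where
  "odd_before (UStar i) (UStar j) \<longleftrightarrow> i < j"
| "odd_before (UStar i) (VGen j) \<longleftrightarrow> True"
| "odd_before (VGen i) (VGen j) \<longleftrightarrow> i < j"
| "odd_before _ _ \<longleftrightarrow> False"

text \<open>The product of the monomials \<open>m\<close> and \<open>n\<close> is \<open>mono_sign m n\<close> times the monomial \<open>m + n\<close>.\<close>

definition mono_sign :: "gen multiset \<Rightarrow> gen multiset \<Rightarrow> real" where
  "mono_sign m n =
     (if \<exists>x. x \<in># m \<and> x \<in># n \<and> odd (gen_deg x) then 0
      else (-1) ^ card {(x, y). x \<in># m \<and> y \<in># n \<and> odd_before y x})"

text \<open>An element of the BFV algebra is a finite sum of terms \<open>P m\<close>, with a multivector field \<open>P\<close> as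
  coefficient of the monomial \<open>m\<close> on its right. In \<open>bfv_mult\<close> the sign
  \<open>koszul (mono_deg k * int (length hs))\<close> is the one for moving \<open>k\<close> past a coefficient of degree
  \<open>length hs\<close>.\<close>

type_synonym 'm bfv = "gen multiset \<Rightarrow> 'm mv"

definition bfv_space ::
    "('m, 'e::real_normed_vector) chart set \<Rightarrow> nat \<Rightarrow> nat \<Rightarrow> int \<Rightarrow> 'm bfv set" where
  "bfv_space \<A> p q k = {a.
     finite {m. a m \<noteq> 0} \<and>
     (\<forall>m. if m \<in> monomials p q then a m \<in> multivector_fields \<A> (k - mono_deg m) else a m = 0)}"

definition bfv_mult :: "'m bfv \<Rightarrow> 'm bfv \<Rightarrow> 'm bfv"  (infixl \<open>\<star>\<close> 70) where
  "a \<star> b = (\<lambda>m. \<Sum>k\<in>{k. k \<subseteq># m}.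
     mono_sign k (m - k) *\<^sub>R
       wedge (a k) (\<lambda>hs. koszul (mono_deg k * int (length hs)) *\<^sub>R b (m - k) hs))"

definition bfv_mv :: "'m mv \<Rightarrow> 'm bfv" where
  "bfv_mv P = (\<lambda>m. if m = {#} then P else 0)"

definition bfv_one :: "'m bfv" where
  "bfv_one = bfv_mv (mv_of_fun 1)"

definition bfv_gen :: "gen \<Rightarrow> 'm bfv" where
  "bfv_gen x = (\<lambda>m. if m = {#x#} then mv_of_fun 1 else 0)"

fun dual_gens :: "gen \<Rightarrow> gen \<Rightarrow> bool" where
  "dual_gens (UStar i) (UGen j) \<longleftrightarrow> i = j"
| "dual_gens (VStar i) (VGen j) \<longleftrightarrow> i = j"
| "dual_gens _ _ \<longleftrightarrow> False"

text \<open>The degree \<open>-1\<close> Poisson bracket of the BFV algebra. As multivector fields and generators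
  generate the algebra, it is determined by these conditions.\<close>

definition bfv_bracket ::
    "('m, 'e::real_normed_vector) chart set \<Rightarrow> nat \<Rightarrow> nat \<Rightarrow> ('m bfv \<Rightarrow> 'm bfv \<Rightarrow> 'm bfv) \<Rightarrow> bool" where
  "bfv_bracket \<A> p q br \<longleftrightarrow>
     graded_poisson_bracket (-1) (bfv_space \<A> p q) (\<star>) (\<lambda>_ _. br) \<and>
     (\<forall>r s. \<forall>P\<in>multivector_fields \<A> r. \<forall>Q\<in>multivector_fields \<A> s.
        br (bfv_mv P) (bfv_mv Q) = bfv_mv (schouten P Q)) \<and>
     (\<forall>r. \<forall>P\<in>multivector_fields \<A> r. \<forall>x\<in>generators p q. br (bfv_mv P) (bfv_gen x) = 0) \<and>
     (\<forall>x\<in>generators p q. \<forall>y\<in>generators p q.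
        (dual_gens x y \<longrightarrow> br (bfv_gen x) (bfv_gen y) = bfv_one) \<and>
        (\<not> dual_gens x y \<and> \<not> dual_gens y x \<longrightarrow> br (bfv_gen x) (bfv_gen y) = 0))"

definition bfv_Q ::
    "nat \<Rightarrow> nat \<Rightarrow> ('g \<Rightarrow> 'm mv) \<Rightarrow> ('h \<Rightarrow> 'm \<Rightarrow> real) \<Rightarrow> (nat \<Rightarrow> 'g) \<Rightarrow> (nat \<Rightarrow> 'h) \<Rightarrow>
     (nat \<Rightarrow> nat \<Rightarrow> nat \<Rightarrow> real) \<Rightarrow> (nat \<Rightarrow> nat \<Rightarrow> nat \<Rightarrow> real) \<Rightarrow> 'm bfv" where
  "bfv_Q p q J1 J0 u v c d =
     (\<Sum>i<p. bfv_mv (J1 (u i)) \<star> bfv_gen (UStar i))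
     + (\<Sum>j<q. bfv_mv (mv_of_fun (J0 (v j))) \<star> bfv_gen (VStar j))
     - (1/2) *\<^sub>R (\<Sum>i<p. \<Sum>j<p. \<Sum>k<p.
         c i j k *\<^sub>R (bfv_gen (UStar i) \<star> bfv_gen (UStar j) \<star> bfv_gen (UGen k)))
     - (\<Sum>m<p. \<Sum>n<q. \<Sum>l<q.
         d m n l *\<^sub>R (bfv_gen (UStar m) \<star> bfv_gen (VStar n) \<star> bfv_gen (VGen l)))"

definition bfv_Pi :: "nat \<Rightarrow> nat \<Rightarrow> 'm mv \<Rightarrow> (nat \<Rightarrow> nat \<Rightarrow> real) \<Rightarrow> 'm bfv" where
  "bfv_Pi p q \<pi> a =
     bfv_mv \<pi> - (\<Sum>i<q. \<Sum>j<p. a i j *\<^sub>R (bfv_gen (VStar i) \<star> bfv_gen (UGen j)))"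

text \<open>The subalgebra \<open>\<K>\<close> generated by \<open>C\<^sup>\<infinity>(M)\<close>, the \<open>u\<^sup>*\<^sub>i\<close> and the \<open>v\<^sup>j\<close>.\<close>

inductive_set bfv_K :: "('m, 'e::real_normed_vector) chart set \<Rightarrow> nat \<Rightarrow> nat \<Rightarrow> 'm bfv set"
  for \<A> :: "('m, 'e::real_normed_vector) chart set" and p q :: nat where
  "f \<in> smooth_functions \<A> \<Longrightarrow> bfv_mv (mv_of_fun f) \<in> bfv_K \<A> p q"
| "i < p \<Longrightarrow> bfv_gen (UStar i) \<in> bfv_K \<A> p q"
| "j < q \<Longrightarrow> bfv_gen (VGen j) \<in> bfv_K \<A> p q"
| "a \<in> bfv_K \<A> p q \<Longrightarrow> b \<in> bfv_K \<A> p q \<Longrightarrow> a + b \<in> bfv_K \<A> p q"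
| "a \<in> bfv_K \<A> p q \<Longrightarrow> r *\<^sub>R a \<in> bfv_K \<A> p q"
| "a \<in> bfv_K \<A> p q \<Longrightarrow> b \<in> bfv_K \<A> p q \<Longrightarrow> a \<star> b \<in> bfv_K \<A> p q"

text \<open>On \<open>\<K>\<close> the degree of the BFV algebra is the total ghost number.\<close>

definition bfv_K_space ::
    "('m, 'e::real_normed_vector) chart set \<Rightarrow> nat \<Rightarrow> nat \<Rightarrow> int \<Rightarrow> 'm bfv set" where
  "bfv_K_space \<A> p q k = bfv_K \<A> p q \<inter> bfv_space \<A> p q k"

text \<open>The tensor product \<open>C\<^sup>\<infinity>(M) \<otimes> \<Lambda>\<^sup>\<bullet>\<gg>\<^sup>* \<otimes> \<Lambda>\<^sup>\<bullet>\<hh>\<close> inside the BFV algebra: elements whose coefficients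
  are smooth functions and whose monomials are \<open>u\<^sup>*\<^sub>I v\<^sup>J\<close> for sets of indices \<open>I\<close> and \<open>J\<close>.\<close>

definition fun_ext_tensor ::
    "('m, 'e::real_normed_vector) chart set \<Rightarrow> nat \<Rightarrow> nat \<Rightarrow> 'm bfv set" where
  "fun_ext_tensor \<A> p q = {a. \<forall>m.
     if \<exists>I\<subseteq>{..<p}. \<exists>J\<subseteq>{..<q}. m = mset_set (UStar ` I) + mset_set (VGen ` J)
     then a m \<in> mv_of_fun ` smooth_functions \<A>
     else a m = 0}"

end

theory Submission
  imports Defs
begin

text \<open>Write \<open>S = Q + P\<close>, with \<open>P\<close> the bivector \<open>\<Pi>\<close> of the statement. The operator \<open>{Q, \<cdot>}\<close> is a derivation,
  so it is determined by its values on generators, where it is a Chevalley-Eilenberg and Koszul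
  differential. In the Leibniz expansion of \<open>{Q, Q}\<close> the terms cancel by the moment map equations, the
  Jacobi identity of \<open>\<gg>\<close> and the module law of \<open>\<hh>\<close>. As \<open>\<Psi>\<close> is a chain map, and vector and bivector
  fields are determined by their action on functions, \<open>{\<pi>, J\<^sub>0(v)} = J\<^sub>1(\<delta> v)\<close> and \<open>{\<pi>, J\<^sub>1(u)} = 0\<close>;
  with the compatibility of \<open>\<delta>\<close> and the bracket this gives \<open>{Q, P} = 0\<close>, while \<open>{P, P} = 0\<close> is immediate.
  The algebra \<open>\<K>\<close> is abelian for the bracket and preserved by \<open>{Q, \<cdot>}\<close> and \<open>{{P, \<cdot>}, \<cdot>}\<close>, so
  \<open>{P, P} = 0\<close> makes the derived bracket a Poisson bracket on it, and \<open>{Q, P} = 0\<close> makes \<open>{Q, \<cdot>}\<close> a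
  derivation of that bracket.\<close>

section \<open>Smooth functions\<close>

text \<open>\<open>bfv_bracket\<close> characterises \<open>br\<close> by axioms on homogeneous
  elements and gives no formula, so every bracket is evaluated by peeling off factors with the
  Leibniz rule until only generators and multivector fields remain. The same axioms supply the facts
  about the Schouten bracket, such as its degree and its Jacobi identity, that would be laborious to
  derive from shuffle sums. Since Leibniz rule and antisymmetry carry signs depending on degrees,
  elements of \<K> are handled through an inductive description that keeps track of the degree,
  \<open>homogeneous_K\<close>. Writing \<open>Q\<close> and \<open>\<Pi>\<close> with linear maps
  out of \<gg> and \<hh> turns contraction with structure constants into linearity, and the
  cancellations into relabellings of sums. The operator \<open>{\<Pi>, \<cdot>}\<close> does not
  preserve \<K>: its values on generators are vector fields and combinations of the
  \<open>v\<^sup>*\<close> or of the \<open>u\<close>. Only a second bracket leads back into \<K>,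
  so closure under the derived bracket needs an argument of its own.\<close>

lemma Ck_on_const: "Ck_on k U (\<lambda>x. c)"
proof (induction k arbitrary: c)
  case (Suc k)
  show ?case
    by (auto intro!: exI[of _ "\<lambda>x w. 0"] Suc derivative_eq_intros)
qed auto

text \<open>The product rule multiplies each factor by a derivative of the other, so the induction
  for products needs the factors themselves in class \<open>Ck_on k\<close> and not only in
  \<open>Ck_on (Suc k)\<close>.\<close>

lemma Ck_on_Suc_imp: "Ck_on (Suc k) U f \<Longrightarrow> Ck_on k U f"
proof (induction k arbitrary: f)
  case 0
  then show ?case
    by (auto intro!: continuous_at_imp_continuous_on intro: has_derivative_continuous)
next
  case (Suc k)
  then obtain D where "\<forall>x\<in>U. (f has_derivative D x) (at x)" "\<forall>w. Ck_on (Suc k) U (\<lambda>x. D x w)"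
    by auto
  with Suc.IH show ?case by (metis Ck_on.simps(2))
qed

lemma Ck_on_add:
  fixes f g :: "'e::real_normed_vector \<Rightarrow> 'f::real_normed_vector"
  shows "Ck_on k U f \<Longrightarrow> Ck_on k U g \<Longrightarrow> Ck_on k U (\<lambda>x. f x + g x)"
proof (induction k arbitrary: f g)
  case 0
  then show ?case by (auto intro: continuous_on_add)
next
  case (Suc k)
  obtain D where D: "\<forall>x\<in>U. (f has_derivative D x) (at x)" "\<forall>w. Ck_on k U (\<lambda>x. D x w)"
    using Suc.prems(1) by auto
  obtain E where E: "\<forall>x\<in>U. (g has_derivative E x) (at x)" "\<forall>w. Ck_on k U (\<lambda>x. E x w)"
    using Suc.prems(2) by auto
  show ?case
    using D E by (auto intro!: exI[of _ "\<lambda>x w. D x w + E x w"] Suc.IH has_derivative_add)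
qed

lemma Ck_on_mult:
  fixes f g :: "'e::real_normed_vector \<Rightarrow> real"
  shows "Ck_on k U f \<Longrightarrow> Ck_on k U g \<Longrightarrow> Ck_on k U (\<lambda>x. f x * g x)"
proof (induction k arbitrary: f g)
  case 0
  then show ?case by (auto intro: continuous_on_mult)
next
  case (Suc k)
  obtain D where D: "\<forall>x\<in>U. (f has_derivative D x) (at x)" "\<forall>w. Ck_on k U (\<lambda>x. D x w)"
    using Suc.prems(1) by auto
  obtain E where E: "\<forall>x\<in>U. (g has_derivative E x) (at x)" "\<forall>w. Ck_on k U (\<lambda>x. E x w)"
    using Suc.prems(2) by auto
  have "Ck_on k U f" "Ck_on k U g"
    using Suc.prems Ck_on_Suc_imp by blast+
  with D E show ?case
    by (auto intro!: exI[of _ "\<lambda>x w. f x * E x w + D x w * g x"] Ck_on_add Suc.IH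
        has_derivative_mult)
qed

lemma const_in_smooth_functions: "(\<lambda>x. r) \<in> smooth_functions \<A>"
  by (auto simp: smooth_functions_def smooth_on_def o_def Ck_on_const)

lemma smooth_functions_add:
  "f \<in> smooth_functions \<A> \<Longrightarrow> g \<in> smooth_functions \<A> \<Longrightarrow> f + g \<in> smooth_functions \<A>"
  by (fastforce simp: smooth_functions_def smooth_on_def o_def plus_fun_def intro!: Ck_on_add)

lemma smooth_functions_mult:
  "f \<in> smooth_functions \<A> \<Longrightarrow> g \<in> smooth_functions \<A> \<Longrightarrow> f * g \<in> smooth_functions \<A>"
  by (fastforce simp: smooth_functions_def smooth_on_def o_def times_fun_def intro!: Ck_on_mult)

lemma one_in_smooth_functions: "1 \<in> smooth_functions \<A>"
  using const_in_smooth_functions[of 1] by (simp add: one_fun_def)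

lemma zero_in_smooth_functions: "0 \<in> smooth_functions \<A>"
  using const_in_smooth_functions[of 0] by (simp add: zero_fun_def)

lemma smooth_functions_scaleR:
  "f \<in> smooth_functions \<A> \<Longrightarrow> r *\<^sub>R f \<in> smooth_functions \<A>"
  using smooth_functions_mult[OF const_in_smooth_functions, of f \<A> r]
  by (simp add: times_fun_def scaleR_fun_def)

lemma subspace_smooth_functions: "subspace (smooth_functions \<A>)"
  by (simp add: subspace_def zero_in_smooth_functions smooth_functions_add smooth_functions_scaleR)


section \<open>Multivector fields\<close>

text \<open>Linearity is split into its two equations and the vanishing clause becomes a
  disjunction, a shape in which the conditions can be proved one by one and cited by
  automation.\<close>

lemma multivector_fields_iff:
  "P \<in> multivector_fields \<A> r \<longleftrightarrow>
     (\<forall>fs. int (length fs) = r \<and> set fs \<subseteq> smooth_functions \<A> \<or> P fs = 0) \<and>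
     (\<forall>fs. set fs \<subseteq> smooth_functions \<A> \<longrightarrow> P fs \<in> smooth_functions \<A>) \<and>
     (\<forall>fs gs. \<forall>f\<in>smooth_functions \<A>. \<forall>g\<in>smooth_functions \<A>.
        P (fs @ (f + g) # gs) = P (fs @ f # gs) + P (fs @ g # gs)) \<and>
     (\<forall>fs gs s. \<forall>f\<in>smooth_functions \<A>. P (fs @ (s *\<^sub>R f) # gs) = s *\<^sub>R P (fs @ f # gs)) \<and>
     (\<forall>fs f g hs. P (fs @ f # g # hs) = - P (fs @ g # f # hs)) \<and>
     (\<forall>fs gs. \<forall>f\<in>smooth_functions \<A>. \<forall>g\<in>smooth_functions \<A>.
        P (fs @ (f * g) # gs) = f * P (fs @ g # gs) + g * P (fs @ f # gs))"
  unfolding multivector_fields_def lin_on_def by blast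

text \<open>Every clause is linear over functions in the value of \<open>P\<close>. The factor
  stands on the right because coefficients of BFV products have the form
  \<open>a j fs * b (m - j) []\<close>; constant \<open>f\<close> gives the scalar
  multiples.\<close>

lemma multivector_fields_mult:
  assumes P: "P \<in> multivector_fields \<A> r" and f: "f \<in> smooth_functions \<A>"
  shows "(\<lambda>fs. P fs * f) \<in> multivector_fields \<A> r"
  unfolding multivector_fields_iff
proof (intro conjI allI ballI impI)
  note P' = P[unfolded multivector_fields_iff]
  fix fs gs g h s and k l :: "'a \<Rightarrow> real"
  show "int (length fs) = r \<and> set fs \<subseteq> smooth_functions \<A> \<or> P fs * f = 0"
    using P' by (metis mult_zero_left)
  show "P fs * f \<in> smooth_functions \<A>" if "set fs \<subseteq> smooth_functions \<A>"
    using P' f that by (blast intro: smooth_functions_mult)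
  show "P (fs @ k # l # gs) * f = - (P (fs @ l # k # gs) * f)"
    using P' by (metis mult_minus_left)
  assume g: "g \<in> smooth_functions \<A>"
  have "P (fs @ (s *\<^sub>R g) # gs) = s *\<^sub>R P (fs @ g # gs)" using P' g by blast
  then show "P (fs @ (s *\<^sub>R g) # gs) * f = s *\<^sub>R (P (fs @ g # gs) * f)"
    by (simp add: fun_eq_iff)
  assume h: "h \<in> smooth_functions \<A>"
  have "P (fs @ (g + h) # gs) = P (fs @ g # gs) + P (fs @ h # gs)" using P' g h by blast
  then show "P (fs @ (g + h) # gs) * f = P (fs @ g # gs) * f + P (fs @ h # gs) * f"
    by (simp add: algebra_simps)
  have "P (fs @ (g * h) # gs) = g * P (fs @ h # gs) + h * P (fs @ g # gs)" using P' g h by blast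
  then show "P (fs @ (g * h) # gs) * f = g * (P (fs @ h # gs) * f) + h * (P (fs @ g # gs) * f)"
    by (simp add: algebra_simps)
qed

lemma subspace_multivector_fields: "subspace (multivector_fields \<A> r)"
  unfolding subspace_def
proof (intro conjI ballI allI)
  show "0 \<in> multivector_fields \<A> r"
    by (simp add: multivector_fields_iff zero_in_smooth_functions)
next
  fix P R
  assume "P \<in> multivector_fields \<A> r" "R \<in> multivector_fields \<A> r"
  then have P: "P \<in> multivector_fields \<A> r" and R: "R \<in> multivector_fields \<A> r" .
  note P' = P[unfolded multivector_fields_iff] and R' = R[unfolded multivector_fields_iff]
  show "P + R \<in> multivector_fields \<A> r"
    unfolding multivector_fields_iff
  proof (intro conjI allI ballI impI)
    fix fs gs g h s and k l :: "'a \<Rightarrow> real"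
    show "int (length fs) = r \<and> set fs \<subseteq> smooth_functions \<A> \<or> (P + R) fs = 0"
      using P' R' by (metis add_0 plus_fun_apply)
    show "(P + R) fs \<in> smooth_functions \<A>" if "set fs \<subseteq> smooth_functions \<A>"
      using P' R' that by (simp add: smooth_functions_add)
    have "P (fs @ k # l # gs) = - P (fs @ l # k # gs)" using P' by metis
    moreover have "R (fs @ k # l # gs) = - R (fs @ l # k # gs)" using R' by metis
    ultimately show "(P + R) (fs @ k # l # gs) = - (P + R) (fs @ l # k # gs)" by simp
    assume g: "g \<in> smooth_functions \<A>"
    show "(P + R) (fs @ (s *\<^sub>R g) # gs) = s *\<^sub>R (P + R) (fs @ g # gs)"
      using P' R' g by (simp add: scaleR_right_distrib)
    assume h: "h \<in> smooth_functions \<A>"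
    show "(P + R) (fs @ (g + h) # gs) = (P + R) (fs @ g # gs) + (P + R) (fs @ h # gs)"
      using P' R' g h by simp
    show "(P + R) (fs @ (g * h) # gs) = g * (P + R) (fs @ h # gs) + h * (P + R) (fs @ g # gs)"
      using P' R' g h by (simp add: algebra_simps)
  qed
next
  fix s P
  assume P: "P \<in> multivector_fields \<A> r"
  have "(\<lambda>fs. P fs * (\<lambda>x. s)) = s *\<^sub>R P"
    by (simp add: fun_eq_iff)
  with multivector_fields_mult[OF P const_in_smooth_functions, of s]
  show "s *\<^sub>R P \<in> multivector_fields \<A> r" by simp
qed

lemma mv_of_fun_in_multivector_fields:
  "f \<in> smooth_functions \<A> \<Longrightarrow> mv_of_fun f \<in> multivector_fields \<A> 0"
  by (auto simp: multivector_fields_def mv_of_fun_def zero_in_smooth_functions lin_on_def)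

lemma multivector_fields_eq_0:
  "P \<in> multivector_fields \<A> r \<Longrightarrow> int (length fs) \<noteq> r \<Longrightarrow> P fs = 0"
  by (auto simp: multivector_fields_def)

lemma multivector_fields_0:
  assumes "P \<in> multivector_fields \<A> 0"
  shows "P [] \<in> smooth_functions \<A>" "P = mv_of_fun (P [])"
  using assms by (auto simp: multivector_fields_def mv_of_fun_def fun_eq_iff)

text \<open>The empty list has the single shuffle \<open>S = {}\<close>, and the second summand
  evaluates \<open>mv_of_fun f\<close> on a nonempty list, which gives zero.\<close>

lemma schouten_fun_Nil: "schouten X (mv_of_fun f) [] = X [f]"
  by (simp add: schouten_def mv_of_fun_def shuffle_sign_def)

lemma vector_field_eqI:
  assumes "X \<in> multivector_fields \<A> 1" "Y \<in> multivector_fields \<A> 1"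
    and "\<And>f. f \<in> smooth_functions \<A> \<Longrightarrow> schouten X (mv_of_fun f) = schouten Y (mv_of_fun f)"
  shows "X = Y"
proof
  fix fs :: "('a \<Rightarrow> real) list"
  show "X fs = Y fs"
  proof (cases "int (length fs) = 1 \<and> set fs \<subseteq> smooth_functions \<A>")
    case True
    then obtain f where "fs = [f]" by (cases fs) auto
    with True assms(3)[of f] show ?thesis by (metis schouten_fun_Nil list.set_intros(1) subsetD)
  next
    case False
    with assms(1,2) show ?thesis by (simp add: multivector_fields_def)
  qed
qed

text \<open>The minus sign comes from the position set \<open>{}\<close>, where
  \<open>card T * (card S + 1) = 1\<close>. The position set \<open>{0}\<close> inserts
  \<open>mv_of_fun f [g] = 0\<close> into \<open>W\<close>, which vanishes on lists of length
  1.\<close>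

lemma schouten_bivector_fun:
  assumes "W \<in> multivector_fields \<A> 2"
  shows "schouten W (mv_of_fun f) [g] = - W [f, g]"
proof -
  have W: "W [0] = 0" using multivector_fields_eq_0[OF assms, of "[0]"] by simp
  have P: "Pow {..<Suc 0} = {{}, {0}}" by (auto simp: lessThan_Suc)
  show ?thesis
    using W by (simp add: schouten_def mv_of_fun_def shuffle_sign_def P)
qed

lemma bivector_field_eq_0I:
  assumes W: "W \<in> multivector_fields \<A> 2"
    and 0: "\<And>f. f \<in> smooth_functions \<A> \<Longrightarrow> schouten W (mv_of_fun f) = 0"
  shows "W = 0"
proof
  fix fs :: "('a \<Rightarrow> real) list"
  show "W fs = 0 fs"
  proof (cases "int (length fs) = 2 \<and> set fs \<subseteq> smooth_functions \<A>")
    case True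
    then obtain f g where "fs = [f, g]"
      by (cases fs; cases "tl fs") auto
    with True 0[of f] schouten_bivector_fun[OF W, of f g] show ?thesis by auto
  next
    case False
    with W show ?thesis by (simp add: multivector_fields_def)
  qed
qed

section \<open>Signs of products of monomials\<close>

lemma koszul_add: "koszul (a + b) = koszul a * koszul b"
  by (simp add: koszul_def)

lemma koszul_mult_self: "koszul a * koszul a = 1"
  by (simp add: koszul_def)

lemma koszul_of_nat: "koszul (int n) = (-1) ^ n"
  by (simp add: koszul_def)

definition odd_disjoint :: "gen multiset \<Rightarrow> gen multiset \<Rightarrow> bool" where
  "odd_disjoint m n \<longleftrightarrow> \<not> (\<exists>x. x \<in># m \<and> x \<in># n \<and> odd (gen_deg x))"

text \<open>The transpositions of odd generators needed to bring the product of \<open>m\<close> and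
  \<open>n\<close> into normal order. Pairs are taken from the underlying sets, since an odd
  generator occurs at most once in a monomial.\<close>

definition inversions :: "gen multiset \<Rightarrow> gen multiset \<Rightarrow> (gen \<times> gen) set" where
  "inversions m n = {(x, y). x \<in># m \<and> y \<in># n \<and> odd_before y x}"

lemma mono_sign_eq:
  "mono_sign m n = (if odd_disjoint m n then koszul (int (card (inversions m n))) else 0)"
  by (auto simp: mono_sign_def odd_disjoint_def inversions_def koszul_of_nat)

lemma odd_before_odd: "odd_before x y \<Longrightarrow> odd (gen_deg x) \<and> odd (gen_deg y)"
  by (cases x; cases y) auto

lemma odd_before_linear:
  "odd (gen_deg x) \<Longrightarrow> odd (gen_deg y) \<Longrightarrow> x \<noteq> y \<Longrightarrow> odd_before x y \<longleftrightarrow> \<not> odd_before y x"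
  by (cases x; cases y) auto

lemma finite_inversions: "finite (inversions m n)"
  by (rule finite_subset[of _ "set_mset m \<times> set_mset n"]) (auto simp: inversions_def)

text \<open>Inversions involve odd generators only, so a pair counted for both \<open>m\<close> and
  \<open>n\<close> would exhibit an odd generator common to them.\<close>

lemma card_inversions_add_left:
  assumes "odd_disjoint m n"
  shows "card (inversions (m + n) r) = card (inversions m r) + card (inversions n r)"
proof -
  have "inversions (m + n) r = inversions m r \<union> inversions n r"
    by (auto simp: inversions_def)
  moreover have "inversions m r \<inter> inversions n r = {}"
    using assms odd_before_odd by (fastforce simp: inversions_def odd_disjoint_def)
  ultimately show ?thesis by (simp add: card_Un_disjoint finite_inversions)
qed

lemma card_inversions_add_right:
  assumes "odd_disjoint n r"
  shows "card (inversions m (n + r)) = card (inversions m n) + card (inversions m r)"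
proof -
  have "inversions m (n + r) = inversions m n \<union> inversions m r"
    by (auto simp: inversions_def)
  moreover have "inversions m n \<inter> inversions m r = {}"
    using assms odd_before_odd by (fastforce simp: inversions_def odd_disjoint_def)
  ultimately show ?thesis by (simp add: card_Un_disjoint finite_inversions)
qed

text \<open>This is associativity on monomials. Both sides count the inversions of the three pairs
  \<open>(m, n)\<close>, \<open>(m, r)\<close>, \<open>(n, r)\<close>, and both are zero as soon as
  one of these pairs shares an odd generator.\<close>

lemma mono_sign_cocycle:
  "mono_sign m n * mono_sign (m + n) r = mono_sign n r * mono_sign m (n + r)"
proof (cases "odd_disjoint m n \<and> odd_disjoint n r \<and> odd_disjoint m r")
  case True
  moreover from True have "odd_disjoint (m + n) r" "odd_disjoint m (n + r)"
    by (auto simp: odd_disjoint_def)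
  ultimately show ?thesis
    by (simp add: mono_sign_eq card_inversions_add_left card_inversions_add_right koszul_add)
next
  case False
  then show ?thesis
    by (auto simp: mono_sign_eq odd_disjoint_def)
qed

lemma mono_deg_add: "mono_deg (m + n) = mono_deg m + mono_deg n"
  by (simp add: mono_deg_def)

text \<open>Modulo 2 the degree counts odd generators with multiplicity, and the hypothesis makes
  all these multiplicities 1.\<close>

lemma even_mono_deg_iff:
  assumes m: "\<forall>x\<in>#m. odd (gen_deg x) \<longrightarrow> count m x = 1"
  shows "even (mono_deg m) \<longleftrightarrow> even (card {x \<in> set_mset m. odd (gen_deg x)})"
proof -
  have "even (mono_deg m) \<longleftrightarrow> even (size (filter_mset (\<lambda>x. odd (gen_deg x)) m))"
    by (induction m) (auto simp: mono_deg_def)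
  moreover have "filter_mset (\<lambda>x. odd (gen_deg x)) m = mset_set {x \<in> set_mset m. odd (gen_deg x)}"
    using m by (auto simp: multiset_eq_iff count_mset_set' not_in_iff)
  ultimately show ?thesis by simp
qed

text \<open>A pair of odd generators, one from \<open>m\<close> and one from \<open>n\<close>, is an
  inversion for exactly one of the two orders of the factors. Hence the two inversion numbers add up
  to the product of the numbers of odd generators, which has the parity of
  \<open>mono_deg m * mono_deg n\<close>.\<close>

lemma mono_sign_commute:
  assumes m: "\<forall>x\<in>#m. odd (gen_deg x) \<longrightarrow> count m x = 1"
    and n: "\<forall>x\<in>#n. odd (gen_deg x) \<longrightarrow> count n x = 1"
  shows "mono_sign m n = koszul (mono_deg m * mono_deg n) * mono_sign n m"
proof (cases "odd_disjoint m n")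
  case True
  then have nm: "odd_disjoint n m" by (auto simp: odd_disjoint_def)
  let ?O = "\<lambda>m. {x \<in> set_mset m. odd (gen_deg x)}"
  let ?I = "{(x, y). x \<in># m \<and> y \<in># n \<and> odd_before x y}"
  have swap: "?I = prod.swap ` inversions n m"
    by (force simp: inversions_def)
  then have I: "card ?I = card (inversions n m)" "finite ?I"
    by (simp_all add: card_image finite_inversions)
  have lin: "odd_before y x \<longleftrightarrow> \<not> odd_before x y"
    if "x \<in># m" "y \<in># n" "odd (gen_deg x)" "odd (gen_deg y)" for x y
    using that True odd_before_linear[of y x] by (auto simp: odd_disjoint_def)
  have un: "?O m \<times> ?O n = inversions m n \<union> ?I"
    using lin odd_before_odd unfolding inversions_def by blast
  have int: "inversions m n \<inter> ?I = {}"
    using lin odd_before_odd unfolding inversions_def by blast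
  have "card (?O m) * card (?O n) = card (?O m \<times> ?O n)"
    by simp
  also have "\<dots> = card (inversions m n) + card (inversions n m)"
    unfolding un using int I finite_inversions by (simp add: card_Un_disjoint)
  finally have card: "card (?O m) * card (?O n) = card (inversions m n) + card (inversions n m)" .
  have "even (mono_deg m * mono_deg n) \<longleftrightarrow> even (card (?O m) * card (?O n))"
    unfolding even_mult_iff even_mono_deg_iff[OF m] even_mono_deg_iff[OF n] ..
  then have "koszul (mono_deg m * mono_deg n) =
      koszul (int (card (inversions m n))) * koszul (int (card (inversions n m)))"
    unfolding card by (simp add: koszul_def)
  then show ?thesis
    using True nm koszul_mult_self[of "int (card (inversions n m))"]
    by (simp add: mono_sign_eq mult.assoc)
next
  case False
  then show ?thesis by (auto simp: mono_sign_eq odd_disjoint_def)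
qed

lemma mono_sign_empty [simp]: "mono_sign {#} m = 1" "mono_sign m {#} = 1"
  by (simp_all add: mono_sign_def)

lemma mono_deg_empty [simp]: "mono_deg {#} = 0"
  by (simp add: mono_deg_def)

lemma koszul_0 [simp]: "koszul 0 = 1"
  by (simp add: koszul_def)


section \<open>The product of the BFV algebra\<close>

lemma sum_fun_apply: "(\<Sum>i\<in>I. f i) x = (\<Sum>i\<in>I. f i x)"
  by (induction I rule: infinite_finite_induct) simp_all

lemma fun_mult_scaleR:
  fixes f g :: "'a \<Rightarrow> real"
  shows "(r *\<^sub>R f) * g = r *\<^sub>R (f * g)" "f * (r *\<^sub>R g) = r *\<^sub>R (f * g)"
  by (simp_all add: fun_eq_iff)

lemma fun_sum_mult:
  fixes f :: "'i \<Rightarrow> 'a \<Rightarrow> real"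
  shows "(\<Sum>i\<in>I. f i) * g = (\<Sum>i\<in>I. f i * g)" "g * (\<Sum>i\<in>I. f i) = (\<Sum>i\<in>I. g * f i)"
  by (simp_all add: fun_eq_iff sum_fun_apply sum_distrib_left sum_distrib_right)

lemma wedge_add_left: "wedge (P + P') R = wedge P R + wedge P' R"
  by (simp add: wedge_def fun_eq_iff sum.distrib algebra_simps)

text \<open>The right argument is an abstraction because \<open>bfv_mult\<close> multiplies the
  right coefficient by a sign that depends on the length of its argument list.\<close>

lemma wedge_add_right: "wedge P (\<lambda>fs. R fs + R' fs) = wedge P R + wedge P R'"
  by (simp add: wedge_def fun_eq_iff sum.distrib algebra_simps)

lemma wedge_scaleR_left: "wedge (r *\<^sub>R P) R = r *\<^sub>R wedge P R"
  by (simp add: wedge_def fun_eq_iff sum_fun_apply sum_distrib_left mult_ac)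

lemma wedge_scaleR_right: "wedge P (\<lambda>fs. r *\<^sub>R R fs) = r *\<^sub>R wedge P R"
  by (simp add: wedge_def fun_eq_iff sum_fun_apply sum_distrib_left mult_ac)

lemma star_add_left: "(a + a') \<star> b = a \<star> b + a' \<star> b"
  by (simp add: bfv_mult_def fun_eq_iff wedge_add_left sum.distrib algebra_simps)

lemma star_add_right: "a \<star> (b + b') = a \<star> b + a \<star> b'"
  by (simp add: bfv_mult_def fun_eq_iff scaleR_right_distrib wedge_add_right sum.distrib
      distrib_left)

lemma star_scaleR_left: "(r *\<^sub>R a) \<star> b = r *\<^sub>R (a \<star> b)"
  by (simp add: bfv_mult_def fun_eq_iff wedge_scaleR_left sum_fun_apply sum_distrib_left mult_ac)

lemma star_scaleR_right: "a \<star> (r *\<^sub>R b) = r *\<^sub>R (a \<star> b)"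
proof -
  have w: "wedge (a k) (\<lambda>hs. s hs *\<^sub>R (r *\<^sub>R b) n hs) = r *\<^sub>R wedge (a k) (\<lambda>hs. s hs *\<^sub>R b n hs)"
    for k n s
    by (subst wedge_scaleR_right[symmetric]) (simp add: mult.commute)
  show ?thesis
    unfolding bfv_mult_def w
    by (simp add: fun_eq_iff sum_fun_apply sum_distrib_left mult_ac)
qed

lemma star_0_left [simp]: "0 \<star> b = 0"
  using star_scaleR_left[of 0] by simp

lemma star_0_right [simp]: "a \<star> 0 = 0"
  using star_scaleR_right[of _ 0] by simp

lemma star_minus_left: "(- a) \<star> b = - (a \<star> b)"
  using star_scaleR_left[of "-1"] by simp

lemma star_minus_right: "a \<star> (- b) = - (a \<star> b)"
  using star_scaleR_right[of _ "-1"] by simp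

lemma star_sum_left: "(\<Sum>i\<in>I. f i) \<star> b = (\<Sum>i\<in>I. f i \<star> b)"
  using sum_comp_morphism[of "\<lambda>a. a \<star> b" f I] by (simp add: star_add_left o_def)

lemma star_sum_right: "a \<star> (\<Sum>i\<in>I. f i) = (\<Sum>i\<in>I. a \<star> f i)"
  using sum_comp_morphism[of "\<lambda>b. a \<star> b" f I] by (simp add: star_add_right o_def)

lemmas star_linear = star_add_left star_add_right star_scaleR_left star_scaleR_right
  star_minus_left star_minus_right star_sum_left star_sum_right

text \<open>Only products whose right factor has functions as coefficients are ever reassociated, which avoids
  associativity of the wedge product of multivector fields.\<close>

definition fun_coeff :: "'m bfv \<Rightarrow> bool" where
  "fun_coeff a \<longleftrightarrow> (\<forall>m fs. fs \<noteq> [] \<longrightarrow> a m fs = 0)"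

text \<open>Every shuffle except the one that hands the whole list to \<open>P\<close> leaves a
  nonempty list for \<open>R\<close>.\<close>

lemma wedge_fun_right:
  assumes "\<And>hs. hs \<noteq> [] \<Longrightarrow> R hs = 0"
  shows "wedge P R fs = P fs * R []"
proof -
  let ?n = "length fs"
  let ?g = "\<lambda>S. shuffle_sign ?n S *\<^sub>R (P (nths fs S) * R (nths fs (- S)))"
  have "?g S = 0" if "S \<in> Pow {..<?n} - {{..<?n}}" for S
  proof -
    from that obtain i where "i < ?n" "i \<notin> S" by auto
    then have "{i. i < ?n \<and> i \<in> - S} \<noteq> {}" by blast
    then have "length (nths fs (- S)) \<noteq> 0" by (simp add: length_nths)
    then show ?thesis using assms by auto
  qed
  then have "wedge P R fs = (\<Sum>S\<in>{{..<?n}}. ?g S)"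
    unfolding wedge_def by (intro sum.mono_neutral_right) auto
  moreover have "nths fs {..<?n} = fs" "nths fs (- {..<?n}) = []"
    by (simp_all add: nths_all flip: length_0_conv) (simp add: length_nths)
  ultimately show ?thesis
    by (simp add: shuffle_sign_def)
qed

lemma wedge_fun_left:
  assumes "\<And>hs. hs \<noteq> [] \<Longrightarrow> P hs = 0"
  shows "wedge P R fs = P [] * R fs"
proof -
  let ?n = "length fs"
  let ?g = "\<lambda>S. shuffle_sign ?n S *\<^sub>R (P (nths fs S) * R (nths fs (- S)))"
  have "?g S = 0" if "S \<in> Pow {..<?n} - {{}}" for S
  proof -
    from that obtain i where "i < ?n" "i \<in> S" by auto
    then have "{i. i < ?n \<and> i \<in> S} \<noteq> {}" by blast
    then have "length (nths fs S) \<noteq> 0" by (simp add: length_nths)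
    then show ?thesis using assms by auto
  qed
  then have "wedge P R fs = (\<Sum>S\<in>{{}}. ?g S)"
    unfolding wedge_def by (intro sum.mono_neutral_right) auto
  then show ?thesis
    by (simp add: shuffle_sign_def nths_all)
qed

text \<open>The coefficients of \<open>b\<close> are evaluated at the empty list only, where the
  Koszul sign of \<open>bfv_mult\<close> is 1.\<close>

lemma star_fun_coeff_right:
  assumes "fun_coeff b"
  shows "(a \<star> b) m fs = (\<Sum>k | k \<subseteq># m. mono_sign k (m - k) *\<^sub>R (a k fs * b (m - k) []))"
  using assms by (simp add: bfv_mult_def fun_coeff_def wedge_fun_right sum_fun_apply)

lemma star_fun_coeff_left:
  assumes "fun_coeff a"
  shows "(a \<star> b) m fs = (\<Sum>k | k \<subseteq># m. mono_sign k (m - k) *\<^sub>R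
    koszul (mono_deg k * int (length fs)) *\<^sub>R (a k [] * b (m - k) fs))"
  using assms by (simp add: bfv_mult_def fun_coeff_def wedge_fun_left sum_fun_apply fun_mult_scaleR)

lemma fun_coeff_star: "fun_coeff a \<Longrightarrow> fun_coeff b \<Longrightarrow> fun_coeff (a \<star> b)"
  unfolding fun_coeff_def[of "a \<star> b"] by (simp add: star_fun_coeff_right) (simp add: fun_coeff_def)

lemma finite_submultisets [simp]: "finite {k. k \<subseteq># m}"
proof (induction m)
  case (add x m)
  have "k \<in> {k. k \<subseteq># m} \<union> add_mset x ` {k. k \<subseteq># m}" if "k \<subseteq># add_mset x m" for k
  proof (cases "x \<in># k")
    case True
    then obtain j where "k = add_mset x j" by (metis mset_add)
    with that show ?thesis by simp
  next
    case False
    with that have "k \<subseteq># m" by (metis diff_single_trivial subset_eq_diff_conv add_mset_add_single)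
    then show ?thesis by simp
  qed
  then show ?case
    using add by (auto intro: finite_subset[of _ "{k. k \<subseteq># m} \<union> add_mset x ` {k. k \<subseteq># m}"])
qed simp

text \<open>Both sides are sums over the decompositions of \<open>m\<close> into three parts, with
  products of functions as coefficients; the signs agree by \<open>mono_sign_cocycle\<close>. The
  left factor may have arbitrary multivector coefficients, since it is only multiplied by
  functions.\<close>

lemma star_assoc:
  assumes b: "fun_coeff b" and c: "fun_coeff c"
  shows "(a \<star> b) \<star> c = a \<star> (b \<star> c)"
proof (intro ext)
  fix m fs x
  have "((a \<star> b) \<star> c) m fs =
      (\<Sum>k | k \<subseteq># m. \<Sum>j | j \<subseteq># k. (mono_sign k (m - k) * mono_sign j (k - j)) *\<^sub>R
        (a j fs * b (k - j) [] * c (m - k) []))"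
    by (simp add: star_fun_coeff_right b c fun_sum_mult fun_mult_scaleR scaleR_sum_right)
  also have "\<dots> = (\<Sum>(k, j)\<in>(SIGMA k:{k. k \<subseteq># m}. {j. j \<subseteq># k}). (mono_sign k (m - k) * mono_sign j (k - j)) *\<^sub>R
        (a j fs * b (k - j) [] * c (m - k) []))"
    by (simp add: sum.Sigma)
  also have "\<dots> = (\<Sum>(j, n)\<in>(SIGMA j:{j. j \<subseteq># m}. {n. n \<subseteq># m - j}).
      (mono_sign j (m - j) * mono_sign n (m - j - n)) *\<^sub>R
        (a j fs * b n [] * c (m - j - n) []))"
  \<comment> \<open>The old indices are the part \<open>k\<close> of \<open>m\<close> belonging to
    \<open>a \<star> b\<close> and the part \<open>j\<close> of \<open>k\<close> belonging to
    \<open>a\<close>; the new ones are \<open>j\<close> and the part \<open>n = k - j\<close>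
    belonging to \<open>b\<close>.\<close>
  proof (rule sum.reindex_bij_witness[of _ "\<lambda>(j, n). (j + n, j)" "\<lambda>(k, j). (j, k - j)"])
    fix z assume "z \<in> (SIGMA k:{k. k \<subseteq># m}. {j. j \<subseteq># k})"
    then obtain k j where z: "z = (k, j)" "k \<subseteq># m" "j \<subseteq># k" by auto
    then obtain n r where nr: "k = j + n" "m = j + n + r" by (metis mset_subset_eq_exists_conv)
    show "(case case z of (k, j) \<Rightarrow> (j, k - j) of (j, n) \<Rightarrow> (j + n, j)) = z"
      using z nr by simp
    show "(case z of (k, j) \<Rightarrow> (j, k - j)) \<in> (SIGMA j:{j. j \<subseteq># m}. {n. n \<subseteq># m - j})"
      using z nr by (simp add: add.assoc)
    show "(case (case z of (k, j) \<Rightarrow> (j, k - j)) of (j, n) \<Rightarrow>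
        (mono_sign j (m - j) * mono_sign n (m - j - n)) *\<^sub>R (a j fs * b n [] * c (m - j - n) [])) =
       (case z of (k, j) \<Rightarrow> (mono_sign k (m - k) * mono_sign j (k - j)) *\<^sub>R
        (a j fs * b (k - j) [] * c (m - k) []))"
      using z nr mono_sign_cocycle[of j n r] by (simp add: add.assoc mult.commute)
  next
    fix z assume "z \<in> (SIGMA j:{j. j \<subseteq># m}. {n. n \<subseteq># m - j})"
    then obtain j n where z: "z = (j, n)" "j \<subseteq># m" "n \<subseteq># m - j" by auto
    then obtain r where r: "m = j + n + r"
      by (metis add.assoc mset_subset_eq_exists_conv subset_mset.add_diff_inverse)
    show "(case case z of (j, n) \<Rightarrow> (j + n, j) of (k, j) \<Rightarrow> (j, k - j)) = z"
      using z by simp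
    show "(case z of (j, n) \<Rightarrow> (j + n, j)) \<in> (SIGMA k:{k. k \<subseteq># m}. {j. j \<subseteq># k})"
      using z r by simp
  qed
  also have "\<dots> = (\<Sum>j | j \<subseteq># m. \<Sum>n | n \<subseteq># m - j.
      (mono_sign j (m - j) * mono_sign n (m - j - n)) *\<^sub>R
        (a j fs * b n [] * c (m - j - n) []))"
    by (simp add: sum.Sigma)
  also have "\<dots> = (a \<star> (b \<star> c)) m fs"
    unfolding star_fun_coeff_right[OF fun_coeff_star[OF b c]] star_fun_coeff_right[OF c]
    by (simp add: fun_sum_mult fun_mult_scaleR scaleR_sum_right mult.assoc)
  finally show "((a \<star> b) \<star> c) m fs x = (a \<star> (b \<star> c)) m fs x" by simp
qed

lemma star_mv_left:
  assumes "fun_coeff b"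
  shows "(bfv_mv P \<star> b) m fs = P fs * b m []"
proof -
  have "(bfv_mv P \<star> b) m fs = (\<Sum>k\<in>{{#}}. mono_sign k (m - k) *\<^sub>R (bfv_mv P k fs * b (m - k) []))"
    unfolding star_fun_coeff_right[OF assms]
    by (rule sum.mono_neutral_right) (auto simp: bfv_mv_def)
  then show ?thesis by (simp add: bfv_mv_def)
qed

lemma star_mv_right:
  assumes "fun_coeff b"
  shows "(b \<star> bfv_mv P) m fs = koszul (mono_deg m * int (length fs)) *\<^sub>R (b m [] * P fs)"
proof -
  have "bfv_mv P (m - k) = 0" if "k \<subseteq># m" "k \<noteq> m" for k
    using that by (auto simp: bfv_mv_def Diff_eq_empty_iff_mset)
  then have "(b \<star> bfv_mv P) m fs = (\<Sum>k\<in>{m}. mono_sign k (m - k) *\<^sub>R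
    koszul (mono_deg k * int (length fs)) *\<^sub>R (b k [] * bfv_mv P (m - k) fs))"
    unfolding star_fun_coeff_left[OF assms]
    by (intro sum.mono_neutral_right) auto
  then show ?thesis by (simp add: bfv_mv_def)
qed

lemma fun_coeff_bfv_mv_of_fun [simp]: "fun_coeff (bfv_mv (mv_of_fun f))"
  by (simp add: fun_coeff_def bfv_mv_def mv_of_fun_def)

lemma fun_coeff_gen [simp]: "fun_coeff (bfv_gen x)"
  by (simp add: fun_coeff_def bfv_gen_def mv_of_fun_def)

lemma fun_coeff_one [simp]: "fun_coeff bfv_one"
  by (simp add: bfv_one_def)

lemma fun_coeff_add: "fun_coeff a \<Longrightarrow> fun_coeff b \<Longrightarrow> fun_coeff (a + b)"
  by (simp add: fun_coeff_def)

lemma fun_coeff_scaleR: "fun_coeff a \<Longrightarrow> fun_coeff (r *\<^sub>R a)"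
  by (simp add: fun_coeff_def)

lemma fun_coeff_sum: "(\<And>i. i \<in> I \<Longrightarrow> fun_coeff (f i)) \<Longrightarrow> fun_coeff (\<Sum>i\<in>I. f i)"
  by (simp add: fun_coeff_def sum_fun_apply)

lemma fun_coeff_eqI:
  assumes "fun_coeff a" "fun_coeff b" "\<And>m. a m [] = b m []"
  shows "a = b"
proof (intro ext)
  fix m fs x
  show "a m fs x = b m fs x"
    using assms by (cases "fs = []") (simp_all add: fun_coeff_def)
qed

lemma mv_of_fun_Nil [simp]: "mv_of_fun f [] = f"
  by (simp add: mv_of_fun_def)

lemma star_one_left: "fun_coeff a \<Longrightarrow> bfv_one \<star> a = a"
  by (rule fun_coeff_eqI) (simp_all add: bfv_one_def star_mv_left fun_coeff_star)

lemma star_one_right: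
  fixes a :: "'m bfv"
  shows "a \<star> bfv_one = a"
proof (intro ext)
  fix m fs x
  have "(bfv_one :: 'm bfv) (m - k) = 0" if "k \<subseteq># m" "k \<noteq> m" for k
    using that by (auto simp: bfv_one_def bfv_mv_def Diff_eq_empty_iff_mset)
  then have "(a \<star> bfv_one) m fs = (\<Sum>k\<in>{m}. mono_sign k (m - k) *\<^sub>R (a k fs * bfv_one (m - k) []))"
    unfolding star_fun_coeff_right[OF fun_coeff_one]
    by (intro sum.mono_neutral_right) simp_all
  then show "(a \<star> bfv_one) m fs x = a m fs x"
    by (simp add: bfv_one_def bfv_mv_def mv_of_fun_def)
qed

lemma bfv_spaceD:
  assumes "a \<in> bfv_space \<A> p q k"
  shows "finite {m. a m \<noteq> 0}" "a m \<in> multivector_fields \<A> (k - mono_deg m)"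
    "a m \<noteq> 0 \<Longrightarrow> m \<in> monomials p q"
proof -
  show "finite {m. a m \<noteq> 0}" "a m \<noteq> 0 \<Longrightarrow> m \<in> monomials p q"
    using assms by (auto simp: bfv_space_def)
  show "a m \<in> multivector_fields \<A> (k - mono_deg m)"
  proof (cases "m \<in> monomials p q")
    case False
    then have "a m = 0" using assms by (auto simp: bfv_space_def)
    then show ?thesis by (simp add: subspace_0 subspace_multivector_fields)
  qed (use assms in \<open>auto simp: bfv_space_def\<close>)
qed

lemma bfv_spaceI:
  assumes "finite {m. a m \<noteq> 0}" "\<And>m. a m \<in> multivector_fields \<A> (k - mono_deg m)"
    "\<And>m. m \<notin> monomials p q \<Longrightarrow> a m = 0"
  shows "a \<in> bfv_space \<A> p q k"
  using assms by (simp add: bfv_space_def)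

lemma subspace_bfv_space: "subspace (bfv_space \<A> p q k)"
  unfolding subspace_def
proof (intro conjI ballI allI)
  show "0 \<in> bfv_space \<A> p q k"
    by (simp add: bfv_space_def subspace_0 subspace_multivector_fields)
next
  fix a b assume a: "a \<in> bfv_space \<A> p q k" and b: "b \<in> bfv_space \<A> p q k"
  show "a + b \<in> bfv_space \<A> p q k"
  proof (rule bfv_spaceI)
    have "{m. (a + b) m \<noteq> 0} \<subseteq> {m. a m \<noteq> 0} \<union> {m. b m \<noteq> 0}" by auto
    then show "finite {m. (a + b) m \<noteq> 0}"
      using bfv_spaceD(1)[OF a] bfv_spaceD(1)[OF b] by (meson finite_UnI finite_subset)
    show "(a + b) m \<in> multivector_fields \<A> (k - mono_deg m)" for m
      using bfv_spaceD(2)[OF a] bfv_spaceD(2)[OF b]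
      by (simp add: subspace_add subspace_multivector_fields)
    show "(a + b) m = 0" if "m \<notin> monomials p q" for m
      using bfv_spaceD(3)[OF a, of m] bfv_spaceD(3)[OF b, of m] that by (metis add_0 plus_fun_apply)
  qed
next
  fix r a assume a: "a \<in> bfv_space \<A> p q k"
  show "r *\<^sub>R a \<in> bfv_space \<A> p q k"
  proof (rule bfv_spaceI)
    have "{m. (r *\<^sub>R a) m \<noteq> 0} \<subseteq> {m. a m \<noteq> 0}" by auto
    then show "finite {m. (r *\<^sub>R a) m \<noteq> 0}"
      using bfv_spaceD(1)[OF a] by (meson finite_subset)
    show "(r *\<^sub>R a) m \<in> multivector_fields \<A> (k - mono_deg m)" for m
      using bfv_spaceD(2)[OF a] by (simp add: subspace_scale subspace_multivector_fields)
    show "(r *\<^sub>R a) m = 0" if "m \<notin> monomials p q" for m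
      using bfv_spaceD(3)[OF a, of m] that by auto
  qed
qed

lemma bfv_mv_in_bfv_space:
  "P \<in> multivector_fields \<A> r \<Longrightarrow> bfv_mv P \<in> bfv_space \<A> p q r"
  by (rule bfv_spaceI)
    (auto simp: bfv_mv_def monomials_def subspace_0 subspace_multivector_fields
      intro: finite_subset[of _ "{{#}}"])

lemma bfv_gen_in_bfv_space:
  "x \<in> generators p q \<Longrightarrow> bfv_gen x \<in> bfv_space \<A> p q (gen_deg x)"
  by (rule bfv_spaceI)
    (auto simp: bfv_gen_def monomials_def mono_deg_def subspace_0 subspace_multivector_fields
      mv_of_fun_in_multivector_fields one_in_smooth_functions intro: finite_subset[of _ "{{#x#}}"])

text \<open>A coefficient that is nonzero on the empty list has degree 0 as a multivector field, so
  its monomial carries the whole degree.\<close>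

lemma fun_coeff_mono_deg:
  assumes "fun_coeff a" "a \<in> bfv_space \<A> p q k" "a m [] \<noteq> 0"
  shows "mono_deg m = k"
  using multivector_fields_eq_0[OF bfv_spaceD(2)[OF assms(2)], of "[]" m] assms(3) by auto

lemma monomials_mono_sign:
  assumes "m \<in> monomials p q" "n \<in> monomials p q" "mono_sign m n \<noteq> 0"
  shows "m + n \<in> monomials p q"
proof -
  have "odd_disjoint m n" using assms(3) by (auto simp: mono_sign_eq split: if_splits)
  then have "count m x = 0 \<or> count n x = 0" if "odd (gen_deg x)" for x
    using that by (metis odd_disjoint_def not_in_iff)
  with assms(1,2) show ?thesis
    unfolding monomials_def
    by (auto simp flip: not_in_iff)
qed

text \<open>Each summand is a multivector field times a function, covered by
  \<open>multivector_fields_mult\<close>. The degrees match because \<open>b (m - j) []\<close> can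
  be nonzero only if \<open>mono_deg (m - j) = l\<close>.\<close>

lemma star_in_bfv_space:
  assumes a: "a \<in> bfv_space \<A> p q k" and b: "b \<in> bfv_space \<A> p q l" and fb: "fun_coeff b"
  shows "a \<star> b \<in> bfv_space \<A> p q (k + l)"
proof (rule bfv_spaceI)
  have eq: "(a \<star> b) m = (\<Sum>j | j \<subseteq># m. mono_sign j (m - j) *\<^sub>R (\<lambda>fs. a j fs * b (m - j) []))" for m
    by (simp add: fun_eq_iff star_fun_coeff_right[OF fb] sum_fun_apply)
  have nz: "\<exists>j. j \<subseteq># m \<and> mono_sign j (m - j) \<noteq> 0 \<and> a j \<noteq> 0 \<and> b (m - j) \<noteq> 0"
    if "(a \<star> b) m \<noteq> 0" for m
  proof -
    have "\<not> (\<forall>j\<in>{j. j \<subseteq># m}. mono_sign j (m - j) *\<^sub>R (\<lambda>fs. a j fs * b (m - j) []) = 0)"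
      using that unfolding eq by (rule contrapos_nn) (rule sum.neutral)
    then obtain j where "j \<subseteq># m"
      "mono_sign j (m - j) *\<^sub>R (\<lambda>fs. a j fs * b (m - j) []) \<noteq> 0"
      by blast
    then show ?thesis by (intro exI[of _ j] conjI) (auto simp: fun_eq_iff)
  qed
  have "{m. (a \<star> b) m \<noteq> 0} \<subseteq> (\<lambda>(j, n). j + n) ` ({m. a m \<noteq> 0} \<times> {m. b m \<noteq> 0})"
  proof
    fix m assume "m \<in> {m. (a \<star> b) m \<noteq> 0}"
    then obtain j where "j \<subseteq># m" "a j \<noteq> 0" "b (m - j) \<noteq> 0" using nz by blast
    then show "m \<in> (\<lambda>(j, n). j + n) ` ({m. a m \<noteq> 0} \<times> {m. b m \<noteq> 0})"
      by (intro image_eqI[of _ _ "(j, m - j)"]) auto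
  qed
  then show "finite {m. (a \<star> b) m \<noteq> 0}"
    using bfv_spaceD(1)[OF a] bfv_spaceD(1)[OF b] by (meson finite_SigmaI finite_imageI finite_subset)
  show "(a \<star> b) m = 0" if "m \<notin> monomials p q" for m
  proof (rule ccontr)
    assume "(a \<star> b) m \<noteq> 0"
    then obtain j where j: "j \<subseteq># m" "mono_sign j (m - j) \<noteq> 0" "a j \<noteq> 0" "b (m - j) \<noteq> 0"
      using nz by blast
    with bfv_spaceD(3)[OF a] bfv_spaceD(3)[OF b] monomials_mono_sign[of j p q "m - j"] that
    show False by simp
  qed
  show "(a \<star> b) m \<in> multivector_fields \<A> (k + l - mono_deg m)" for m
    unfolding eq
  proof (intro subspace_sum subspace_scale subspace_multivector_fields)
    fix j assume "j \<in> {j. j \<subseteq># m}"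
    then have jm: "mono_deg m = mono_deg j + mono_deg (m - j)"
      by (simp flip: mono_deg_add)
    show "(\<lambda>fs. a j fs * b (m - j) []) \<in> multivector_fields \<A> (k + l - mono_deg m)"
    proof (cases "b (m - j) [] = 0")
      case True
      then have "(\<lambda>fs. a j fs * b (m - j) []) = 0" by (simp add: fun_eq_iff)
      then show ?thesis by (simp add: subspace_0 subspace_multivector_fields)
    next
      case False
      then have l: "mono_deg (m - j) = l" using fun_coeff_mono_deg[OF fb b] by blast
      then have "b (m - j) \<in> multivector_fields \<A> 0" using bfv_spaceD(2)[OF b, of "m - j"] by simp
      then have "b (m - j) [] \<in> smooth_functions \<A>" by (rule multivector_fields_0)
      with multivector_fields_mult[OF bfv_spaceD(2)[OF a]] l jm show ?thesis by simp
    qed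
  qed
qed

text \<open>The substitution of \<open>m - j\<close> for \<open>j\<close> exchanges the roles of the
  factors. In every nonzero term the two monomials have degrees \<open>k\<close> and
  \<open>l\<close>, so \<open>mono_sign_commute\<close> yields the same sign for all terms.\<close>

lemma star_commute:
  assumes a: "a \<in> bfv_space \<A> p q k" "fun_coeff a" and b: "b \<in> bfv_space \<A> p q l" "fun_coeff b"
  shows "a \<star> b = koszul (k * l) *\<^sub>R (b \<star> a)"
proof (rule fun_coeff_eqI)
  fix m
  have "(a \<star> b) m [] = (\<Sum>j | j \<subseteq># m. mono_sign j (m - j) *\<^sub>R (a j [] * b (m - j) []))"
    by (rule star_fun_coeff_right[OF b(2)])
  also have "\<dots> = (\<Sum>j | j \<subseteq># m. mono_sign (m - j) j *\<^sub>R (a (m - j) [] * b j []))"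
    by (rule sum.reindex_bij_witness[of _ "\<lambda>j. m - j" "\<lambda>j. m - j"])
      (auto simp: subset_mset.diff_diff_right)
  also have "\<dots> = (\<Sum>j | j \<subseteq># m. koszul (k * l) *\<^sub>R (mono_sign j (m - j) *\<^sub>R (b j [] * a (m - j) [])))"
  proof (intro sum.cong refl)
    fix j
    show "mono_sign (m - j) j *\<^sub>R (a (m - j) [] * b j []) =
      koszul (k * l) *\<^sub>R (mono_sign j (m - j) *\<^sub>R (b j [] * a (m - j) []))"
    proof (cases "a (m - j) [] = 0 \<or> b j [] = 0")
      case False
      then have "m - j \<in> monomials p q" "j \<in> monomials p q"
        using bfv_spaceD(3)[OF a(1)] bfv_spaceD(3)[OF b(1)] by (metis zero_fun_apply)+
      then have "mono_sign (m - j) j = koszul (mono_deg (m - j) * mono_deg j) * mono_sign j (m - j)"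
        by (intro mono_sign_commute) (auto simp: monomials_def)
      moreover have "mono_deg (m - j) = k" "mono_deg j = l"
        using False fun_coeff_mono_deg[OF a(2,1)] fun_coeff_mono_deg[OF b(2,1)] by auto
      ultimately show ?thesis by (simp add: mult.commute)
    qed auto
  qed
  also have "\<dots> = (koszul (k * l) *\<^sub>R (b \<star> a)) m []"
    by (simp add: star_fun_coeff_right[OF a(2)] scaleR_sum_right)
  finally show "(a \<star> b) m [] = (koszul (k * l) *\<^sub>R (b \<star> a)) m []" .
qed (use a b in \<open>auto intro: fun_coeff_star fun_coeff_scaleR\<close>)

text \<open>Where the product is nonzero, the monomial has degree \<open>k\<close> and the list has
  length \<open>r\<close>, so the sign in \<open>star_mv_right\<close> is constant.\<close>

lemma star_commute_mv:
  assumes b: "b \<in> bfv_space \<A> p q k" "fun_coeff b" and P: "P \<in> multivector_fields \<A> r"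
  shows "b \<star> bfv_mv P = koszul (k * r) *\<^sub>R (bfv_mv P \<star> b)"
proof (intro ext)
  fix m fs x
  show "(b \<star> bfv_mv P) m fs x = (koszul (k * r) *\<^sub>R (bfv_mv P \<star> b)) m fs x"
  proof (cases "b m [] = 0 \<or> P fs = 0")
    case False
    then have "mono_deg m = k" "int (length fs) = r"
      using fun_coeff_mono_deg[OF b(2,1)] multivector_fields_eq_0[OF P] by auto
    then show ?thesis by (simp add: star_mv_left[OF b(2)] star_mv_right[OF b(2)])
  qed (auto simp: star_mv_left[OF b(2)] star_mv_right[OF b(2)])
qed

section \<open>The subalgebra \<open>\<K>\<close>\<close>

definition ext_monomials :: "nat \<Rightarrow> nat \<Rightarrow> gen multiset set" where
  "ext_monomials p q =
     {m. set_mset m \<subseteq> UStar ` {..<p} \<union> VGen ` {..<q} \<and> (\<forall>x\<in>#m. count m x = 1)}"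

lemma ext_monomials_iff:
  "m \<in> ext_monomials p q \<longleftrightarrow>
     (\<exists>I\<subseteq>{..<p}. \<exists>J\<subseteq>{..<q}. m = mset_set (UStar ` I) + mset_set (VGen ` J))"
proof
  assume m: "m \<in> ext_monomials p q"
  define I where "I = {i \<in> {..<p}. UStar i \<in># m}"
  define J where "J = {j \<in> {..<q}. VGen j \<in># m}"
  have "set_mset m = UStar ` I \<union> VGen ` J"
    using m by (auto simp: ext_monomials_def I_def J_def)
  moreover have "m = mset_set (set_mset m)"
    using m by (auto simp: multiset_eq_iff count_mset_set' ext_monomials_def not_in_iff)
  ultimately have "m = mset_set (UStar ` I \<union> VGen ` J)" by simp
  also have "\<dots> = mset_set (UStar ` I) + mset_set (VGen ` J)"
    by (rule mset_set_Union) (auto simp: I_def J_def)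
  finally have "m = mset_set (UStar ` I) + mset_set (VGen ` J)" .
  moreover have "I \<subseteq> {..<p}" "J \<subseteq> {..<q}" by (auto simp: I_def J_def)
  ultimately show "\<exists>I\<subseteq>{..<p}. \<exists>J\<subseteq>{..<q}. m = mset_set (UStar ` I) + mset_set (VGen ` J)"
    by blast
next
  assume "\<exists>I\<subseteq>{..<p}. \<exists>J\<subseteq>{..<q}. m = mset_set (UStar ` I) + mset_set (VGen ` J)"
  then obtain I J where IJ: "I \<subseteq> {..<p}" "J \<subseteq> {..<q}"
    and m: "m = mset_set (UStar ` I) + mset_set (VGen ` J)" by blast
  have "finite I" "finite J" using IJ finite_subset by blast+
  then have "finite (UStar ` I \<union> VGen ` J)" and "m = mset_set (UStar ` I \<union> VGen ` J)"
    unfolding m by (simp_all, subst mset_set_Union) auto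
  then show "m \<in> ext_monomials p q"
    using IJ by (auto simp: ext_monomials_def)
qed

lemma fun_ext_tensor_iff:
  "a \<in> fun_ext_tensor \<A> p q \<longleftrightarrow>
     fun_coeff a \<and> (\<forall>m. a m [] \<in> smooth_functions \<A>) \<and> (\<forall>m. m \<notin> ext_monomials p q \<longrightarrow> a m [] = 0)"
proof -
  have "a m \<in> mv_of_fun ` smooth_functions \<A> \<longleftrightarrow>
      (\<forall>fs. fs \<noteq> [] \<longrightarrow> a m fs = 0) \<and> a m [] \<in> smooth_functions \<A>" for m
  proof
    assume "(\<forall>fs. fs \<noteq> [] \<longrightarrow> a m fs = 0) \<and> a m [] \<in> smooth_functions \<A>"
    moreover from this have "a m = mv_of_fun (a m [])" by (auto simp: mv_of_fun_def)
    ultimately show "a m \<in> mv_of_fun ` smooth_functions \<A>" by blast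
  next
    assume "a m \<in> mv_of_fun ` smooth_functions \<A>"
    then obtain f where "f \<in> smooth_functions \<A>" "a m = mv_of_fun f" by blast
    then show "(\<forall>fs. fs \<noteq> [] \<longrightarrow> a m fs = 0) \<and> a m [] \<in> smooth_functions \<A>"
      by (simp add: mv_of_fun_def)
  qed
  moreover have "a m = 0 \<longleftrightarrow> (\<forall>fs. fs \<noteq> [] \<longrightarrow> a m fs = 0) \<and> a m [] = 0" for m
    unfolding fun_eq_iff[of "a m"] by (metis zero_fun_apply)
  ultimately show ?thesis
    unfolding fun_ext_tensor_def ext_monomials_iff[symmetric] fun_coeff_def
    by (smt (verit) mem_Collect_eq zero_in_smooth_functions)
qed

text \<open>Makes the expansion of an element of \<open>fun_ext_tensor\<close> over monomials a
  finite sum, although the definition of that set has no clause on finite support.\<close>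

lemma finite_ext_monomials: "finite (ext_monomials p q)"
proof -
  have "ext_monomials p q \<subseteq> mset_set ` Pow (UStar ` {..<p} \<union> VGen ` {..<q})"
  proof
    fix m assume m: "m \<in> ext_monomials p q"
    then have "m = mset_set (set_mset m)"
      by (auto simp: multiset_eq_iff count_mset_set' ext_monomials_def not_in_iff)
    moreover have "set_mset m \<in> Pow (UStar ` {..<p} \<union> VGen ` {..<q})"
      using m by (simp add: ext_monomials_def)
    ultimately show "m \<in> mset_set ` Pow (UStar ` {..<p} \<union> VGen ` {..<q})"
      by (rule image_eqI)
  qed
  then show ?thesis by (rule finite_subset) simp
qed

section \<open>Monomials and homogeneous elements of \<K>\<close>

definition bfv_monom :: "gen multiset \<Rightarrow> 'm bfv" where
  "bfv_monom m = (\<lambda>n. if n = m then mv_of_fun 1 else 0)"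

lemma bfv_gen_eq_monom: "bfv_gen x = bfv_monom {#x#}"
  by (simp add: bfv_gen_def bfv_monom_def)

lemma fun_coeff_monom [simp]: "fun_coeff (bfv_monom m)"
  by (simp add: fun_coeff_def bfv_monom_def mv_of_fun_def)

lemma monom_star_monom:
  "bfv_monom m \<star> bfv_monom n = mono_sign m n *\<^sub>R (bfv_monom (m + n) :: 'm bfv)"
proof (rule fun_coeff_eqI)
  fix r
  let ?f = "\<lambda>k. mono_sign k (r - k) *\<^sub>R
    (bfv_monom m k [] * (bfv_monom n (r - k) []) :: 'm \<Rightarrow> real)"
  have "(bfv_monom m \<star> bfv_monom n :: 'm bfv) r [] = (\<Sum>k | k \<subseteq># r. ?f k)"
    by (rule star_fun_coeff_right) simp
  also have "\<dots> = (\<Sum>k\<in>{k. k \<subseteq># r} \<inter> {m}. ?f k)"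
    by (rule sum.mono_neutral_right) (auto simp: bfv_monom_def)
  also have "\<dots> = (mono_sign m n *\<^sub>R bfv_monom (m + n)) r []"
    by (cases "m \<subseteq># r") (auto simp: bfv_monom_def)
  finally show "(bfv_monom m \<star> bfv_monom n :: 'm bfv) r [] =
    (mono_sign m n *\<^sub>R bfv_monom (m + n)) r []" .
qed (simp_all add: fun_coeff_star fun_coeff_scaleR)

text \<open>The sums in \<open>bfv_K\<close> may mix degrees, whereas the Leibniz rule and
  antisymmetry of the bracket hold for homogeneous arguments. In this variant each element of a
  derivation has a degree, so properties of brackets can be proved by rule induction;
  \<open>mem_bfv_K_space_iff\<close> shows that nothing is lost.\<close>

inductive homogeneous_K ::
    "('m, 'e::real_normed_vector) chart set \<Rightarrow> nat \<Rightarrow> nat \<Rightarrow> int \<Rightarrow> 'm bfv \<Rightarrow> bool"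
  for \<A> :: "('m, 'e) chart set" and p q :: nat where
  zero: "homogeneous_K \<A> p q k 0"
| "fun": "f \<in> smooth_functions \<A> \<Longrightarrow> homogeneous_K \<A> p q 0 (bfv_mv (mv_of_fun f))"
| ustar: "i < p \<Longrightarrow> homogeneous_K \<A> p q 1 (bfv_gen (UStar i))"
| vgen: "j < q \<Longrightarrow> homogeneous_K \<A> p q (-1) (bfv_gen (VGen j))"
| add: "homogeneous_K \<A> p q k a \<Longrightarrow> homogeneous_K \<A> p q k b \<Longrightarrow> homogeneous_K \<A> p q k (a + b)"
| scale: "homogeneous_K \<A> p q k a \<Longrightarrow> homogeneous_K \<A> p q k (r *\<^sub>R a)"
| mult: "homogeneous_K \<A> p q k a \<Longrightarrow> homogeneous_K \<A> p q l b \<Longrightarrow>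
    homogeneous_K \<A> p q (k + l) (a \<star> b)"

lemma homogeneous_K_sum:
  "(\<And>i. i \<in> I \<Longrightarrow> homogeneous_K \<A> p q k (f i)) \<Longrightarrow> homogeneous_K \<A> p q k (\<Sum>i\<in>I. f i)"
  by (induction I rule: infinite_finite_induct) (auto intro: homogeneous_K.intros)

lemma homogeneous_K_minus: "homogeneous_K \<A> p q k a \<Longrightarrow> homogeneous_K \<A> p q k (- a)"
  using homogeneous_K.scale[of \<A> p q k a "-1"] by simp

lemma homogeneous_K_diff:
  "homogeneous_K \<A> p q k a \<Longrightarrow> homogeneous_K \<A> p q k b \<Longrightarrow> homogeneous_K \<A> p q k (a - b)"
  unfolding diff_conv_add_uminus by (intro homogeneous_K.add homogeneous_K_minus)

lemma homogeneous_K_mult: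
  "homogeneous_K \<A> p q k a \<Longrightarrow> homogeneous_K \<A> p q l b \<Longrightarrow> k + l = n \<Longrightarrow>
    homogeneous_K \<A> p q n (a \<star> b)"
  using homogeneous_K.mult by blast

lemma zero_in_bfv_K: "0 \<in> bfv_K \<A> p q"
  using bfv_K.intros(5)[OF bfv_K.intros(1)[OF zero_in_smooth_functions], of 0] by simp

lemma fun_coeff_bfv_K: "a \<in> bfv_K \<A> p q \<Longrightarrow> fun_coeff a"
  by (induction rule: bfv_K.induct)
    (blast intro: fun_coeff_add fun_coeff_scaleR fun_coeff_star fun_coeff_gen fun_coeff_bfv_mv_of_fun)+

lemma homogeneous_K_in_bfv_K: "homogeneous_K \<A> p q k a \<Longrightarrow> a \<in> bfv_K \<A> p q"
  by (induction rule: homogeneous_K.induct) (blast intro: zero_in_bfv_K bfv_K.intros)+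

lemma fun_coeff_homogeneous_K: "homogeneous_K \<A> p q k a \<Longrightarrow> fun_coeff a"
  using homogeneous_K_in_bfv_K fun_coeff_bfv_K by blast

lemma homogeneous_K_in_bfv_space: "homogeneous_K \<A> p q k a \<Longrightarrow> a \<in> bfv_space \<A> p q k"
proof (induction rule: homogeneous_K.induct)
  case (ustar i)
  then show ?case using bfv_gen_in_bfv_space[of "UStar i" p q \<A>] by (simp add: generators_def)
next
  case (vgen j)
  then show ?case using bfv_gen_in_bfv_space[of "VGen j" p q \<A>] by (simp add: generators_def)
next
  case (mult k a l b)
  then show ?case by (intro star_in_bfv_space fun_coeff_homogeneous_K)
qed (blast intro: subspace_0 subspace_add subspace_scale subspace_bfv_space bfv_mv_in_bfv_space
    mv_of_fun_in_multivector_fields)+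

lemma ext_monomials_mono_sign:
  assumes "m \<in> ext_monomials p q" "n \<in> ext_monomials p q" "mono_sign m n \<noteq> 0"
  shows "m + n \<in> ext_monomials p q"
proof -
  have "odd_disjoint m n" using assms(3) by (auto simp: mono_sign_eq split: if_splits)
  moreover have "odd (gen_deg x)" if "x \<in># m" for x
    using that assms(1) by (auto simp: ext_monomials_def)
  ultimately have "count m x = 0 \<or> count n x = 0" for x
    by (metis odd_disjoint_def not_in_iff)
  with assms(1,2) show ?thesis
    unfolding ext_monomials_def by (auto simp flip: not_in_iff)
qed

lemma fun_ext_tensor_star:
  assumes a: "a \<in> fun_ext_tensor \<A> p q" and b: "b \<in> fun_ext_tensor \<A> p q"
  shows "a \<star> b \<in> fun_ext_tensor \<A> p q"
  unfolding fun_ext_tensor_iff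
proof (intro conjI allI impI)
  note a = a[unfolded fun_ext_tensor_iff] and b = b[unfolded fun_ext_tensor_iff]
  have eq: "(a \<star> b) m [] = (\<Sum>k | k \<subseteq># m. mono_sign k (m - k) *\<^sub>R (a k [] * b (m - k) []))" for m
    using b by (intro star_fun_coeff_right) simp
  show "fun_coeff (a \<star> b)" using a b by (simp add: fun_coeff_star)
  show "(a \<star> b) m [] \<in> smooth_functions \<A>" for m
    unfolding eq using a b
    by (intro subspace_sum subspace_scale subspace_smooth_functions smooth_functions_mult) auto
  show "(a \<star> b) m [] = 0" if m: "m \<notin> ext_monomials p q" for m
    unfolding eq
  proof (rule sum.neutral, rule ballI, rule ccontr)
    fix k assume k: "k \<in> {k. k \<subseteq># m}"
      and nz: "mono_sign k (m - k) *\<^sub>R (a k [] * b (m - k) []) \<noteq> 0"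
    then have "a k [] \<noteq> 0" "b (m - k) [] \<noteq> 0" "mono_sign k (m - k) \<noteq> 0" by auto
    then have "k + (m - k) \<in> ext_monomials p q"
      using a b by (intro ext_monomials_mono_sign) blast+
    with k m show False by simp
  qed
qed

lemma bfv_K_subset_fun_ext_tensor: "bfv_K \<A> p q \<subseteq> fun_ext_tensor \<A> p q"
proof
  fix a assume "a \<in> bfv_K \<A> p q"
  then show "a \<in> fun_ext_tensor \<A> p q"
  proof (induction rule: bfv_K.induct)
    case (1 f)
    have "fun_coeff (bfv_mv (mv_of_fun f))" by simp
    with 1 show ?case
      unfolding fun_ext_tensor_iff
      by (auto simp: bfv_mv_def ext_monomials_def zero_in_smooth_functions)
  next
    case (2 i)
    have "fun_coeff (bfv_gen (UStar i))" by simp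
    with 2 show ?case
      unfolding fun_ext_tensor_iff
      by (auto simp: bfv_gen_def ext_monomials_def zero_in_smooth_functions one_in_smooth_functions)
  next
    case (3 j)
    have "fun_coeff (bfv_gen (VGen j))" by simp
    with 3 show ?case
      unfolding fun_ext_tensor_iff
      by (auto simp: bfv_gen_def ext_monomials_def zero_in_smooth_functions one_in_smooth_functions)
  next
    case (4 a b)
    then show ?case
      unfolding fun_ext_tensor_iff
      by (simp add: fun_coeff_add smooth_functions_add)
  next
    case (5 a r)
    then show ?case
      unfolding fun_ext_tensor_iff
      by (simp add: fun_coeff_scaleR smooth_functions_scaleR)
  next
    case (6 a b)
    then show ?case by (blast intro: fun_ext_tensor_star)
  qed
qed

text \<open>The monomial is built one generator at a time. Multiplying by \<open>bfv_gen x\<close>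
  on the left produces the sign \<open>?s\<close>, which is its own inverse because \<open>x\<close>
  does not occur in \<open>m\<close>; a further factor \<open>?s\<close> removes it.\<close>

lemma homogeneous_K_monom:
  "m \<in> ext_monomials p q \<Longrightarrow> homogeneous_K \<A> p q (mono_deg m) (bfv_monom m)"
proof (induction m)
  case empty
  have "(bfv_monom {#} :: 'a bfv) = bfv_mv (mv_of_fun 1)"
    by (auto simp: bfv_monom_def bfv_mv_def fun_eq_iff)
  then show ?case
    using homogeneous_K.fun[OF one_in_smooth_functions, of \<A> p q] by (simp only: mono_deg_empty)
next
  case (add x m)
  have x: "x \<notin># m" using add.prems by (auto simp: ext_monomials_def not_in_iff)
  have m: "m \<in> ext_monomials p q"
    unfolding ext_monomials_def
  proof (intro CollectI conjI ballI)
    show "set_mset m \<subseteq> UStar ` {..<p} \<union> VGen ` {..<q}"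
      using add.prems by (simp add: ext_monomials_def)
    fix y assume "y \<in># m"
    moreover from this x have "y \<noteq> x" by blast
    ultimately show "count m y = 1" using add.prems by (auto simp: ext_monomials_def)
  qed
  let ?s = "mono_sign {#x#} m"
  have "odd_disjoint {#x#} m" using x by (simp add: odd_disjoint_def)
  then have s: "?s * ?s = 1" by (simp add: mono_sign_eq koszul_mult_self)
  have "homogeneous_K \<A> p q (gen_deg x) (bfv_gen x)"
    using add.prems by (auto simp: ext_monomials_def intro: homogeneous_K.intros)
  then have "homogeneous_K \<A> p q (gen_deg x + mono_deg m) (?s *\<^sub>R (bfv_gen x \<star> bfv_monom m))"
    using add.IH[OF m] by (intro homogeneous_K.intros)
  moreover have "?s *\<^sub>R (bfv_gen x \<star> bfv_monom m) = (bfv_monom (add_mset x m) :: 'a bfv)"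
    by (simp add: bfv_gen_eq_monom monom_star_monom s)
  ultimately show ?case by (simp add: mono_deg_def)
qed

lemma fun_ext_tensor_decompose:
  assumes "a \<in> fun_ext_tensor \<A> p q"
  shows "a = (\<Sum>m\<in>ext_monomials p q. bfv_mv (mv_of_fun (a m [])) \<star> bfv_monom m)"
proof (rule fun_coeff_eqI)
  note a = assms[unfolded fun_ext_tensor_iff]
  show "fun_coeff a" using a by blast
  show "fun_coeff (\<Sum>m\<in>ext_monomials p q. bfv_mv (mv_of_fun (a m [])) \<star> bfv_monom m)"
    by (intro fun_coeff_sum fun_coeff_star) simp_all
  fix n
  have "(\<Sum>m\<in>ext_monomials p q. bfv_mv (mv_of_fun (a m [])) \<star> bfv_monom m) n [] =
      (\<Sum>m\<in>ext_monomials p q. a m [] * (if n = m then 1 else 0))"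
    by (simp add: sum_fun_apply star_mv_left) (auto simp: bfv_monom_def intro!: sum.cong)
  also have "\<dots> = (\<Sum>m\<in>ext_monomials p q. if n = m then a m [] else 0)"
    by (intro sum.cong) auto
  also have "\<dots> = a n []"
    using a by (simp add: sum.delta' finite_ext_monomials)
  finally show "a n [] = (\<Sum>m\<in>ext_monomials p q. bfv_mv (mv_of_fun (a m [])) \<star> bfv_monom m) n []" ..
qed

lemma fun_ext_tensor_summand:
  assumes "a \<in> fun_ext_tensor \<A> p q" "m \<in> ext_monomials p q"
  shows "homogeneous_K \<A> p q (mono_deg m) (bfv_mv (mv_of_fun (a m [])) \<star> bfv_monom m)"
  by (rule homogeneous_K_mult[OF homogeneous_K.fun homogeneous_K_monom])
    (use assms in \<open>auto simp: fun_ext_tensor_iff\<close>)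

lemma bfv_K_eq_fun_ext_tensor: "bfv_K \<A> p q = fun_ext_tensor \<A> p q"
proof
  show "fun_ext_tensor \<A> p q \<subseteq> bfv_K \<A> p q"
  proof
    fix a assume a: "a \<in> fun_ext_tensor \<A> p q"
    have "(\<Sum>m\<in>I. bfv_mv (mv_of_fun (a m [])) \<star> bfv_monom m) \<in> bfv_K \<A> p q"
      if "I \<subseteq> ext_monomials p q" for I
      using that
    proof (induction I rule: infinite_finite_induct)
      case (insert m I)
      then show ?case
        using homogeneous_K_in_bfv_K[OF fun_ext_tensor_summand[OF a, of m]]
        by (simp only: sum.insert insert_subset simp_thms) (blast intro: bfv_K.intros)
    qed (use zero_in_bfv_K in \<open>simp_all only: sum.infinite sum.empty simp_thms\<close>)
    from this[OF order_refl] show "a \<in> bfv_K \<A> p q"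
      unfolding fun_ext_tensor_decompose[OF a, symmetric] .
  qed
qed (rule bfv_K_subset_fun_ext_tensor)

text \<open>The expansion into monomials separates the degrees: a summand is zero, or its monomial
  has degree \<open>k\<close>. An induction over \<open>bfv_K\<close> would not see this, since
  summands of different degrees may cancel there.\<close>

lemma mem_bfv_K_space_iff: "a \<in> bfv_K_space \<A> p q k \<longleftrightarrow> homogeneous_K \<A> p q k a"
proof
  assume "a \<in> bfv_K_space \<A> p q k"
  then have a: "a \<in> fun_ext_tensor \<A> p q" "a \<in> bfv_space \<A> p q k"
    by (simp_all add: bfv_K_space_def bfv_K_eq_fun_ext_tensor)
  have "homogeneous_K \<A> p q k (bfv_mv (mv_of_fun (a m [])) \<star> bfv_monom m)"
    if "m \<in> ext_monomials p q" for m
  proof (cases "a m [] = 0")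
    case True
    have "(bfv_mv (mv_of_fun 0) :: 'a bfv) = 0" by (simp add: bfv_mv_def mv_of_fun_def fun_eq_iff)
    with True show ?thesis by (simp only: star_0_left homogeneous_K.zero)
  next
    case False
    then have "mono_deg m = k"
      using fun_coeff_mono_deg[OF _ a(2)] a(1) by (simp add: fun_ext_tensor_iff)
    then show ?thesis using fun_ext_tensor_summand[OF a(1) that] by simp
  qed
  then have "homogeneous_K \<A> p q k (\<Sum>m\<in>ext_monomials p q. bfv_mv (mv_of_fun (a m [])) \<star> bfv_monom m)"
    by (rule homogeneous_K_sum)
  then show "homogeneous_K \<A> p q k a" using fun_ext_tensor_decompose[OF a(1)] by simp
next
  assume "homogeneous_K \<A> p q k a"
  then show "a \<in> bfv_K_space \<A> p q k"
    by (simp add: bfv_K_space_def homogeneous_K_in_bfv_K homogeneous_K_in_bfv_space)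
qed

lemma graded_comm_algebra_bfv_K:
  "graded_comm_algebra (bfv_K_space \<A> p q) (\<star>) bfv_one"
  unfolding graded_comm_algebra_def
proof (intro conjI allI ballI)
  show "graded_space (bfv_K_space \<A> p q)"
    unfolding graded_space_def subspace_def
    by (auto simp: mem_bfv_K_space_iff intro: homogeneous_K.intros)
  show "bilin_on (bfv_K_space \<A> p q k) (bfv_K_space \<A> p q l) (\<star>)" for k l
    by (simp add: bilin_on_def lin_on_def star_linear)
  show "bfv_one \<in> bfv_K_space \<A> p q 0"
    by (simp add: mem_bfv_K_space_iff bfv_one_def homogeneous_K.fun one_in_smooth_functions)
next
  fix k x assume "x \<in> bfv_K_space \<A> p q k"
  then show "bfv_one \<star> x = x" "x \<star> bfv_one = x"
    by (simp_all add: mem_bfv_K_space_iff star_one_left star_one_right fun_coeff_homogeneous_K)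
next
  fix k l x y assume x: "x \<in> bfv_K_space \<A> p q k" and y: "y \<in> bfv_K_space \<A> p q l"
  then show "x \<star> y \<in> bfv_K_space \<A> p q (k + l)"
    by (simp add: mem_bfv_K_space_iff homogeneous_K.mult)
  show "x \<star> y = koszul (k * l) *\<^sub>R (y \<star> x)"
    using x y unfolding mem_bfv_K_space_iff
    by (intro star_commute homogeneous_K_in_bfv_space fun_coeff_homogeneous_K)
  fix m z assume z: "z \<in> bfv_K_space \<A> p q m"
  show "x \<star> y \<star> z = x \<star> (y \<star> z)"
    using y z unfolding mem_bfv_K_space_iff by (intro star_assoc fun_coeff_homogeneous_K)
qed

section \<open>The Poisson bracket of the BFV algebra\<close>

lemma star_in_bfv_space':
  "a \<in> bfv_space \<A> p q k \<Longrightarrow> b \<in> bfv_space \<A> p q l \<Longrightarrow> fun_coeff b \<Longrightarrow> k + l = n \<Longrightarrow>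
    a \<star> b \<in> bfv_space \<A> p q n"
  using star_in_bfv_space by blast

locale bfv_poisson =
  fixes \<A> :: "('m, 'e::real_normed_vector) chart set"
    and p q :: nat
    and br :: "'m bfv \<Rightarrow> 'm bfv \<Rightarrow> 'm bfv"
  assumes bracket: "bfv_bracket \<A> p q br"
begin

abbreviation B :: "int \<Rightarrow> 'm bfv set" where
  "B \<equiv> bfv_space \<A> p q"

lemma graded_poisson: "graded_poisson_bracket (-1) B (\<star>) (\<lambda>_ _. br)"
  using bracket by (simp add: bfv_bracket_def)

lemma graded_lie: "graded_lie_algebra (-1) B (\<lambda>_ _. br)"
  using graded_poisson by (simp add: graded_poisson_bracket_def)

lemma br_bilin: "bilin_on (B k) (B l) br"
  using graded_lie unfolding graded_lie_algebra_def by (elim conjE) blast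

lemma br_closed: "a \<in> B k \<Longrightarrow> b \<in> B l \<Longrightarrow> br a b \<in> B (k + l - 1)"
  using graded_lie unfolding graded_lie_algebra_def diff_conv_add_uminus by (elim conjE) blast

lemma br_antisym:
  "a \<in> B k \<Longrightarrow> b \<in> B l \<Longrightarrow> br a b = - (koszul ((k - 1) * (l - 1)) *\<^sub>R br b a)"
  using graded_lie unfolding graded_lie_algebra_def diff_conv_add_uminus by (elim conjE) blast

lemma br_jacobi: "a \<in> B k \<Longrightarrow> b \<in> B l \<Longrightarrow> x \<in> B n \<Longrightarrow>
    br a (br b x) = br (br a b) x + koszul ((k - 1) * (l - 1)) *\<^sub>R br b (br a x)"
  using graded_lie unfolding graded_lie_algebra_def diff_conv_add_uminus by (elim conjE) blast

lemma br_leibniz: "a \<in> B k \<Longrightarrow> b \<in> B l \<Longrightarrow> x \<in> B n \<Longrightarrow>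
    br a (b \<star> x) = br a b \<star> x + koszul ((k - 1) * l) *\<^sub>R (b \<star> br a x)"
  using graded_poisson unfolding graded_poisson_bracket_def diff_conv_add_uminus
  by (elim conjE) blast

lemma br_mv_mv:
    "P \<in> multivector_fields \<A> r \<Longrightarrow> R \<in> multivector_fields \<A> s \<Longrightarrow>
      br (bfv_mv P) (bfv_mv R) = bfv_mv (schouten P R)"
  and br_mv_gen:
    "P \<in> multivector_fields \<A> r \<Longrightarrow> x \<in> generators p q \<Longrightarrow> br (bfv_mv P) (bfv_gen x) = 0"
  and br_gen_gen_dual:
    "x \<in> generators p q \<Longrightarrow> y \<in> generators p q \<Longrightarrow> dual_gens x y \<Longrightarrow>
      br (bfv_gen x) (bfv_gen y) = bfv_one"
  and br_gen_gen_0: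
    "x \<in> generators p q \<Longrightarrow> y \<in> generators p q \<Longrightarrow> \<not> dual_gens x y \<Longrightarrow> \<not> dual_gens y x \<Longrightarrow>
      br (bfv_gen x) (bfv_gen y) = 0"
  using bracket unfolding bfv_bracket_def by blast+

lemma subspace_B: "subspace (B k)"
  by (rule subspace_bfv_space)

lemma br_add_right: "a \<in> B k \<Longrightarrow> b \<in> B l \<Longrightarrow> b' \<in> B l \<Longrightarrow> br a (b + b') = br a b + br a b'"
  and br_scaleR_right: "a \<in> B k \<Longrightarrow> b \<in> B l \<Longrightarrow> br a (r *\<^sub>R b) = r *\<^sub>R br a b"
  and br_add_left: "a \<in> B k \<Longrightarrow> a' \<in> B k \<Longrightarrow> b \<in> B l \<Longrightarrow> br (a + a') b = br a b + br a' b"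
  and br_scaleR_left: "a \<in> B k \<Longrightarrow> b \<in> B l \<Longrightarrow> br (r *\<^sub>R a) b = r *\<^sub>R br a b"
  using br_bilin[of k l] unfolding bilin_on_def lin_on_def by blast+

lemma br_0_right: "a \<in> B k \<Longrightarrow> br a 0 = 0"
  using br_scaleR_right[of a k 0 0 0] subspace_0[OF subspace_B] by simp

lemma br_0_left: "b \<in> B l \<Longrightarrow> br 0 b = 0"
  using br_scaleR_left[of 0 0 b l 0] subspace_0[OF subspace_B] by simp

lemma br_minus_right: "a \<in> B k \<Longrightarrow> b \<in> B l \<Longrightarrow> br a (- b) = - br a b"
  using br_scaleR_right[of a k b l "-1"] by simp

lemma br_minus_left: "a \<in> B k \<Longrightarrow> b \<in> B l \<Longrightarrow> br (- a) b = - br a b"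
  using br_scaleR_left[of a k b l "-1"] by simp

lemma br_diff_right: "a \<in> B k \<Longrightarrow> b \<in> B l \<Longrightarrow> b' \<in> B l \<Longrightarrow> br a (b - b') = br a b - br a b'"
  using br_add_right[of a k b l "- b'"] br_minus_right[of a k b' l] subspace_neg[OF subspace_B, of b' l]
  by (simp only: diff_conv_add_uminus)

lemma br_diff_left: "a \<in> B k \<Longrightarrow> a' \<in> B k \<Longrightarrow> b \<in> B l \<Longrightarrow> br (a - a') b = br a b - br a' b"
  using br_add_left[of a k "- a'" b l] br_minus_left[of a' k b l] subspace_neg[OF subspace_B, of a' k]
  by (simp only: diff_conv_add_uminus)

lemma br_sum_right:
  assumes "a \<in> B k" "\<And>i. i \<in> I \<Longrightarrow> f i \<in> B l"
  shows "br a (\<Sum>i\<in>I. f i) = (\<Sum>i\<in>I. br a (f i))"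
  using assms(2)
proof (induction I rule: infinite_finite_induct)
  case (insert i I)
  then have "br a (f i + (\<Sum>i\<in>I. f i)) = br a (f i) + br a (\<Sum>i\<in>I. f i)"
    by (intro br_add_right[OF assms(1)] subspace_sum[OF subspace_B]) auto
  moreover have "br a (\<Sum>i\<in>I. f i) = (\<Sum>i\<in>I. br a (f i))"
    using insert.prems by (intro insert.IH) simp
  ultimately show ?case
    unfolding sum.insert[OF insert.hyps] by (simp only:)
qed (use br_0_right[OF assms(1)] in simp_all)

lemma br_sum_left:
  assumes "b \<in> B l" "\<And>i. i \<in> I \<Longrightarrow> f i \<in> B k"
  shows "br (\<Sum>i\<in>I. f i) b = (\<Sum>i\<in>I. br (f i) b)"
  using assms(2)
proof (induction I rule: infinite_finite_induct)
  case (insert i I)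
  then have "br (f i + (\<Sum>i\<in>I. f i)) b = br (f i) b + br (\<Sum>i\<in>I. f i) b"
    by (intro br_add_left[OF _ _ assms(1)] subspace_sum[OF subspace_B]) auto
  moreover have "br (\<Sum>i\<in>I. f i) b = (\<Sum>i\<in>I. br (f i) b)"
    using insert.prems by (intro insert.IH) simp
  ultimately show ?case
    unfolding sum.insert[OF insert.hyps] by (simp only:)
qed (use br_0_left[OF assms(1)] in simp_all)

lemma br_swap_0: "a \<in> B k \<Longrightarrow> b \<in> B l \<Longrightarrow> br b a = 0 \<Longrightarrow> br a b = 0"
  using br_antisym[of a k b l] by simp

lemma br_star_0:
  "a \<in> B k \<Longrightarrow> b \<in> B l \<Longrightarrow> x \<in> B n \<Longrightarrow> br a b = 0 \<Longrightarrow> br a x = 0 \<Longrightarrow> br a (b \<star> x) = 0"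
  by (simp add: br_leibniz)

lemma gen_in_B: "x \<in> generators p q \<Longrightarrow> bfv_gen x \<in> B (gen_deg x)"
  by (rule bfv_gen_in_bfv_space)

lemma mv_in_B: "P \<in> multivector_fields \<A> r \<Longrightarrow> bfv_mv P \<in> B r"
  by (rule bfv_mv_in_bfv_space)

lemma fun_in_B: "f \<in> smooth_functions \<A> \<Longrightarrow> bfv_mv (mv_of_fun f) \<in> B 0"
  by (intro mv_in_B mv_of_fun_in_multivector_fields)

lemma br_gen_mv:
  "P \<in> multivector_fields \<A> r \<Longrightarrow> x \<in> generators p q \<Longrightarrow> br (bfv_gen x) (bfv_mv P) = 0"
  by (rule br_swap_0[OF gen_in_B mv_in_B br_mv_gen])

lemma bfv_mv_in_B_iff: "bfv_mv P \<in> B r \<longleftrightarrow> P \<in> multivector_fields \<A> r"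
  using bfv_spaceD(2)[of "bfv_mv P" \<A> p q r "{#}"] mv_in_B by (auto simp: bfv_mv_def)

text \<open>The degree of the Schouten bracket is read off from the closure axiom of
  \<open>br\<close>, at the coefficient of the empty monomial.\<close>

lemma schouten_in_multivector_fields:
  "P \<in> multivector_fields \<A> r \<Longrightarrow> R \<in> multivector_fields \<A> s \<Longrightarrow>
    schouten P R \<in> multivector_fields \<A> (r + s - 1)"
  using br_closed[OF mv_in_B mv_in_B, of P r R s] by (simp add: br_mv_mv bfv_mv_in_B_iff)

lemma bfv_mv_inject: "bfv_mv P = bfv_mv R \<Longrightarrow> P = R"
  by (drule fun_cong[of _ _ "{#}"]) (simp add: bfv_mv_def)

text \<open>The bracket has degree -1, and no list has length -1.\<close>

lemma schouten_fun_fun: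
  assumes "f \<in> smooth_functions \<A>" "g \<in> smooth_functions \<A>"
  shows "schouten (mv_of_fun f) (mv_of_fun g) = 0"
proof
  fix fs :: "('m \<Rightarrow> real) list"
  have "schouten (mv_of_fun f) (mv_of_fun g) \<in> multivector_fields \<A> (0 + 0 - 1)"
    by (intro schouten_in_multivector_fields mv_of_fun_in_multivector_fields assms)
  then show "schouten (mv_of_fun f) (mv_of_fun g) fs = 0 fs"
    by (simp add: multivector_fields_eq_0 fun_eq_iff)
qed

lemma bfv_mv_0 [simp]: "bfv_mv 0 = 0"
  by (simp add: bfv_mv_def fun_eq_iff)

lemma br_fun_fun:
  "f \<in> smooth_functions \<A> \<Longrightarrow> g \<in> smooth_functions \<A> \<Longrightarrow>
    br (bfv_mv (mv_of_fun f)) (bfv_mv (mv_of_fun g)) = 0"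
  using br_mv_mv[OF mv_of_fun_in_multivector_fields mv_of_fun_in_multivector_fields, of f g]
  by (simp add: schouten_fun_fun)

lemma gens_in_generators [simp]:
  "i < p \<Longrightarrow> UStar i \<in> generators p q" "j < q \<Longrightarrow> VStar j \<in> generators p q"
  "i < p \<Longrightarrow> UGen i \<in> generators p q" "j < q \<Longrightarrow> VGen j \<in> generators p q"
  by (auto simp: generators_def)

lemma gens_in_B:
  "i < p \<Longrightarrow> bfv_gen (UStar i) \<in> B 1" "j < q \<Longrightarrow> bfv_gen (VStar j) \<in> B 2"
  "i < p \<Longrightarrow> bfv_gen (UGen i) \<in> B 0" "j < q \<Longrightarrow> bfv_gen (VGen j) \<in> B (-1)"
  using gen_in_B[of "UStar i"] gen_in_B[of "VStar j"] gen_in_B[of "UGen i"] gen_in_B[of "VGen j"]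
  by simp_all

lemma br_UStar_UGen:
  "i < p \<Longrightarrow> j < p \<Longrightarrow> br (bfv_gen (UStar i)) (bfv_gen (UGen j)) = (if i = j then bfv_one else 0)"
  by (simp add: br_gen_gen_dual br_gen_gen_0)

lemma br_VStar_VGen:
  "i < q \<Longrightarrow> j < q \<Longrightarrow> br (bfv_gen (VStar i)) (bfv_gen (VGen j)) = (if i = j then bfv_one else 0)"
  by (simp add: br_gen_gen_dual br_gen_gen_0)

text \<open>The shifted degrees of a dual pair are 0 and -1 for \<open>u\<close>, and 1 and -2 for
  \<open>v\<close>. Their product is even in both cases, so reversing the pair changes the
  sign.\<close>

lemma br_UGen_UStar:
  "i < p \<Longrightarrow> j < p \<Longrightarrow> br (bfv_gen (UGen i)) (bfv_gen (UStar j)) = (if i = j then - bfv_one else 0)"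
  by (simp add: br_antisym[OF gens_in_B(3) gens_in_B(1)] br_UStar_UGen)

lemma br_VGen_VStar:
  "i < q \<Longrightarrow> j < q \<Longrightarrow> br (bfv_gen (VGen i)) (bfv_gen (VStar j)) = (if i = j then - bfv_one else 0)"
  by (simp add: br_antisym[OF gens_in_B(4) gens_in_B(2)] br_VStar_VGen koszul_def)

end

section \<open>Linear maps into the BFV algebra\<close>

lemma bfv_mv_add: "bfv_mv (P + R) = bfv_mv P + bfv_mv R"
  by (simp add: bfv_mv_def fun_eq_iff)

lemma bfv_mv_scaleR: "bfv_mv (r *\<^sub>R P) = r *\<^sub>R bfv_mv P"
  by (simp add: bfv_mv_def fun_eq_iff)

lemma mv_of_fun_add: "mv_of_fun (f + g) = mv_of_fun f + mv_of_fun g"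
  by (simp add: mv_of_fun_def fun_eq_iff)

lemma mv_of_fun_scaleR: "mv_of_fun (r *\<^sub>R f) = r *\<^sub>R mv_of_fun f"
  by (simp add: mv_of_fun_def fun_eq_iff)

lemma star_diff_left: "(x - y) \<star> b = x \<star> b - y \<star> b"
  by (simp only: diff_conv_add_uminus star_linear)

lemma star_diff_right: "b \<star> (x - y) = b \<star> x - b \<star> y"
  by (simp only: diff_conv_add_uminus star_linear)

lemma linear_star_left: "linear f \<Longrightarrow> linear (\<lambda>x. f x \<star> b)"
  by (simp add: linear_iff star_linear)

lemma linear_star_right: "linear f \<Longrightarrow> linear (\<lambda>x. b \<star> f x)"
  by (simp add: linear_iff star_linear)

lemma linear_comp: "linear f \<Longrightarrow> linear g \<Longrightarrow> linear (\<lambda>x. f (g x))"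
  using linear_compose[of g f] by (simp add: o_def)

lemma sum_rotate: "(\<Sum>i\<in>A. \<Sum>j\<in>B. \<Sum>k\<in>C. g i j k) = (\<Sum>k\<in>C. \<Sum>i\<in>A. \<Sum>j\<in>B. g i j k)"
proof -
  have "(\<Sum>k\<in>C. \<Sum>i\<in>A. \<Sum>j\<in>B. g i j k) = (\<Sum>i\<in>A. \<Sum>k\<in>C. \<Sum>j\<in>B. g i j k)"
    by (rule sum.swap)
  also have "\<dots> = (\<Sum>i\<in>A. \<Sum>j\<in>B. \<Sum>k\<in>C. g i j k)"
    by (intro sum.cong refl sum.swap)
  finally show ?thesis ..
qed

text \<open>The linear maps \<open>U\<close> and \<open>V\<close> are the inclusions of \<open>\<gg>\<close> and \<open>\<hh>[1]\<close> into the BFV algebra; in terms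
  of them structure constants disappear from most formulas.\<close>

locale bfv_moment_data = bfv_poisson \<A> p q br
  for \<A> :: "('m, 'e::real_normed_vector) chart set"
    and p q :: nat
    and br :: "'m bfv \<Rightarrow> 'm bfv \<Rightarrow> 'm bfv" +
  fixes \<pi> :: "'m mv"
    and lie :: "'g::real_vector \<Rightarrow> 'g \<Rightarrow> 'g"
    and act :: "'g \<Rightarrow> 'h::real_vector \<Rightarrow> 'h"
    and \<delta> :: "'h \<Rightarrow> 'g"
    and J1 :: "'g \<Rightarrow> 'm mv"
    and J0 :: "'h \<Rightarrow> 'm \<Rightarrow> real"
    and u :: "nat \<Rightarrow> 'g"
    and v :: "nat \<Rightarrow> 'h"
    and c d :: "nat \<Rightarrow> nat \<Rightarrow> nat \<Rightarrow> real"
    and a :: "nat \<Rightarrow> nat \<Rightarrow> real"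
    and U :: "'g \<Rightarrow> 'm bfv"
    and V :: "'h \<Rightarrow> 'm bfv"
  assumes pi: "\<pi> \<in> multivector_fields \<A> 2"
    and pi_pi: "schouten \<pi> \<pi> = 0"
    and linear_J1: "linear J1"
    and linear_J0: "linear J0"
    and J1: "J1 x \<in> multivector_fields \<A> 1"
    and J0: "J0 y \<in> smooth_functions \<A>"
    and J1_J1: "schouten (J1 x) (J1 x') = J1 (lie x x')"
    and J1_J0: "schouten (J1 x) (mv_of_fun (J0 y)) = mv_of_fun (J0 (act x y))"
    and pi_J1: "schouten \<pi> (J1 x) = 0"
    and pi_J0: "schouten \<pi> (mv_of_fun (J0 y)) = J1 (\<delta> y)"
    and linear_lie_right: "linear (lie x)"
    and linear_lie_left: "linear (\<lambda>x. lie x x')"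
    and linear_act_right: "linear (act x)"
    and linear_act_left: "linear (\<lambda>x. act x y)"
    and linear_delta: "linear \<delta>"
    and lie_antisym: "lie x x' = - lie x' x"
    and lie_jacobi: "lie x (lie x' x'') = lie (lie x x') x'' + lie x' (lie x x'')"
    and act_act: "act x (act x' y) = act (lie x x') y + act x' (act x y)"
    and delta_act: "\<delta> (act x y) = lie x (\<delta> y)"
    and act_delta: "act (\<delta> y) y' = - act (\<delta> y') y"
    and expand_u: "\<exists>r. x = (\<Sum>k<p. r k *\<^sub>R u k)"
    and expand_v: "\<exists>r. y = (\<Sum>k<q. r k *\<^sub>R v k)"
    and c: "i < p \<Longrightarrow> j < p \<Longrightarrow> lie (u i) (u j) = (\<Sum>k<p. c i j k *\<^sub>R u k)"
    and d: "i < p \<Longrightarrow> j < q \<Longrightarrow> act (u i) (v j) = (\<Sum>l<q. d i j l *\<^sub>R v l)"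
    and a: "j < q \<Longrightarrow> \<delta> (v j) = (\<Sum>k<p. a j k *\<^sub>R u k)"
    and linear_U: "linear U"
    and linear_V: "linear V"
    and U_u: "i < p \<Longrightarrow> U (u i) = bfv_gen (UGen i)"
    and V_v: "j < q \<Longrightarrow> V (v j) = bfv_gen (VGen j)"
begin

abbreviation "X x \<equiv> bfv_mv (J1 x)"
abbreviation "F y \<equiv> bfv_mv (mv_of_fun (J0 y))"
abbreviation \<eta> :: "nat \<Rightarrow> 'm bfv" where "\<eta> i \<equiv> bfv_gen (UStar i)"
abbreviation \<nu> :: "nat \<Rightarrow> 'm bfv" where "\<nu> j \<equiv> bfv_gen (VStar j)"
abbreviation "Q \<equiv> bfv_Q p q J1 J0 u v c d"
abbreviation "P \<equiv> bfv_Pi p q \<pi> a"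

lemma linear_X: "linear X"
  by (simp add: linear_iff linear_add[OF linear_J1] linear_scale[OF linear_J1]
      bfv_mv_add bfv_mv_scaleR del: scaleR_fun_apply)

lemma linear_F: "linear F"
  by (simp add: linear_iff linear_add[OF linear_J0] linear_scale[OF linear_J0]
      bfv_mv_add bfv_mv_scaleR mv_of_fun_add mv_of_fun_scaleR del: scaleR_fun_apply)

lemma linear_eq_on_u:
  assumes "linear f" "linear g" "\<And>k. k < p \<Longrightarrow> f (u k) = g (u k)"
  shows "f x = g x"
proof -
  obtain r where "x = (\<Sum>k<p. r k *\<^sub>R u k)" using expand_u by blast
  then show ?thesis
    using assms by (simp add: linear_sum linear_scale)
qed

lemma linear_eq_on_v:
  assumes "linear f" "linear g" "\<And>k. k < q \<Longrightarrow> f (v k) = g (v k)"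
  shows "f x = g x"
proof -
  obtain r where "x = (\<Sum>k<q. r k *\<^sub>R v k)" using expand_v by blast
  then show ?thesis
    using assms by (simp add: linear_sum linear_scale)
qed

lemma U_in_B: "U x \<in> B 0" and fun_coeff_U: "fun_coeff (U x)"
proof -
  obtain r where "x = (\<Sum>k<p. r k *\<^sub>R u k)" using expand_u by blast
  then have x: "U x = (\<Sum>k<p. r k *\<^sub>R bfv_gen (UGen k))"
    by (simp add: linear_sum[OF linear_U] linear_scale[OF linear_U] U_u)
  show "U x \<in> B 0"
    unfolding x by (intro subspace_sum subspace_scale subspace_B gens_in_B) simp
  show "fun_coeff (U x)"
    unfolding x by (intro fun_coeff_sum fun_coeff_scaleR fun_coeff_gen)
qed

lemma V_in_B: "V y \<in> B (-1)" and fun_coeff_V: "fun_coeff (V y)"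
proof -
  obtain r where "y = (\<Sum>k<q. r k *\<^sub>R v k)" using expand_v by blast
  then have y: "V y = (\<Sum>k<q. r k *\<^sub>R bfv_gen (VGen k))"
    by (simp add: linear_sum[OF linear_V] linear_scale[OF linear_V] V_v)
  show "V y \<in> B (-1)"
    unfolding y by (intro subspace_sum subspace_scale subspace_B gens_in_B) simp
  show "fun_coeff (V y)"
    unfolding y by (intro fun_coeff_sum fun_coeff_scaleR fun_coeff_gen)
qed

lemma X_in_B: "X x \<in> B 1"
  by (rule mv_in_B[OF J1])

lemma F_in_B: "F y \<in> B 0"
  by (rule fun_in_B[OF J0])

lemma pi_in_B: "bfv_mv \<pi> \<in> B 2"
  by (rule mv_in_B[OF pi])

lemmas in_B = U_in_B V_in_B X_in_B F_in_B pi_in_B gens_in_B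

lemmas fun_coeffs = fun_coeff_U fun_coeff_V fun_coeff_bfv_mv_of_fun fun_coeff_gen fun_coeff_star

lemma products_in_B:
  "i < p \<Longrightarrow> X x \<star> \<eta> i \<in> B 2"
  "j < q \<Longrightarrow> F y \<star> \<nu> j \<in> B 2"
  "i < p \<Longrightarrow> j < p \<Longrightarrow> \<eta> i \<star> \<eta> j \<in> B 2"
  "i < p \<Longrightarrow> k < q \<Longrightarrow> \<eta> i \<star> \<nu> k \<in> B 3"
  "i < p \<Longrightarrow> j < p \<Longrightarrow> \<eta> i \<star> \<eta> j \<star> U x \<in> B 2"
  "i < p \<Longrightarrow> k < q \<Longrightarrow> \<eta> i \<star> \<nu> k \<star> V y \<in> B 2"
  "k < q \<Longrightarrow> \<nu> k \<star> U x \<in> B 2"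
  by (rule star_in_bfv_space' in_B fun_coeffs | assumption | simp)+

text \<open>Linearity of \<open>T i j\<close> absorbs the structure constants. The basis index
  stands outermost because it belongs to the factor that was differentiated: the bracket of
  \<open>Q\<close> with \<open>\<eta> k\<close> contributes the coefficients
  \<open>c i j k\<close>.\<close>

lemma sum_structure_u:
  assumes "\<And>i j. linear (T i j)"
  shows "(\<Sum>k<p. \<Sum>i<p. \<Sum>j<p. c i j k *\<^sub>R T i j (u k)) = (\<Sum>i<p. \<Sum>j<p. T i j (lie (u i) (u j)))"
  by (subst sum_rotate[symmetric], intro sum.cong refl)
     (simp add: c linear_sum[OF assms] linear_scale[OF assms])

lemma sum_structure_v:
  assumes "\<And>i j. linear (T i j)"
  shows "(\<Sum>k<q. \<Sum>i<p. \<Sum>j<q. d i j k *\<^sub>R T i j (v k)) = (\<Sum>i<p. \<Sum>j<q. T i j (act (u i) (v j)))"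
  by (subst sum_rotate[symmetric], intro sum.cong refl)
     (simp add: d linear_sum[OF assms] linear_scale[OF assms])

section \<open>\<open>Q\<close> and \<open>\<Pi>\<close> without structure constants\<close>

lemma Q_eq:
  "Q = (\<Sum>i<p. X (u i) \<star> \<eta> i) + (\<Sum>j<q. F (v j) \<star> \<nu> j)
     - (1/2) *\<^sub>R (\<Sum>i<p. \<Sum>j<p. \<eta> i \<star> \<eta> j \<star> U (lie (u i) (u j)))
     - (\<Sum>i<p. \<Sum>j<q. \<eta> i \<star> \<nu> j \<star> V (act (u i) (v j)))"
proof -
  have "(\<Sum>k<p. c i j k *\<^sub>R (\<eta> i \<star> \<eta> j \<star> bfv_gen (UGen k))) = \<eta> i \<star> \<eta> j \<star> U (lie (u i) (u j))"
    if "i < p" "j < p" for i j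
    using that by (simp add: c linear_sum[OF linear_U] linear_scale[OF linear_U] U_u star_linear)
  moreover have "(\<Sum>l<q. d i j l *\<^sub>R (\<eta> i \<star> \<nu> j \<star> bfv_gen (VGen l))) = \<eta> i \<star> \<nu> j \<star> V (act (u i) (v j))"
    if "i < p" "j < q" for i j
    using that by (simp add: d linear_sum[OF linear_V] linear_scale[OF linear_V] V_v star_linear)
  ultimately show ?thesis
    unfolding bfv_Q_def by simp
qed

lemma Pi_eq: "P = bfv_mv \<pi> - (\<Sum>j<q. \<nu> j \<star> U (\<delta> (v j)))"
proof -
  have "(\<Sum>k<p. a j k *\<^sub>R (\<nu> j \<star> bfv_gen (UGen k))) = \<nu> j \<star> U (\<delta> (v j))" if "j < q" for j
    using that by (simp add: a linear_sum[OF linear_U] linear_scale[OF linear_U] U_u star_linear)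
  then show ?thesis
    unfolding bfv_Pi_def by simp
qed

lemma Q_in_B: "Q \<in> B 2"
  unfolding Q_eq
  by (intro subspace_diff subspace_add subspace_scale subspace_sum subspace_B products_in_B) simp_all

lemma Pi_in_B: "P \<in> B 2"
  unfolding Pi_eq
  by (intro subspace_diff subspace_sum subspace_B products_in_B pi_in_B) simp_all

text \<open>The Leibniz rule expands products in the second argument, so \<open>Q\<close> is put
  there and moved back to the front by \<open>br_Q_flip\<close>.\<close>

lemma br_Q_right:
  assumes "x \<in> B k"
  shows "br x Q = (\<Sum>i<p. br x (X (u i) \<star> \<eta> i)) + (\<Sum>j<q. br x (F (v j) \<star> \<nu> j))
     - (1/2) *\<^sub>R (\<Sum>i<p. \<Sum>j<p. br x (\<eta> i \<star> \<eta> j \<star> U (lie (u i) (u j))))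
     - (\<Sum>i<p. \<Sum>j<q. br x (\<eta> i \<star> \<nu> j \<star> V (act (u i) (v j))))"
proof -
  let ?a = "\<Sum>i<p. X (u i) \<star> \<eta> i" and ?b = "\<Sum>j<q. F (v j) \<star> \<nu> j"
    and ?c = "\<Sum>i<p. \<Sum>j<p. \<eta> i \<star> \<eta> j \<star> U (lie (u i) (u j))"
    and ?d = "\<Sum>i<p. \<Sum>j<q. \<eta> i \<star> \<nu> j \<star> V (act (u i) (v j))"
  have in_B: "?a \<in> B 2" "?b \<in> B 2" "?c \<in> B 2" "?d \<in> B 2"
    by (intro subspace_sum subspace_B products_in_B; simp)+
  then have ab: "?a + ?b \<in> B 2" and c2: "(1/2) *\<^sub>R ?c \<in> B 2"
    by (blast intro: subspace_add subspace_scale subspace_B)+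
  then have "?a + ?b - (1/2) *\<^sub>R ?c \<in> B 2"
    by (rule subspace_diff[OF subspace_B])
  with in_B ab c2 have "br x Q = br x ?a + br x ?b - (1/2) *\<^sub>R br x ?c - br x ?d"
    unfolding Q_eq using assms by (simp only: br_diff_right br_add_right br_scaleR_right)
  moreover have "br x ?a = (\<Sum>i<p. br x (X (u i) \<star> \<eta> i))"
    by (rule br_sum_right[OF assms, where l=2]) (simp add: products_in_B)
  moreover have "br x ?b = (\<Sum>j<q. br x (F (v j) \<star> \<nu> j))"
    by (rule br_sum_right[OF assms, where l=2]) (simp add: products_in_B)
  moreover have "br x ?c = (\<Sum>i<p. \<Sum>j<p. br x (\<eta> i \<star> \<eta> j \<star> U (lie (u i) (u j))))"
    by (subst br_sum_right[OF assms, where l=2];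
        (intro sum.cong refl br_sum_right[OF assms, where l=2] subspace_sum subspace_B)?)
      (simp_all add: products_in_B)
  moreover have "br x ?d = (\<Sum>i<p. \<Sum>j<q. br x (\<eta> i \<star> \<nu> j \<star> V (act (u i) (v j))))"
    by (subst br_sum_right[OF assms, where l=2];
        (intro sum.cong refl br_sum_right[OF assms, where l=2] subspace_sum subspace_B)?)
      (simp_all add: products_in_B)
  ultimately show ?thesis by (simp only:)
qed

lemma br_Pi_right:
  assumes "x \<in> B k"
  shows "br x P = br x (bfv_mv \<pi>) - (\<Sum>j<q. br x (\<nu> j \<star> U (\<delta> (v j))))"
proof -
  let ?n = "\<Sum>j<q. \<nu> j \<star> U (\<delta> (v j))"
  have "?n \<in> B 2"
    by (intro subspace_sum subspace_B products_in_B) simp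
  then have "br x P = br x (bfv_mv \<pi>) - br x ?n"
    unfolding Pi_eq by (rule br_diff_right[OF assms pi_in_B])
  moreover have "br x ?n = (\<Sum>j<q. br x (\<nu> j \<star> U (\<delta> (v j))))"
    by (rule br_sum_right[OF assms, where l=2]) (simp add: products_in_B)
  ultimately show ?thesis by (simp only:)
qed

text \<open>\<open>Q\<close> has shifted degree 1, and
  \<open>- koszul (k - 1) = koszul k\<close>.\<close>

lemma br_Q_flip: "x \<in> B k \<Longrightarrow> br Q x = koszul k *\<^sub>R br x Q"
  using br_antisym[OF Q_in_B, of x k] by (simp add: koszul_def)

lemma br_Pi_flip: "x \<in> B k \<Longrightarrow> br P x = koszul k *\<^sub>R br x P"
  using br_antisym[OF Pi_in_B, of x k] by (simp add: koszul_def)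

section \<open>The operator \<open>{Q, \<cdot>}\<close> on generators\<close>

lemma br_mv_U: "R \<in> multivector_fields \<A> r \<Longrightarrow> br (bfv_mv R) (U x) = 0"
proof -
  assume R: "R \<in> multivector_fields \<A> r"
  obtain s where "x = (\<Sum>k<p. s k *\<^sub>R u k)" using expand_u by blast
  then have x: "U x = (\<Sum>k<p. s k *\<^sub>R bfv_gen (UGen k))"
    by (simp add: linear_sum[OF linear_U] linear_scale[OF linear_U] U_u)
  show ?thesis
    unfolding x
    by (subst br_sum_right[OF mv_in_B[OF R], where l=0])
      (simp_all add: subspace_scale subspace_B gens_in_B br_mv_gen[OF R]
        br_scaleR_right[OF mv_in_B[OF R] gens_in_B(3)])
qed

lemma br_mv_V: "R \<in> multivector_fields \<A> r \<Longrightarrow> br (bfv_mv R) (V y) = 0"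
proof -
  assume R: "R \<in> multivector_fields \<A> r"
  obtain s where "y = (\<Sum>k<q. s k *\<^sub>R v k)" using expand_v by blast
  then have y: "V y = (\<Sum>k<q. s k *\<^sub>R bfv_gen (VGen k))"
    by (simp add: linear_sum[OF linear_V] linear_scale[OF linear_V] V_v)
  show ?thesis
    unfolding y
    by (subst br_sum_right[OF mv_in_B[OF R], where l="-1"])
      (simp_all add: subspace_scale subspace_B gens_in_B br_mv_gen[OF R]
        br_scaleR_right[OF mv_in_B[OF R] gens_in_B(4)])
qed

lemma br_gen_U_0:
  assumes x: "x \<in> generators p q" and 0: "\<And>k. \<not> dual_gens x (UGen k)"
  shows "br (bfv_gen x) (U z) = 0"
proof -
  obtain s where "z = (\<Sum>k<p. s k *\<^sub>R u k)" using expand_u by blast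
  then have z: "U z = (\<Sum>k<p. s k *\<^sub>R bfv_gen (UGen k))"
    by (simp add: linear_sum[OF linear_U] linear_scale[OF linear_U] U_u)
  have "br (bfv_gen x) (bfv_gen (UGen k)) = 0" if "k < p" for k
    using x 0 that by (intro br_gen_gen_0) simp_all
  then show ?thesis
    unfolding z
    by (subst br_sum_right[OF gen_in_B[OF x], where l=0])
      (simp_all add: subspace_scale subspace_B gens_in_B br_scaleR_right[OF gen_in_B[OF x] gens_in_B(3)])
qed

lemma br_gen_V_0:
  assumes x: "x \<in> generators p q" and 0: "\<And>k. \<not> dual_gens x (VGen k)"
  shows "br (bfv_gen x) (V z) = 0"
proof -
  obtain s where "z = (\<Sum>k<q. s k *\<^sub>R v k)" using expand_v by blast
  then have z: "V z = (\<Sum>k<q. s k *\<^sub>R bfv_gen (VGen k))"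
    by (simp add: linear_sum[OF linear_V] linear_scale[OF linear_V] V_v)
  have "br (bfv_gen x) (bfv_gen (VGen k)) = 0" if "k < q" for k
    using x 0 that by (intro br_gen_gen_0) simp_all
  then show ?thesis
    unfolding z
    by (subst br_sum_right[OF gen_in_B[OF x], where l="-1"])
      (simp_all add: subspace_scale subspace_B gens_in_B br_scaleR_right[OF gen_in_B[OF x] gens_in_B(4)])
qed

text \<open>A multivector field has zero bracket with every generator, so only the two groups of
  terms in \<open>Q\<close> with multivector coefficients contribute. The overall minus sign is the
  flip sign in degree 1.\<close>

lemma br_Q_X: "br Q (X x) = - (\<Sum>i<p. X (lie x (u i)) \<star> \<eta> i) - (\<Sum>j<q. F (act x (v j)) \<star> \<nu> j)"
proof -
  have "br (X x) (X (u i) \<star> \<eta> i) = X (lie x (u i)) \<star> \<eta> i" if "i < p" for i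
    using that by (simp add: br_leibniz[OF X_in_B X_in_B gens_in_B(1)] br_mv_mv[OF J1 J1] J1_J1
        br_mv_gen[OF J1])
  moreover have "br (X x) (F (v j) \<star> \<nu> j) = F (act x (v j)) \<star> \<nu> j" if "j < q" for j
    using that by (simp add: br_leibniz[OF X_in_B F_in_B gens_in_B(2)]
        br_mv_mv[OF J1 mv_of_fun_in_multivector_fields[OF J0]] J1_J0 br_mv_gen[OF J1])
  moreover have "br (X x) (\<eta> i \<star> \<eta> j \<star> U z) = 0" if "i < p" "j < p" for i j z
    using that by (intro br_star_0[OF X_in_B products_in_B(3) U_in_B]
        br_star_0[OF X_in_B gens_in_B(1) gens_in_B(1)] br_mv_gen[OF J1] br_mv_U[OF J1]) simp_all
  moreover have "br (X x) (\<eta> i \<star> \<nu> j \<star> V z) = 0" if "i < p" "j < q" for i j z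
    using that by (intro br_star_0[OF X_in_B products_in_B(4) V_in_B]
        br_star_0[OF X_in_B gens_in_B(1) gens_in_B(2)] br_mv_gen[OF J1] br_mv_V[OF J1]) simp_all
  ultimately show ?thesis
    by (simp add: br_Q_flip[OF X_in_B] br_Q_right[OF X_in_B] koszul_def)
qed

lemma br_Q_F: "br Q (F y) = - (\<Sum>i<p. F (act (u i) y) \<star> \<eta> i)"
proof -
  note J0' = mv_of_fun_in_multivector_fields[OF J0]
  have "br (F y) (X x) = - F (act x y)" for x
    by (simp add: br_antisym[OF F_in_B X_in_B] br_mv_mv[OF J1 J0'] J1_J0)
  then have "br (F y) (X (u i) \<star> \<eta> i) = - (F (act (u i) y) \<star> \<eta> i)" if "i < p" for i
    using that by (simp add: br_leibniz[OF F_in_B X_in_B gens_in_B(1)] star_linear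
        br_mv_gen[OF J0'])
  moreover have "br (F y) (F (v j) \<star> \<nu> j) = 0" if "j < q" for j
    using that by (intro br_star_0[OF F_in_B F_in_B gens_in_B(2)] br_fun_fun J0 br_mv_gen[OF J0'])
      simp_all
  moreover have "br (F y) (\<eta> i \<star> \<eta> j \<star> U z) = 0" if "i < p" "j < p" for i j z
    using that by (intro br_star_0[OF F_in_B products_in_B(3) U_in_B]
        br_star_0[OF F_in_B gens_in_B(1) gens_in_B(1)] br_mv_gen[OF J0'] br_mv_U[OF J0']) simp_all
  moreover have "br (F y) (\<eta> i \<star> \<nu> j \<star> V z) = 0" if "i < p" "j < q" for i j z
    using that by (intro br_star_0[OF F_in_B products_in_B(4) V_in_B]
        br_star_0[OF F_in_B gens_in_B(1) gens_in_B(2)] br_mv_gen[OF J0'] br_mv_V[OF J0']) simp_all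
  ultimately show ?thesis
    by (simp add: br_Q_flip[OF F_in_B] br_Q_right[OF F_in_B] sum_negf)
qed

lemma sum_if_eq_left:
  fixes f :: "nat \<Rightarrow> 'z::comm_monoid_add"
  shows "k < n \<Longrightarrow> (\<Sum>i<n. if k = i then f i else 0) = f k"
    "k < n \<Longrightarrow> (\<Sum>i<n. if i = k then f i else 0) = f k"
  by (simp_all add: sum.delta sum.delta')

text \<open>\<open>\<eta> k\<close> is dual to \<open>u k\<close> only, so it reads off the
  coordinate \<open>c i j k\<close> of \<open>lie (u i) (u j)\<close>. Up to sign this is the
  Chevalley-Eilenberg differential of an element of the dual basis.\<close>

lemma br_eta_Q:
  assumes "k < p"
  shows "br (\<eta> k) Q = - ((1/2) *\<^sub>R (\<Sum>i<p. \<Sum>j<p. c i j k *\<^sub>R (\<eta> i \<star> \<eta> j)))"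
proof -
  note k = gens_in_B(1)[OF assms]
  have eta: "br (\<eta> k) (\<eta> i) = 0" if "i < p" for i
    using that assms by (simp add: br_gen_gen_0)
  have nu: "br (\<eta> k) (\<nu> j) = 0" if "j < q" for j
    using that assms by (simp add: br_gen_gen_0)
  have V: "br (\<eta> k) (V y) = 0" for y
    using assms by (simp add: br_gen_V_0)
  have U: "br (\<eta> k) (U (lie (u i) (u j))) = c i j k *\<^sub>R bfv_one" if "i < p" "j < p" for i j
  proof -
    have "U (lie (u i) (u j)) = (\<Sum>l<p. c i j l *\<^sub>R bfv_gen (UGen l))"
      using that by (simp add: c linear_sum[OF linear_U] linear_scale[OF linear_U] U_u)
    moreover have "br (\<eta> k) (\<Sum>l<p. c i j l *\<^sub>R bfv_gen (UGen l)) =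
        (\<Sum>l<p. br (\<eta> k) (c i j l *\<^sub>R bfv_gen (UGen l)))"
      by (rule br_sum_right[OF k, where l=0]) (simp add: subspace_scale subspace_B gens_in_B)
    moreover have "\<dots> = (\<Sum>l<p. if k = l then c i j l *\<^sub>R bfv_one else 0)"
      using assms by (intro sum.cong refl) (simp add: br_scaleR_right[OF k gens_in_B(3)] br_UStar_UGen)
    ultimately show ?thesis
      using assms by (simp only: sum_if_eq_left)
  qed
  have "br (\<eta> k) (X (u i) \<star> \<eta> i) = 0" if "i < p" for i
    using that assms by (intro br_star_0[OF k X_in_B gens_in_B(1)] br_gen_mv[OF J1] eta) simp_all
  moreover have "br (\<eta> k) (F (v j) \<star> \<nu> j) = 0" if "j < q" for j
    using that assms by (intro br_star_0[OF k F_in_B gens_in_B(2)]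
        br_gen_mv[OF mv_of_fun_in_multivector_fields[OF J0]] nu) simp_all
  moreover have "br (\<eta> k) (\<eta> i \<star> \<eta> j \<star> U (lie (u i) (u j))) = c i j k *\<^sub>R (\<eta> i \<star> \<eta> j)"
    if "i < p" "j < p" for i j
    using that by (simp add: br_leibniz[OF k products_in_B(3) U_in_B] U star_linear star_one_right
        br_star_0[OF k gens_in_B(1) gens_in_B(1)] eta)
  moreover have "br (\<eta> k) (\<eta> i \<star> \<nu> j \<star> V z) = 0" if "i < p" "j < q" for i j z
    using that by (intro br_star_0[OF k products_in_B(4) V_in_B]
        br_star_0[OF k gens_in_B(1) gens_in_B(2)] eta nu V) simp_all
  ultimately show ?thesis
    by (simp add: br_Q_right[OF k])
qed

lemma br_Q_eta: "k < p \<Longrightarrow> br Q (\<eta> k) = (1/2) *\<^sub>R (\<Sum>i<p. \<Sum>j<p. c i j k *\<^sub>R (\<eta> i \<star> \<eta> j))"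
  by (simp add: br_Q_flip[OF gens_in_B(1)] br_eta_Q koszul_def)

lemma br_Q_nu:
  assumes "k < q"
  shows "br Q (\<nu> k) = (\<Sum>i<p. \<Sum>j<q. d i j k *\<^sub>R (\<eta> i \<star> \<nu> j))"
proof -
  note k = gens_in_B(2)[OF assms]
  have eta: "br (\<nu> k) (\<eta> i) = 0" if "i < p" for i
    using that assms by (simp add: br_gen_gen_0)
  have nu: "br (\<nu> k) (\<nu> j) = 0" if "j < q" for j
    using that assms by (simp add: br_gen_gen_0)
  have U: "br (\<nu> k) (U x) = 0" for x
    using assms by (simp add: br_gen_U_0)
  have V: "br (\<nu> k) (V (act (u i) (v j))) = d i j k *\<^sub>R bfv_one" if "i < p" "j < q" for i j
  proof -
    have "V (act (u i) (v j)) = (\<Sum>l<q. d i j l *\<^sub>R bfv_gen (VGen l))"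
      using that by (simp add: d linear_sum[OF linear_V] linear_scale[OF linear_V] V_v)
    moreover have "br (\<nu> k) (\<Sum>l<q. d i j l *\<^sub>R bfv_gen (VGen l)) =
        (\<Sum>l<q. br (\<nu> k) (d i j l *\<^sub>R bfv_gen (VGen l)))"
      by (rule br_sum_right[OF k, where l="-1"]) (simp add: subspace_scale subspace_B gens_in_B)
    moreover have "\<dots> = (\<Sum>l<q. if k = l then d i j l *\<^sub>R bfv_one else 0)"
      using assms by (intro sum.cong refl) (simp add: br_scaleR_right[OF k gens_in_B(4)] br_VStar_VGen)
    ultimately show ?thesis
      using assms by (simp only: sum_if_eq_left)
  qed
  have "br (\<nu> k) (X (u i) \<star> \<eta> i) = 0" if "i < p" for i
    using that assms by (intro br_star_0[OF k X_in_B gens_in_B(1)] br_gen_mv[OF J1] eta) simp_all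
  moreover have "br (\<nu> k) (F (v j) \<star> \<nu> j) = 0" if "j < q" for j
    using that assms by (intro br_star_0[OF k F_in_B gens_in_B(2)]
        br_gen_mv[OF mv_of_fun_in_multivector_fields[OF J0]] nu) simp_all
  moreover have "br (\<nu> k) (\<eta> i \<star> \<eta> j \<star> U z) = 0" if "i < p" "j < p" for i j z
    using that by (intro br_star_0[OF k products_in_B(3) U_in_B]
        br_star_0[OF k gens_in_B(1) gens_in_B(1)] eta U) simp_all
  \<comment> \<open>The derivation \<open>{\<nu> k, \<cdot>}\<close> has degree 1 and passes a
    product of degree 3, which gives the minus sign.\<close>
  moreover have "br (\<nu> k) (\<eta> i \<star> \<nu> j \<star> V (act (u i) (v j))) = - (d i j k *\<^sub>R (\<eta> i \<star> \<nu> j))"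
    if "i < p" "j < q" for i j
    using that by (simp add: br_leibniz[OF k products_in_B(4) V_in_B] V star_linear star_one_right
        br_star_0[OF k gens_in_B(1) gens_in_B(2)] eta nu koszul_def)
  ultimately show ?thesis
    by (simp add: br_Q_flip[OF k] br_Q_right[OF k] sum_negf koszul_def)
qed

text \<open>Both sides are linear in \<open>x\<close>, so \<open>x\<close> may be a basis vector,
  whose bracket strips off the dual \<open>\<eta>\<close>. In the terms with \<open>U\<close> it can
  hit either of two such factors; by antisymmetry of \<open>lie\<close> the two contributions agree,
  which cancels the factor 1/2. The summand \<open>X x\<close> is the Koszul part, the two sums are
  the action on \<gg> and on \<hh>.\<close>

lemma br_Q_U:
  "br Q (U x) = X x + (\<Sum>j<p. \<eta> j \<star> U (lie x (u j))) + (\<Sum>j<q. \<nu> j \<star> V (act x (v j)))"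
  (is "_ = ?r x")
proof (rule linear_eq_on_u[where f = "\<lambda>x. br Q (U x)"])
  show "linear (\<lambda>x. br Q (U x))"
    by (simp add: linear_iff linear_add[OF linear_U] linear_scale[OF linear_U]
        br_add_right[OF Q_in_B U_in_B U_in_B] br_scaleR_right[OF Q_in_B U_in_B])
  show "linear ?r"
    by (intro linear_compose_add linear_compose_sum linear_X linear_star_right ballI
        linear_comp[OF linear_U linear_lie_left] linear_comp[OF linear_V linear_act_left])
next
  fix k assume kp: "k < p"
  note k = gens_in_B(3)[OF kp]
  have eta: "br (bfv_gen (UGen k)) (\<eta> i) = (if k = i then - bfv_one else 0)" if "i < p" for i
    using that kp by (rule br_UGen_UStar[rotated])
  have nu: "br (bfv_gen (UGen k)) (\<nu> j) = 0" if "j < q" for j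
    using that kp by (simp add: br_gen_gen_0)
  have U: "br (bfv_gen (UGen k)) (U x) = 0" and V: "br (bfv_gen (UGen k)) (V y) = 0" for x y
    using kp by (simp_all add: br_gen_U_0 br_gen_V_0)
  have 1: "br (bfv_gen (UGen k)) (X (u i) \<star> \<eta> i) = (if k = i then X (u i) else 0)" if "i < p" for i
    using that kp by (simp add: br_leibniz[OF k X_in_B gens_in_B(1)] br_gen_mv[OF J1] eta koszul_def
        star_linear star_one_right)
  have 2: "br (bfv_gen (UGen k)) (F (v j) \<star> \<nu> j) = 0" if "j < q" for j
    using that kp by (intro br_star_0[OF k F_in_B gens_in_B(2)]
        br_gen_mv[OF mv_of_fun_in_multivector_fields[OF J0]] nu) simp_all
  have 3: "br (bfv_gen (UGen k)) (\<eta> i \<star> \<eta> j \<star> U z) =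
      (if k = j then \<eta> i \<star> U z else 0) - (if k = i then \<eta> j \<star> U z else 0)" if "i < p" "j < p" for i j z
    using that by (simp add: br_leibniz[OF k products_in_B(3) U_in_B]
        br_leibniz[OF k gens_in_B(1) gens_in_B(1)] eta U koszul_def star_linear
        star_one_right star_one_left)
  have 4: "br (bfv_gen (UGen k)) (\<eta> i \<star> \<nu> j \<star> V z) = (if k = i then - (\<nu> j \<star> V z) else 0)"
    if "i < p" "j < q" for i j z
    using that by (simp add: br_leibniz[OF k products_in_B(4) V_in_B]
        br_leibniz[OF k gens_in_B(1) gens_in_B(2)] eta nu V koszul_def star_linear star_one_left)
  have "(\<Sum>i<p. \<Sum>j<p. br (bfv_gen (UGen k)) (\<eta> i \<star> \<eta> j \<star> U (lie (u i) (u j)))) =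
      (\<Sum>i<p. \<Sum>j<p. if k = j then \<eta> i \<star> U (lie (u i) (u j)) else 0)
      - (\<Sum>i<p. \<Sum>j<p. if k = i then \<eta> j \<star> U (lie (u i) (u j)) else 0)"
    by (simp add: 3 sum_subtractf)
  also have "(\<Sum>i<p. \<Sum>j<p. if k = j then \<eta> i \<star> U (lie (u i) (u j)) else 0) =
      (\<Sum>i<p. \<eta> i \<star> U (lie (u i) (u k)))"
    using kp by (simp only: sum_if_eq_left)
  also have "(\<Sum>i<p. \<Sum>j<p. if k = i then \<eta> j \<star> U (lie (u i) (u j)) else 0) =
      (\<Sum>j<p. \<eta> j \<star> U (lie (u k) (u j)))"
    by (subst sum.swap) (use kp in \<open>simp only: sum_if_eq_left\<close>)
  also have "(\<Sum>i<p. \<eta> i \<star> U (lie (u i) (u k))) = - (\<Sum>j<p. \<eta> j \<star> U (lie (u k) (u j)))"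
    unfolding lie_antisym[of _ "u k"] linear_neg[OF linear_U] star_linear sum_negf ..
  finally have s3: "(\<Sum>i<p. \<Sum>j<p. br (bfv_gen (UGen k)) (\<eta> i \<star> \<eta> j \<star> U (lie (u i) (u j)))) =
      - (2 *\<^sub>R (\<Sum>j<p. \<eta> j \<star> U (lie (u k) (u j))))"
    by (simp only: scaleR_2 minus_add_distrib diff_conv_add_uminus)
  have s1: "(\<Sum>i<p. br (bfv_gen (UGen k)) (X (u i) \<star> \<eta> i)) = X (u k)"
    using kp by (simp add: 1 sum_if_eq_left)
  have "(\<Sum>i<p. \<Sum>j<q. br (bfv_gen (UGen k)) (\<eta> i \<star> \<nu> j \<star> V (act (u i) (v j)))) =
      (\<Sum>j<q. \<Sum>i<p. if k = i then - (\<nu> j \<star> V (act (u i) (v j))) else 0)"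
    by (subst sum.swap) (simp add: 4)
  then have s4: "(\<Sum>i<p. \<Sum>j<q. br (bfv_gen (UGen k)) (\<eta> i \<star> \<nu> j \<star> V (act (u i) (v j)))) =
      - (\<Sum>j<q. \<nu> j \<star> V (act (u k) (v j)))"
    using kp by (simp only: sum_if_eq_left sum_negf)
  show "br Q (U (u k)) = ?r (u k)"
    unfolding U_u[OF kp] br_Q_flip[OF k] br_Q_right[OF k] s1 s3 s4
    by (simp add: 2 fun_eq_iff)
qed

text \<open>A basis vector of \<hh> strips off its dual \<open>\<nu>\<close>, which occurs in two
  groups of terms of \<open>Q\<close>: one yields the Koszul part \<open>F y\<close>, the other the
  action.\<close>

lemma br_Q_V: "br Q (V y) = F y - (\<Sum>i<p. \<eta> i \<star> V (act (u i) y))"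
  (is "_ = ?r y")
proof (rule linear_eq_on_v[where f = "\<lambda>y. br Q (V y)"])
  show "linear (\<lambda>x. br Q (V x))"
    by (simp add: linear_iff linear_add[OF linear_V] linear_scale[OF linear_V]
        br_add_right[OF Q_in_B V_in_B V_in_B] br_scaleR_right[OF Q_in_B V_in_B])
  show "linear ?r"
    by (intro linear_compose_sub linear_compose_sum linear_F linear_star_right ballI
        linear_comp[OF linear_V linear_act_right])
next
  fix k assume kq: "k < q"
  note k = gens_in_B(4)[OF kq]
  have eta: "br (bfv_gen (VGen k)) (\<eta> i) = 0" if "i < p" for i
    using that kq by (simp add: br_gen_gen_0)
  have nu: "br (bfv_gen (VGen k)) (\<nu> j) = (if k = j then - bfv_one else 0)" if "j < q" for j
    using that kq by (rule br_VGen_VStar[rotated])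
  have U: "br (bfv_gen (VGen k)) (U x) = 0" and V: "br (bfv_gen (VGen k)) (V y) = 0" for x y
    using kq by (simp_all add: br_gen_U_0 br_gen_V_0)
  have 1: "br (bfv_gen (VGen k)) (X (u i) \<star> \<eta> i) = 0" if "i < p" for i
    using that kq by (intro br_star_0[OF k X_in_B gens_in_B(1)] br_gen_mv[OF J1] eta) simp_all
  have 2: "br (bfv_gen (VGen k)) (F (v j) \<star> \<nu> j) = (if k = j then - F (v j) else 0)" if "j < q" for j
    using that kq by (simp add: br_leibniz[OF k F_in_B gens_in_B(2)] nu star_linear star_one_right
        br_gen_mv[OF mv_of_fun_in_multivector_fields[OF J0]])
  have 3: "br (bfv_gen (VGen k)) (\<eta> i \<star> \<eta> j \<star> U z) = 0" if "i < p" "j < p" for i j z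
    using that by (intro br_star_0[OF k products_in_B(3) U_in_B]
        br_star_0[OF k gens_in_B(1) gens_in_B(1)] eta U) simp_all
  have 4: "br (bfv_gen (VGen k)) (\<eta> i \<star> \<nu> j \<star> V z) = (if k = j then - (\<eta> i \<star> V z) else 0)"
    if "i < p" "j < q" for i j z
    using that by (simp add: br_leibniz[OF k products_in_B(4) V_in_B]
        br_leibniz[OF k gens_in_B(1) gens_in_B(2)] eta nu V koszul_def star_linear star_one_right)
  have s2: "(\<Sum>j<q. br (bfv_gen (VGen k)) (F (v j) \<star> \<nu> j)) = - F (v k)"
    using kq by (simp add: 2 sum_if_eq_left)
  have s4: "(\<Sum>i<p. \<Sum>j<q. br (bfv_gen (VGen k)) (\<eta> i \<star> \<nu> j \<star> V (act (u i) (v j)))) =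
      - (\<Sum>i<p. \<eta> i \<star> V (act (u i) (v k)))"
    using kq by (simp add: 4 sum_if_eq_left sum_negf)
  show "br Q (V (v k)) = ?r (v k)"
    unfolding V_v[OF kq] br_Q_flip[OF k] br_Q_right[OF k] s2 s4
    by (simp add: 1 3 koszul_def fun_eq_iff)
qed

subsection \<open>The master equation\<close>

lemma eta_eta: "i < p \<Longrightarrow> j < p \<Longrightarrow> \<eta> j \<star> \<eta> i = - (\<eta> i \<star> \<eta> j)"
  using star_commute[OF gens_in_B(1) fun_coeff_gen gens_in_B(1) fun_coeff_gen, of j i]
  by (simp add: koszul_def)

lemma nu_eta: "i < p \<Longrightarrow> j < q \<Longrightarrow> \<nu> j \<star> \<eta> i = \<eta> i \<star> \<nu> j"
  using star_commute[OF gens_in_B(2) fun_coeff_gen gens_in_B(1) fun_coeff_gen, of j i]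
  by (simp add: koszul_def)

lemma br_Q_star:
  "x \<in> B k \<Longrightarrow> y \<in> B l \<Longrightarrow> br Q (x \<star> y) = br Q x \<star> y + koszul k *\<^sub>R (x \<star> br Q y)"
  using br_leibniz[OF Q_in_B, of x k y l] by simp

text \<open>The factor 1/2 is a difference: differentiating \<open>X (u i)\<close> gives the full
  sum over \<open>X (lie (u i) (u j))\<close>, and differentiating \<open>\<eta> i\<close> takes
  half of it away once the constants are absorbed.\<close>

lemma sum_br_Q_X_eta:
  "(\<Sum>i<p. br Q (X (u i) \<star> \<eta> i)) =
     (1/2) *\<^sub>R (\<Sum>i<p. \<Sum>j<p. X (lie (u i) (u j)) \<star> (\<eta> i \<star> \<eta> j))
     - (\<Sum>i<p. \<Sum>j<q. F (act (u i) (v j)) \<star> (\<eta> i \<star> \<nu> j))"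
proof -
  have "br Q (X (u i) \<star> \<eta> i) = (\<Sum>j<p. X (lie (u i) (u j)) \<star> (\<eta> i \<star> \<eta> j))
      - (\<Sum>j<q. F (act (u i) (v j)) \<star> (\<eta> i \<star> \<nu> j))
      - (1/2) *\<^sub>R (\<Sum>k<p. \<Sum>l<p. c k l i *\<^sub>R (X (u i) \<star> (\<eta> k \<star> \<eta> l)))" if i: "i < p" for i
  proof -
    have "X (lie (u i) (u j)) \<star> \<eta> j \<star> \<eta> i = - (X (lie (u i) (u j)) \<star> (\<eta> i \<star> \<eta> j))" if "j < p" for j
      by (simp add: star_assoc eta_eta[OF i that] star_minus_right)
    moreover have "F (act (u i) (v j)) \<star> \<nu> j \<star> \<eta> i = F (act (u i) (v j)) \<star> (\<eta> i \<star> \<nu> j)" if "j < q" for j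
      using i that by (simp add: star_assoc nu_eta)
    moreover have "br Q (X (u i) \<star> \<eta> i) = br Q (X (u i)) \<star> \<eta> i - X (u i) \<star> br Q (\<eta> i)"
      using i by (simp add: br_Q_star[OF X_in_B gens_in_B(1)] koszul_def)
    ultimately show ?thesis
      using i by (simp add: br_Q_X br_Q_eta star_linear star_diff_left sum_negf)
  qed
  moreover have "(\<Sum>i<p. \<Sum>k<p. \<Sum>l<p. c k l i *\<^sub>R (X (u i) \<star> (\<eta> k \<star> \<eta> l))) =
      (\<Sum>i<p. \<Sum>j<p. X (lie (u i) (u j)) \<star> (\<eta> i \<star> \<eta> j))"
    by (rule sum_structure_u) (intro linear_star_left linear_X)
  ultimately show ?thesis
    by (simp add: sum_subtractf flip: scaleR_sum_right)
      (simp add: fun_eq_iff)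
qed

text \<open>Differentiating \<open>F\<close> and differentiating \<open>\<nu>\<close> both produce
  the action of \<gg> on \<hh>, with opposite signs.\<close>

lemma sum_br_Q_F_nu: "(\<Sum>j<q. br Q (F (v j) \<star> \<nu> j)) = 0"
proof -
  have "br Q (F (v j) \<star> \<nu> j) = (\<Sum>k<p. \<Sum>l<q. d k l j *\<^sub>R (F (v j) \<star> (\<eta> k \<star> \<nu> l)))
      - (\<Sum>i<p. F (act (u i) (v j)) \<star> (\<eta> i \<star> \<nu> j))" if j: "j < q" for j
    using j by (simp add: br_Q_star[OF F_in_B gens_in_B(2)] br_Q_F br_Q_nu star_linear star_assoc)
  moreover have "(\<Sum>j<q. \<Sum>k<p. \<Sum>l<q. d k l j *\<^sub>R (F (v j) \<star> (\<eta> k \<star> \<nu> l))) =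
      (\<Sum>i<p. \<Sum>j<q. F (act (u i) (v j)) \<star> (\<eta> i \<star> \<nu> j))"
    by (rule sum_structure_v) (intro linear_star_left linear_F)
  moreover have "(\<Sum>j<q. \<Sum>i<p. F (act (u i) (v j)) \<star> (\<eta> i \<star> \<nu> j)) =
      (\<Sum>i<p. \<Sum>j<q. F (act (u i) (v j)) \<star> (\<eta> i \<star> \<nu> j))"
    by (rule sum.swap)
  ultimately show ?thesis
    by (simp add: sum_subtractf)
qed

text \<open>A cyclic permutation of three odd factors is even, so rotating the summation indices
  shows that \<open>?S\<close> equals the sum with either of the other two cyclic versions of the
  double bracket. By the Jacobi identity the three sums add up to zero, that is
  \<open>3 *\<^sub>R ?S = 0\<close>.\<close>

lemma jacobi_sum:
  "(\<Sum>i<p. \<Sum>j<p. \<Sum>k<p. (\<eta> i \<star> \<eta> j) \<star> (\<eta> k \<star> U (lie (lie (u i) (u j)) (u k)))) = 0"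
  (is "?S = 0")
proof -
  let ?E = "\<lambda>i j k x. (\<eta> i \<star> \<eta> j) \<star> (\<eta> k \<star> U x)"
  let ?l = "\<lambda>i j k. lie (lie (u i) (u j)) (u k)"
  have cyc: "?E j k i x = ?E i j k x" if "i < p" "j < p" "k < p" for i j k x
  proof -
    have "(\<eta> j \<star> \<eta> k) \<star> \<eta> i = \<eta> i \<star> (\<eta> j \<star> \<eta> k)"
      using that star_commute[OF products_in_B(3) fun_coeff_star[OF fun_coeff_gen fun_coeff_gen]
          gens_in_B(1) fun_coeff_gen, of j k i] by (simp add: koszul_def)
    then show ?thesis
      by (simp add: fun_coeffs flip: star_assoc)
  qed
  have rot: "(\<Sum>i<p. \<Sum>j<p. \<Sum>k<p. f i j k) = (\<Sum>i<p. \<Sum>j<p. \<Sum>k<p. f j k i)"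
    for f :: "nat \<Rightarrow> nat \<Rightarrow> nat \<Rightarrow> 'm bfv"
    by (rule sum_rotate)
  have "?S = (\<Sum>i<p. \<Sum>j<p. \<Sum>k<p. ?E j k i (?l j k i))"
    by (rule rot)
  then have 1: "?S = (\<Sum>i<p. \<Sum>j<p. \<Sum>k<p. ?E i j k (?l j k i))"
    by (simp add: cyc)
  also have "\<dots> = (\<Sum>i<p. \<Sum>j<p. \<Sum>k<p. ?E j k i (?l k i j))"
    by (rule rot)
  finally have 2: "?S = (\<Sum>i<p. \<Sum>j<p. \<Sum>k<p. ?E i j k (?l k i j))"
    by (simp add: cyc)
  have "?l i j k + ?l j k i + ?l k i j = 0" for i j k
  proof -
    have "?l i j k + ?l k i j = - ?l j k i"
      using lie_jacobi[of "u i" "u j" "u k"] lie_antisym[of "u i" "lie (u j) (u k)"]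
        lie_antisym[of "u j" "lie (u i) (u k)"] lie_antisym[of "u i" "u k"]
        linear_neg[OF linear_lie_left, of "lie (u k) (u i)" "u j"] by simp
    moreover have "?l i j k + ?l j k i + ?l k i j = (?l i j k + ?l k i j) + ?l j k i"
      by (simp only: ac_simps)
    ultimately show ?thesis by simp
  qed
  then have "?E i j k (?l i j k) + ?E i j k (?l j k i) + ?E i j k (?l k i j) = 0" for i j k
    by (simp only: star_linear[symmetric] linear_add[OF linear_U, symmetric] linear_0[OF linear_U]
        star_0_right)
  then have "?S + (\<Sum>i<p. \<Sum>j<p. \<Sum>k<p. ?E i j k (?l j k i)) +
      (\<Sum>i<p. \<Sum>j<p. \<Sum>k<p. ?E i j k (?l k i j)) = 0"
    by (simp only: sum.distrib[symmetric] sum.neutral_const)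
  then have "?S + ?S + ?S = 0"
    unfolding 1[symmetric] 2[symmetric] .
  then have "3 *\<^sub>R ?S = 0"
    by (simp add: fun_eq_iff)
  then show ?thesis by (simp only: scaleR_eq_0_iff) simp
qed

text \<open>All terms with three factors \<open>\<eta>\<close> become instances of
  \<open>jacobi_sum\<close>: two after the constants are absorbed, one directly. What survives comes
  from the Koszul part of \<open>br_Q_U\<close> and from its sum over \<hh>.\<close>

lemma sum_br_Q_eta_eta_U:
  "(\<Sum>i<p. \<Sum>j<p. br Q (\<eta> i \<star> \<eta> j \<star> U (lie (u i) (u j)))) =
     (\<Sum>i<p. \<Sum>j<p. X (lie (u i) (u j)) \<star> (\<eta> i \<star> \<eta> j))
     + (\<Sum>i<p. \<Sum>j<p. \<Sum>k<q. (\<eta> i \<star> \<eta> j) \<star> (\<nu> k \<star> V (act (lie (u i) (u j)) (v k))))"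
proof -
  let ?l = "\<lambda>i j. lie (u i) (u j)"
  let ?E = "\<lambda>i j k x. (\<eta> i \<star> \<eta> j) \<star> (\<eta> k \<star> U x)"
  have step: "br Q (\<eta> i \<star> \<eta> j \<star> U (?l i j)) =
      (1/2) *\<^sub>R (\<Sum>k<p. \<Sum>l<p. c k l i *\<^sub>R ?E k l j (?l i j))
      - (1/2) *\<^sub>R (\<Sum>k<p. \<Sum>l<p. c k l j *\<^sub>R ?E k l i (?l i j))
      + X (?l i j) \<star> (\<eta> i \<star> \<eta> j)
      + (\<Sum>k<p. ?E i j k (lie (?l i j) (u k)))
      + (\<Sum>k<q. (\<eta> i \<star> \<eta> j) \<star> (\<nu> k \<star> V (act (?l i j) (v k))))"
    if i: "i < p" and j: "j < p" for i j
  proof -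
    have "br Q (\<eta> i \<star> \<eta> j \<star> U (?l i j)) =
        br Q (\<eta> i) \<star> \<eta> j \<star> U (?l i j) - \<eta> i \<star> br Q (\<eta> j) \<star> U (?l i j)
        + (\<eta> i \<star> \<eta> j) \<star> br Q (U (?l i j))"
      using i j by (simp add: br_Q_star[OF products_in_B(3) U_in_B] br_Q_star[OF gens_in_B(1) gens_in_B(1)]
          koszul_def star_diff_left)
    moreover have "br Q (\<eta> i) \<star> \<eta> j \<star> U (?l i j) =
        (1/2) *\<^sub>R (\<Sum>k<p. \<Sum>l<p. c k l i *\<^sub>R ?E k l j (?l i j))"
      using i by (simp add: br_Q_eta star_linear star_assoc fun_coeffs)
    moreover have "\<eta> i \<star> br Q (\<eta> j) \<star> U (?l i j) =
        (1/2) *\<^sub>R (\<Sum>k<p. \<Sum>l<p. c k l j *\<^sub>R ?E k l i (?l i j))"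
    proof -
      \<comment> \<open>\<open>\<eta> k \<star> \<eta> l\<close> has even degree, so
        \<open>\<eta> i\<close> passes it without a sign.\<close>
      have "\<eta> i \<star> (\<eta> k \<star> \<eta> l) \<star> U x = ?E k l i x" if "k < p" "l < p" for k l x
        using star_commute[OF gens_in_B(1)[OF i] fun_coeff_gen products_in_B(3)[OF that]
            fun_coeff_star[OF fun_coeff_gen fun_coeff_gen]]
        by (simp add: koszul_def star_assoc[of "\<eta> i" "U x", symmetric] fun_coeffs)
      then show ?thesis
        using j by (simp add: br_Q_eta star_linear)
    qed
    moreover have "(\<eta> i \<star> \<eta> j) \<star> X (?l i j) = X (?l i j) \<star> (\<eta> i \<star> \<eta> j)"
      using star_commute_mv[OF products_in_B(3)[OF i j] _ J1] by (simp add: fun_coeffs koszul_def)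
    ultimately show ?thesis
      by (simp add: br_Q_U star_linear add.assoc)
  qed
  have s1: "(\<Sum>i<p. \<Sum>j<p. \<Sum>k<p. \<Sum>l<p. c k l i *\<^sub>R ?E k l j (?l i j)) = 0"
  proof -
    have "(\<Sum>i<p. \<Sum>j<p. \<Sum>k<p. \<Sum>l<p. c k l i *\<^sub>R ?E k l j (?l i j)) =
        (\<Sum>j<p. \<Sum>i<p. \<Sum>k<p. \<Sum>l<p. c k l i *\<^sub>R ?E k l j (?l i j))"
      by (rule sum.swap)
    also have "\<dots> = (\<Sum>j<p. \<Sum>k<p. \<Sum>l<p. ?E k l j (lie (?l k l) (u j)))"
      by (intro sum.cong refl sum_structure_u linear_star_right linear_comp[OF linear_U linear_lie_left])
    also have "\<dots> = 0"
      by (subst sum_rotate[symmetric]) (rule jacobi_sum)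
    finally show ?thesis .
  qed
  have s2: "(\<Sum>i<p. \<Sum>j<p. \<Sum>k<p. \<Sum>l<p. c k l j *\<^sub>R ?E k l i (?l i j)) = 0"
  proof -
    have "(\<Sum>i<p. \<Sum>j<p. \<Sum>k<p. \<Sum>l<p. c k l j *\<^sub>R ?E k l i (?l i j)) =
        (\<Sum>i<p. \<Sum>k<p. \<Sum>l<p. ?E k l i (lie (u i) (?l k l)))"
      by (intro sum.cong refl sum_structure_u linear_star_right linear_comp[OF linear_U linear_lie_right])
    also have "\<dots> = - (\<Sum>i<p. \<Sum>k<p. \<Sum>l<p. ?E k l i (lie (?l k l) (u i)))"
      by (subst lie_antisym) (simp only: linear_neg[OF linear_U] star_minus_right sum_negf)
    also have "\<dots> = 0"
      by (subst sum_rotate[symmetric]) (simp only: jacobi_sum minus_zero)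
    finally show ?thesis .
  qed
  have "(\<Sum>i<p. \<Sum>j<p. br Q (\<eta> i \<star> \<eta> j \<star> U (?l i j))) =
      (1/2) *\<^sub>R (\<Sum>i<p. \<Sum>j<p. \<Sum>k<p. \<Sum>l<p. c k l i *\<^sub>R ?E k l j (?l i j))
      - (1/2) *\<^sub>R (\<Sum>i<p. \<Sum>j<p. \<Sum>k<p. \<Sum>l<p. c k l j *\<^sub>R ?E k l i (?l i j))
      + (\<Sum>i<p. \<Sum>j<p. X (?l i j) \<star> (\<eta> i \<star> \<eta> j))
      + (\<Sum>i<p. \<Sum>j<p. \<Sum>k<p. ?E i j k (lie (?l i j) (u k)))
      + (\<Sum>i<p. \<Sum>j<p. \<Sum>k<q. (\<eta> i \<star> \<eta> j) \<star> (\<nu> k \<star> V (act (?l i j) (v k))))"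
    by (simp add: step sum.distrib sum_subtractf flip: scaleR_sum_right)
  then show ?thesis
    unfolding s1 s2 jacobi_sum by simp
qed

text \<open>Differentiating \<open>\<eta>\<close> gives \<open>?W\<close> with factor 1/2.
  Differentiating \<open>\<nu>\<close> and \<open>V\<close> gives a difference of two iterated
  actions, which is \<open>- ?W\<close> by the module law; together this makes -1/2.\<close>

lemma sum_br_Q_eta_nu_V:
  "(\<Sum>i<p. \<Sum>j<q. br Q (\<eta> i \<star> \<nu> j \<star> V (act (u i) (v j)))) =
     - ((1/2) *\<^sub>R (\<Sum>i<p. \<Sum>j<p. \<Sum>k<q. (\<eta> i \<star> \<eta> j) \<star> (\<nu> k \<star> V (act (lie (u i) (u j)) (v k)))))
     - (\<Sum>i<p. \<Sum>j<q. F (act (u i) (v j)) \<star> (\<eta> i \<star> \<nu> j))"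
  (is "_ = - ((1/2) *\<^sub>R ?W) - ?FF")
proof -
  let ?z = "\<lambda>i j. act (u i) (v j)"
  let ?G = "\<lambda>i k j y. (\<eta> i \<star> \<eta> k) \<star> (\<nu> j \<star> V y)"
  have step: "br Q (\<eta> i \<star> \<nu> j \<star> V (?z i j)) =
      (1/2) *\<^sub>R (\<Sum>k<p. \<Sum>l<p. c k l i *\<^sub>R ?G k l j (?z i j))
      - (\<Sum>k<p. \<Sum>l<q. d k l j *\<^sub>R ?G i k l (?z i j))
      - F (?z i j) \<star> (\<eta> i \<star> \<nu> j)
      + (\<Sum>k<p. ?G i k j (act (u k) (?z i j)))"
    if i: "i < p" and j: "j < q" for i j
  proof -
    have "br Q (\<eta> i \<star> \<nu> j \<star> V (?z i j)) =
        br Q (\<eta> i) \<star> \<nu> j \<star> V (?z i j) - \<eta> i \<star> br Q (\<nu> j) \<star> V (?z i j)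
        - (\<eta> i \<star> \<nu> j) \<star> br Q (V (?z i j))"
      using i j by (simp add: br_Q_star[OF products_in_B(4) V_in_B] br_Q_star[OF gens_in_B(1) gens_in_B(2)]
          koszul_def star_diff_left)
    moreover have "br Q (\<eta> i) \<star> \<nu> j \<star> V (?z i j) =
        (1/2) *\<^sub>R (\<Sum>k<p. \<Sum>l<p. c k l i *\<^sub>R ?G k l j (?z i j))"
      using i by (simp add: br_Q_eta star_linear star_assoc fun_coeffs)
    moreover have "\<eta> i \<star> br Q (\<nu> j) \<star> V (?z i j) =
        (\<Sum>k<p. \<Sum>l<q. d k l j *\<^sub>R ?G i k l (?z i j))"
      using j by (simp add: br_Q_nu star_linear star_assoc fun_coeffs)
    moreover have "(\<eta> i \<star> \<nu> j) \<star> F (?z i j) = F (?z i j) \<star> (\<eta> i \<star> \<nu> j)"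
      using star_commute_mv[OF products_in_B(4)[OF i j] _ mv_of_fun_in_multivector_fields[OF J0]]
      by (simp add: fun_coeffs)
    moreover have "(\<eta> i \<star> \<nu> j) \<star> (\<eta> k \<star> V y) = ?G i k j y" if "k < p" for k y
    proof -
      have "(\<eta> i \<star> \<nu> j) \<star> (\<eta> k \<star> V y) = \<eta> i \<star> ((\<nu> j \<star> \<eta> k) \<star> V y)"
        by (simp add: star_assoc fun_coeffs)
      also have "\<dots> = ?G i k j y"
        unfolding nu_eta[OF that j] by (simp add: star_assoc fun_coeffs)
      finally show ?thesis .
    qed
    ultimately show ?thesis
      by (simp add: br_Q_V star_linear star_diff_right)
  qed
  have s1: "(\<Sum>i<p. \<Sum>j<q. \<Sum>k<p. \<Sum>l<p. c k l i *\<^sub>R ?G k l j (?z i j)) = ?W"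
  proof -
    have "(\<Sum>i<p. \<Sum>j<q. \<Sum>k<p. \<Sum>l<p. c k l i *\<^sub>R ?G k l j (?z i j)) =
        (\<Sum>j<q. \<Sum>i<p. \<Sum>k<p. \<Sum>l<p. c k l i *\<^sub>R ?G k l j (?z i j))"
      by (rule sum.swap)
    also have "\<dots> = (\<Sum>j<q. \<Sum>k<p. \<Sum>l<p. ?G k l j (act (lie (u k) (u l)) (v j)))"
      by (intro sum.cong refl sum_structure_u linear_star_right linear_comp[OF linear_V linear_act_left])
    also have "\<dots> = ?W"
      by (rule sum_rotate[symmetric])
    finally show ?thesis .
  qed
  have s2: "(\<Sum>i<p. \<Sum>j<q. \<Sum>k<p. \<Sum>l<q. d k l j *\<^sub>R ?G i k l (?z i j)) =
      (\<Sum>i<p. \<Sum>k<p. \<Sum>l<q. ?G i k l (act (u i) (?z k l)))"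
    by (intro sum.cong refl sum_structure_v linear_star_right linear_comp[OF linear_V linear_act_right])
  have s3: "(\<Sum>i<p. \<Sum>j<q. \<Sum>k<p. ?G i k j (act (u k) (?z i j))) =
      (\<Sum>i<p. \<Sum>k<p. \<Sum>l<q. ?G i k l (act (u k) (?z i l)))"
    by (intro sum.cong refl sum.swap)
  have s4: "(\<Sum>i<p. \<Sum>k<p. \<Sum>l<q. ?G i k l (act (u i) (?z k l)))
      = ?W + (\<Sum>i<p. \<Sum>k<p. \<Sum>l<q. ?G i k l (act (u k) (?z i l)))"
  proof -
    have "?G i k l (act (u i) (?z k l)) =
        ?G i k l (act (lie (u i) (u k)) (v l)) + ?G i k l (act (u k) (?z i l))" for i k l
      by (subst act_act) (simp only: linear_add[OF linear_V] star_linear)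
    then show ?thesis by (simp only: sum.distrib)
  qed
  have "(\<Sum>i<p. \<Sum>j<q. br Q (\<eta> i \<star> \<nu> j \<star> V (?z i j))) =
      (1/2) *\<^sub>R (\<Sum>i<p. \<Sum>j<q. \<Sum>k<p. \<Sum>l<p. c k l i *\<^sub>R ?G k l j (?z i j))
      - (\<Sum>i<p. \<Sum>j<q. \<Sum>k<p. \<Sum>l<q. d k l j *\<^sub>R ?G i k l (?z i j)) - ?FF
      + (\<Sum>i<p. \<Sum>j<q. \<Sum>k<p. ?G i k j (act (u k) (?z i j)))"
    by (simp add: step sum.distrib sum_subtractf flip: scaleR_sum_right)
  also have "\<dots> = - ((1/2) *\<^sub>R ?W) - ?FF"
    unfolding s1 s2 s3 s4 by (simp add: fun_eq_iff)
  finally show ?thesis .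
qed

text \<open>Three families of sums remain: with coefficients \<open>X\<close>, with coefficients
  \<open>F\<close>, and with \<open>V\<close> of an iterated action. Each occurs twice, with
  opposite coefficients.\<close>

lemma br_Q_Q: "br Q Q = 0"
  unfolding br_Q_right[OF Q_in_B] sum_br_Q_X_eta sum_br_Q_F_nu sum_br_Q_eta_eta_U sum_br_Q_eta_nu_V
  by (simp add: fun_eq_iff add_divide_distrib)

text \<open>Against \<pi> only the terms of \<open>Q\<close> with \<open>J0\<close> react; by
  \<open>pi_J0\<close> they give \<open>X (\<delta> (v j)) \<star> \<nu> j\<close>, which is also
  the Koszul part of differentiating \<open>U (\<delta> (v j))\<close>. The terms with
  \<open>\<eta> \<star> \<nu>\<close> cancel because \<delta> is equivariant. In the terms with two
  factors \<open>\<nu>\<close>, these commute while \<open>act (\<delta> y) y'\<close> is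
  antisymmetric in \<open>y\<close> and \<open>y'\<close>.\<close>

lemma br_Q_P: "br Q P = 0"
proof -
  have "br (bfv_mv \<pi>) (X x) = 0" for x
    by (simp add: br_mv_mv[OF pi J1] pi_J1)
  then have 1: "br (bfv_mv \<pi>) (X x \<star> \<eta> i) = 0" if "i < p" for i x
    using that by (simp add: br_star_0[OF pi_in_B X_in_B gens_in_B(1)] br_mv_gen[OF pi])
  have 2: "br (bfv_mv \<pi>) (F y \<star> \<nu> j) = X (\<delta> y) \<star> \<nu> j" if "j < q" for y j
    using that by (simp add: br_leibniz[OF pi_in_B F_in_B gens_in_B(2)] br_mv_gen[OF pi]
        br_mv_mv[OF pi mv_of_fun_in_multivector_fields[OF J0]] pi_J0)
  have 3: "br (bfv_mv \<pi>) (\<eta> i \<star> \<eta> j \<star> U z) = 0" if "i < p" "j < p" for i j z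
    using that by (intro br_star_0[OF pi_in_B products_in_B(3) U_in_B]
        br_star_0[OF pi_in_B gens_in_B(1) gens_in_B(1)] br_mv_gen[OF pi] br_mv_U[OF pi]) simp_all
  have 4: "br (bfv_mv \<pi>) (\<eta> i \<star> \<nu> j \<star> V z) = 0" if "i < p" "j < q" for i j z
    using that by (intro br_star_0[OF pi_in_B products_in_B(4) V_in_B]
        br_star_0[OF pi_in_B gens_in_B(1) gens_in_B(2)] br_mv_gen[OF pi] br_mv_V[OF pi]) simp_all
  have pi: "br Q (bfv_mv \<pi>) = (\<Sum>j<q. X (\<delta> (v j)) \<star> \<nu> j)"
    by (simp add: br_Q_flip[OF pi_in_B] br_Q_right[OF pi_in_B] 1 2 3 4 koszul_def)
  have "br Q (\<nu> j \<star> U (\<delta> (v j))) =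
      (\<Sum>k<p. \<Sum>l<q. d k l j *\<^sub>R ((\<eta> k \<star> \<nu> l) \<star> U (\<delta> (v j))))
      + X (\<delta> (v j)) \<star> \<nu> j - (\<Sum>k<p. (\<eta> k \<star> \<nu> j) \<star> U (\<delta> (act (u k) (v j))))
      + (\<Sum>k<q. \<nu> j \<star> (\<nu> k \<star> V (act (\<delta> (v j)) (v k))))" if j: "j < q" for j
  proof -
    have "br Q (\<nu> j \<star> U (\<delta> (v j))) =
        br Q (\<nu> j) \<star> U (\<delta> (v j)) + \<nu> j \<star> br Q (U (\<delta> (v j)))"
      using j by (simp add: br_Q_star[OF gens_in_B(2) U_in_B] koszul_def)
    moreover have "\<nu> j \<star> X (\<delta> (v j)) = X (\<delta> (v j)) \<star> \<nu> j"
      using star_commute_mv[OF gens_in_B(2)[OF j] _ J1] by (simp add: koszul_def)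
    moreover have "\<nu> j \<star> (\<eta> k \<star> U (lie (\<delta> (v j)) (u k))) = - ((\<eta> k \<star> \<nu> j) \<star> U (\<delta> (act (u k) (v j))))"
      if "k < p" for k
    proof -
      have "\<nu> j \<star> (\<eta> k \<star> U (lie (\<delta> (v j)) (u k))) = (\<eta> k \<star> \<nu> j) \<star> U (lie (\<delta> (v j)) (u k))"
        unfolding nu_eta[OF that j, symmetric] by (simp add: star_assoc fun_coeffs)
      moreover have "lie (\<delta> (v j)) (u k) = - \<delta> (act (u k) (v j))"
        by (simp add: delta_act lie_antisym[of "\<delta> (v j)"])
      ultimately show ?thesis
        by (simp only: linear_neg[OF linear_U] star_minus_right)
    qed
    ultimately show ?thesis
      using j by (simp add: br_Q_nu br_Q_U star_linear sum_negf)
  qed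
  then have "(\<Sum>j<q. br Q (\<nu> j \<star> U (\<delta> (v j)))) =
      (\<Sum>j<q. \<Sum>k<p. \<Sum>l<q. d k l j *\<^sub>R ((\<eta> k \<star> \<nu> l) \<star> U (\<delta> (v j))))
      + (\<Sum>j<q. X (\<delta> (v j)) \<star> \<nu> j)
      - (\<Sum>j<q. \<Sum>k<p. (\<eta> k \<star> \<nu> j) \<star> U (\<delta> (act (u k) (v j))))
      + (\<Sum>j<q. \<Sum>k<q. \<nu> j \<star> (\<nu> k \<star> V (act (\<delta> (v j)) (v k))))"
    by (simp add: sum.distrib sum_subtractf)
  moreover have "(\<Sum>j<q. \<Sum>k<p. \<Sum>l<q. d k l j *\<^sub>R ((\<eta> k \<star> \<nu> l) \<star> U (\<delta> (v j)))) =
      (\<Sum>k<p. \<Sum>j<q. (\<eta> k \<star> \<nu> j) \<star> U (\<delta> (act (u k) (v j))))"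
    by (intro sum_structure_v linear_star_right linear_comp[OF linear_U linear_delta])
  moreover have "(\<Sum>k<p. \<Sum>j<q. (\<eta> k \<star> \<nu> j) \<star> U (\<delta> (act (u k) (v j)))) =
      (\<Sum>j<q. \<Sum>k<p. (\<eta> k \<star> \<nu> j) \<star> U (\<delta> (act (u k) (v j))))"
    by (rule sum.swap)
  moreover have "(\<Sum>j<q. \<Sum>k<q. \<nu> j \<star> (\<nu> k \<star> V (act (\<delta> (v j)) (v k)))) = 0" (is "?S = 0")
  proof -
    have sw: "\<nu> k \<star> (\<nu> j \<star> V (act (\<delta> (v k)) (v j))) = - (\<nu> j \<star> (\<nu> k \<star> V (act (\<delta> (v j)) (v k))))"
      if "j < q" "k < q" for j k
    proof -
      have "\<nu> k \<star> \<nu> j = \<nu> j \<star> \<nu> k"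
        using star_commute[OF gens_in_B(2) fun_coeff_gen gens_in_B(2) fun_coeff_gen, of k j] that
        by (simp add: koszul_def)
      then have "\<nu> k \<star> (\<nu> j \<star> y) = \<nu> j \<star> (\<nu> k \<star> y)" if "fun_coeff y" for y
        using that by (simp flip: star_assoc)
      then show ?thesis
        unfolding act_delta[of "v k" "v j"] linear_neg[OF linear_V] star_minus_right
        by (simp add: fun_coeffs)
    qed
    have "(\<Sum>j<q. \<Sum>k<q. \<nu> k \<star> (\<nu> j \<star> V (act (\<delta> (v k)) (v j)))) =
        (\<Sum>j<q. \<Sum>k<q. - (\<nu> j \<star> (\<nu> k \<star> V (act (\<delta> (v j)) (v k)))))"
      by (intro sum.cong refl sw) simp_all
    moreover have "(\<Sum>j<q. \<Sum>k<q. \<nu> k \<star> (\<nu> j \<star> V (act (\<delta> (v k)) (v j)))) = ?S"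
      by (rule sum.swap)
    ultimately have "?S = - ?S"
      by (simp only: sum_negf)
    then have "2 *\<^sub>R ?S = 0" by (simp only: scaleR_2 eq_neg_iff_add_eq_0)
    then show ?thesis by (simp only: scaleR_eq_0_iff) simp
  qed
  ultimately show ?thesis
    by (simp add: br_Pi_right[OF Q_in_B] pi)
qed

text \<open>\<open>?N\<close> contains only \<open>\<nu>\<close> and \<open>U\<close>, whose dual
  generators are \<open>v\<close> and \<open>\<eta>\<close>. No dual pair meets in
  \<open>br ?N ?N\<close>, and multivector fields have zero bracket with all generators.\<close>

lemma br_P_P: "br P P = 0"
proof -
  let ?N = "\<Sum>j<q. \<nu> j \<star> U (\<delta> (v j))"
  have N: "?N \<in> B 2"
    by (intro subspace_sum subspace_B products_in_B) simp
  have pi_N: "br (bfv_mv \<pi>) ?N = 0"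
    by (subst br_sum_right[OF pi_in_B, where l=2])
      (simp_all add: products_in_B br_star_0[OF pi_in_B gens_in_B(2) U_in_B] br_mv_gen[OF pi] br_mv_U[OF pi])
  have N_pi: "br ?N (bfv_mv \<pi>) = 0"
    by (rule br_swap_0[OF N pi_in_B pi_N])
  have nu_N: "br (\<nu> k) ?N = 0" if k: "k < q" for k
    by (subst br_sum_right[OF gens_in_B(2)[OF k], where l=2])
      (simp_all add: products_in_B br_star_0[OF gens_in_B(2)[OF k] gens_in_B(2) U_in_B] k
        br_gen_gen_0 br_gen_U_0)
  have gen_N: "br (bfv_gen (UGen k)) ?N = 0" if k: "k < p" for k
    by (subst br_sum_right[OF gens_in_B(3)[OF k], where l=2])
      (simp_all add: products_in_B br_star_0[OF gens_in_B(3)[OF k] gens_in_B(2) U_in_B] k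
        br_gen_gen_0 br_gen_U_0)
  have N_U: "br ?N (U x) = 0" for x
  proof (rule linear_eq_on_u[where g = "\<lambda>x. 0"])
    show "linear (\<lambda>x. br ?N (U x))"
      by (simp add: linear_iff linear_add[OF linear_U] linear_scale[OF linear_U]
          br_add_right[OF N U_in_B U_in_B] br_scaleR_right[OF N U_in_B])
    show "br ?N (U (u k)) = 0" if "k < p" for k
      unfolding U_u[OF that] by (rule br_swap_0[OF N gens_in_B(3) gen_N]) (use that in simp_all)
  qed (rule linear_zero)
  have "br ?N (\<nu> j \<star> U x) = 0" if "j < q" for j x
    using that by (intro br_star_0[OF N gens_in_B(2) U_in_B] br_swap_0[OF N gens_in_B(2)] nu_N N_U)
  then have N_N: "br ?N ?N = 0"
    by (subst br_sum_right[OF N, where l=2]) (simp_all add: products_in_B)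
  have "br P P = br (bfv_mv \<pi>) (bfv_mv \<pi>) - br ?N (bfv_mv \<pi>) - (br (bfv_mv \<pi>) ?N - br ?N ?N)"
    unfolding Pi_eq
    by (simp only: br_diff_right[OF subspace_diff[OF subspace_B pi_in_B N] pi_in_B N]
        br_diff_left[OF pi_in_B N pi_in_B] br_diff_left[OF pi_in_B N N])
  also have "br (bfv_mv \<pi>) (bfv_mv \<pi>) = 0"
    by (simp add: br_mv_mv[OF pi pi] pi_pi)
  finally show ?thesis
    by (simp only: N_pi pi_N N_N diff_zero)
qed

subsection \<open>The derived bracket on \<open>\<K>\<close>\<close>

text \<open>Bracketing with a fixed \<open>x\<close> is a derivation of degree \<open>n - 1\<close>,
  so it suffices to test the generators, whose degrees are 0, 1 and -1.\<close>

lemma br_homogeneous_K: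
  assumes x: "x \<in> B n"
    and "fun": "\<And>f. f \<in> smooth_functions \<A> \<Longrightarrow> homogeneous_K \<A> p q (n - 1) (br x (bfv_mv (mv_of_fun f)))"
    and eta: "\<And>i. i < p \<Longrightarrow> homogeneous_K \<A> p q n (br x (bfv_gen (UStar i)))"
    and V: "\<And>j. j < q \<Longrightarrow> homogeneous_K \<A> p q (n - 2) (br x (bfv_gen (VGen j)))"
    and w: "homogeneous_K \<A> p q k w"
  shows "homogeneous_K \<A> p q (k + n - 1) (br x w)"
  using w
proof (induction rule: homogeneous_K.induct)
  case (zero k)
  then show ?case using homogeneous_K.zero by (simp only: br_0_right[OF x])
next
  case (add k a b)
  then show ?case
    using homogeneous_K.add
    by (simp only: br_add_right[OF x homogeneous_K_in_bfv_space homogeneous_K_in_bfv_space])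
next
  case (scale k a r)
  then show ?case
    using homogeneous_K.scale by (simp only: br_scaleR_right[OF x homogeneous_K_in_bfv_space])
next
  case (mult k a l b)
  have "homogeneous_K \<A> p q (k + l + n - 1) (br x a \<star> b)"
    by (rule homogeneous_K_mult[OF mult.IH(1) mult.hyps(2)]) simp
  moreover have "homogeneous_K \<A> p q (k + l + n - 1) (a \<star> br x b)"
    by (rule homogeneous_K_mult[OF mult.hyps(1) mult.IH(2)]) simp
  ultimately show ?case
    unfolding br_leibniz[OF x homogeneous_K_in_bfv_space[OF mult.hyps(1)]
        homogeneous_K_in_bfv_space[OF mult.hyps(2)]]
    by (intro homogeneous_K.add homogeneous_K.scale)
qed (use "fun" eta V in \<open>simp_all add: algebra_simps\<close>)

lemma br_homogeneous_K_eq_0: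
  assumes x: "x \<in> B n"
    and "fun": "\<And>f. f \<in> smooth_functions \<A> \<Longrightarrow> br x (bfv_mv (mv_of_fun f)) = 0"
    and eta: "\<And>i. i < p \<Longrightarrow> br x (bfv_gen (UStar i)) = 0"
    and V: "\<And>j. j < q \<Longrightarrow> br x (bfv_gen (VGen j)) = 0"
    and w: "homogeneous_K \<A> p q k w"
  shows "br x w = 0"
  using w
proof (induction rule: homogeneous_K.induct)
  case (zero k)
  then show ?case by (rule br_0_right[OF x])
next
  case (add k a b)
  then show ?case
    by (simp only: br_add_right[OF x homogeneous_K_in_bfv_space homogeneous_K_in_bfv_space] add_0)
next
  case (scale k a r)
  then show ?case by (simp only: br_scaleR_right[OF x homogeneous_K_in_bfv_space] scaleR_zero_right)
next
  case (mult k a l b)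
  then show ?case by (intro br_star_0[OF x homogeneous_K_in_bfv_space homogeneous_K_in_bfv_space])
qed (use "fun" eta V in simp_all)

text \<open>There is one induction for each argument: the inner one fixes a generator and varies
  \<open>x\<close>, antisymmetry exchanges the two, and the outer one varies \<open>y\<close>. In
  the base cases no two generators of \<K> are dual to each other.\<close>

lemma K_abelian:
  assumes x: "homogeneous_K \<A> p q k x" and y: "homogeneous_K \<A> p q l y"
  shows "br x y = 0"
proof -
  note xB = homogeneous_K_in_bfv_space[OF x]
  show ?thesis
  proof (rule br_homogeneous_K_eq_0[OF xB _ _ _ y])
    fix f assume f: "f \<in> smooth_functions \<A>"
    have "br (bfv_mv (mv_of_fun f)) x = 0"
      by (rule br_homogeneous_K_eq_0[OF fun_in_B[OF f] _ _ _ x])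
        (simp_all add: br_fun_fun[OF f] br_mv_gen[OF mv_of_fun_in_multivector_fields[OF f]])
    then show "br x (bfv_mv (mv_of_fun f)) = 0"
      by (rule br_swap_0[OF xB fun_in_B[OF f]])
  next
    fix i assume i: "i < p"
    have "br (\<eta> i) x = 0"
      by (rule br_homogeneous_K_eq_0[OF gens_in_B(1)[OF i] _ _ _ x])
        (simp_all add: i br_gen_mv[OF mv_of_fun_in_multivector_fields] br_gen_gen_0)
    then show "br x (\<eta> i) = 0"
      by (rule br_swap_0[OF xB gens_in_B(1)[OF i]])
  next
    fix j assume j: "j < q"
    have "br (bfv_gen (VGen j)) x = 0"
      by (rule br_homogeneous_K_eq_0[OF gens_in_B(4)[OF j] _ _ _ x])
        (simp_all add: j br_gen_mv[OF mv_of_fun_in_multivector_fields] br_gen_gen_0)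
    then show "br x (bfv_gen (VGen j)) = 0"
      by (rule br_swap_0[OF xB gens_in_B(4)[OF j]])
  qed
qed

lemma homogeneous_K_bfv_mv:
  assumes "R \<in> multivector_fields \<A> 0" shows "homogeneous_K \<A> p q 0 (bfv_mv R)"
  using homogeneous_K.fun[OF multivector_fields_0(1)[OF assms], of p q]
  by (simp only: multivector_fields_0(2)[OF assms, symmetric])

lemma homogeneous_K_F: "homogeneous_K \<A> p q 0 (F y)"
  by (rule homogeneous_K.fun[OF J0])

lemma homogeneous_K_V: "homogeneous_K \<A> p q (-1) (V y)"
proof -
  obtain r where "y = (\<Sum>k<q. r k *\<^sub>R v k)" using expand_v by blast
  then have y: "V y = (\<Sum>k<q. r k *\<^sub>R bfv_gen (VGen k))"
    by (simp add: linear_sum[OF linear_V] linear_scale[OF linear_V] V_v)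
  show ?thesis
    unfolding y by (intro homogeneous_K_sum homogeneous_K.scale homogeneous_K.vgen) simp
qed

lemma homogeneous_K_one: "homogeneous_K \<A> p q 0 bfv_one"
  unfolding bfv_one_def by (rule homogeneous_K.fun[OF one_in_smooth_functions])

text \<open>\<open>Q\<close> itself contains \<open>\<nu>\<close> and \<open>U\<close>, which lie
  outside \<K>, but they disappear from its brackets with the generators: a function leaves
  functions times \<open>\<eta>\<close>, an \<open>\<eta>\<close> leaves products of two
  \<open>\<eta>\<close>, and a \<open>v\<close> leaves \<open>F\<close> and
  \<open>\<eta> \<star> V\<close>.\<close>

lemma br_Q_homogeneous_K:
  assumes "homogeneous_K \<A> p q k w"
  shows "homogeneous_K \<A> p q (k + 1) (br Q w)"
proof -
  have 1: "homogeneous_K \<A> p q 1 (br Q (bfv_mv (mv_of_fun f)))" if f: "f \<in> smooth_functions \<A>" for f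
  proof -
    note f' = mv_of_fun_in_multivector_fields[OF f]
    have 1: "br (bfv_mv (mv_of_fun f)) (X x \<star> \<eta> i) = bfv_mv (schouten (mv_of_fun f) (J1 x)) \<star> \<eta> i"
      if "i < p" for i x
      using that by (simp add: br_leibniz[OF fun_in_B[OF f] X_in_B gens_in_B(1)] br_mv_gen[OF f']
          br_mv_mv[OF f' J1])
    have 2: "br (bfv_mv (mv_of_fun f)) (F y \<star> \<nu> j) = 0" if "j < q" for j y
      using that by (simp add: br_star_0[OF fun_in_B[OF f] F_in_B gens_in_B(2)] br_mv_gen[OF f']
          br_fun_fun[OF f J0])
    have 3: "br (bfv_mv (mv_of_fun f)) (\<eta> i \<star> \<eta> j \<star> U z) = 0" if "i < p" "j < p" for i j z
      using that by (intro br_star_0[OF fun_in_B[OF f] products_in_B(3) U_in_B]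
          br_star_0[OF fun_in_B[OF f] gens_in_B(1) gens_in_B(1)] br_mv_gen[OF f'] br_mv_U[OF f']) simp_all
    have 4: "br (bfv_mv (mv_of_fun f)) (\<eta> i \<star> \<nu> j \<star> V z) = 0" if "i < p" "j < q" for i j z
      using that by (intro br_star_0[OF fun_in_B[OF f] products_in_B(4) V_in_B]
          br_star_0[OF fun_in_B[OF f] gens_in_B(1) gens_in_B(2)] br_mv_gen[OF f'] br_mv_V[OF f']) simp_all
    have "br Q (bfv_mv (mv_of_fun f)) = (\<Sum>i<p. bfv_mv (schouten (mv_of_fun f) (J1 (u i))) \<star> \<eta> i)"
      by (simp add: br_Q_flip[OF fun_in_B[OF f]] br_Q_right[OF fun_in_B[OF f]] 1 2 3 4)
    moreover have "schouten (mv_of_fun f) (J1 x) \<in> multivector_fields \<A> 0" for x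
      using schouten_in_multivector_fields[OF f' J1] by simp
    ultimately show ?thesis
      by (auto intro!: homogeneous_K_sum homogeneous_K_mult[OF homogeneous_K_bfv_mv homogeneous_K.ustar])
  qed
  have "homogeneous_K \<A> p q (k + 2 - 1) (br Q w)"
  proof (rule br_homogeneous_K[OF Q_in_B _ _ _ assms])
    show "homogeneous_K \<A> p q 2 (br Q (\<eta> i))" if "i < p" for i
      unfolding br_Q_eta[OF that]
      by (intro homogeneous_K.scale homogeneous_K_sum homogeneous_K_mult[OF homogeneous_K.ustar homogeneous_K.ustar])
        simp_all
    show "homogeneous_K \<A> p q (2 - 2) (br Q (bfv_gen (VGen j)))" if "j < q" for j
      unfolding V_v[OF that, symmetric] br_Q_V
      by (intro homogeneous_K_diff homogeneous_K_sum homogeneous_K_mult[OF homogeneous_K.ustar homogeneous_K_V])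
        (simp_all add: homogeneous_K_F)
  qed (use 1 in simp)
  then show ?thesis by (simp add: add.commute)
qed

text \<open>The Jacobi identity for \<open>P\<close>, \<open>x\<close>, \<open>y\<close> has zero
  left-hand side, as \<K> is abelian. This relates the two derived brackets; the exponent collects
  \<open>k - 1\<close> from the Jacobi identity and \<open>(k - 1) * l\<close> from
  antisymmetry.\<close>

lemma derived_swap:
  assumes x: "homogeneous_K \<A> p q k x" and y: "homogeneous_K \<A> p q l y"
  shows "br (br P x) y = koszul ((k - 1) * (l + 1)) *\<^sub>R br (br P y) x"
proof -
  note xB = homogeneous_K_in_bfv_space[OF x] and yB = homogeneous_K_in_bfv_space[OF y]
  have "br P (br x y) = br (br P x) y + koszul (k - 1) *\<^sub>R br x (br P y)"
    using br_jacobi[OF Pi_in_B xB yB] by simp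
  moreover have "br P (br x y) = 0"
    unfolding K_abelian[OF x y] by (rule br_0_right[OF Pi_in_B])
  ultimately have "br (br P x) y = - (koszul (k - 1) *\<^sub>R br x (br P y))"
    by (simp only: eq_neg_iff_add_eq_0)
  moreover have "br x (br P y) = - (koszul ((k - 1) * l) *\<^sub>R br (br P y) x)"
    using br_antisym[OF xB br_closed[OF Pi_in_B yB]] by simp
  moreover have "koszul ((k - 1) * (l + 1)) = koszul (k - 1) * koszul ((k - 1) * l)"
    by (simp add: distrib_left koszul_add mult.commute)
  ultimately show ?thesis
    by (simp only: scaleR_minus_right minus_minus scaleR_scaleR)
qed

text \<open>The value lies outside \<K>. With \<open>br_P_V\<close> and \<open>br_P_fun\<close> this
  lists the operators whose brackets must be shown to preserve \<K>.\<close>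

lemma br_P_eta: "k < p \<Longrightarrow> br P (\<eta> k) = (\<Sum>j<q. a j k *\<^sub>R \<nu> j)"
proof -
  assume kp: "k < p"
  note k = gens_in_B(1)[OF kp]
  have "br (\<eta> k) (\<nu> j \<star> U (\<delta> (v j))) = a j k *\<^sub>R \<nu> j" if j: "j < q" for j
  proof -
    have "U (\<delta> (v j)) = (\<Sum>l<p. a j l *\<^sub>R bfv_gen (UGen l))"
      using j by (simp add: a linear_sum[OF linear_U] linear_scale[OF linear_U] U_u)
    moreover have "br (\<eta> k) (\<Sum>l<p. a j l *\<^sub>R bfv_gen (UGen l)) =
        (\<Sum>l<p. br (\<eta> k) (a j l *\<^sub>R bfv_gen (UGen l)))"
      by (rule br_sum_right[OF k, where l=0]) (simp add: subspace_scale subspace_B gens_in_B)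
    moreover have "\<dots> = (\<Sum>l<p. if k = l then a j l *\<^sub>R bfv_one else 0)"
      using kp by (intro sum.cong refl) (simp add: br_scaleR_right[OF k gens_in_B(3)] br_UStar_UGen)
    ultimately have "br (\<eta> k) (U (\<delta> (v j))) = a j k *\<^sub>R bfv_one"
      using kp by (simp only: sum_if_eq_left)
    then show ?thesis
      using j kp by (simp add: br_leibniz[OF k gens_in_B(2) U_in_B] br_gen_gen_0 star_linear star_one_right)
  qed
  then show ?thesis
    using kp by (simp add: br_Pi_flip[OF k] br_Pi_right[OF k] br_gen_mv[OF pi] koszul_def)
qed

lemma br_P_V:
  assumes "k < q"
  shows "br P (bfv_gen (VGen k)) = - U (\<delta> (v k))"
proof -
  note k = gens_in_B(4)[OF assms]
  have "br (bfv_gen (VGen k)) (\<nu> j \<star> U x) = (if k = j then - U x else 0)" if "j < q" for j x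
    using that assms by (simp add: br_leibniz[OF k gens_in_B(2) U_in_B] br_VGen_VStar br_gen_U_0
        star_linear star_one_left fun_coeff_U)
  then have "(\<Sum>j<q. br (bfv_gen (VGen k)) (\<nu> j \<star> U (\<delta> (v j)))) = - U (\<delta> (v k))"
    using assms by (simp add: sum_if_eq_left)
  then show ?thesis
    using assms by (simp add: br_Pi_flip[OF k] br_Pi_right[OF k] br_gen_mv[OF pi] koszul_def)
qed

lemma br_P_fun:
  assumes f: "f \<in> smooth_functions \<A>"
  shows "br P (bfv_mv (mv_of_fun f)) = bfv_mv (schouten (mv_of_fun f) \<pi>)"
proof -
  note f' = mv_of_fun_in_multivector_fields[OF f]
  have "br (bfv_mv (mv_of_fun f)) (\<nu> j \<star> U x) = 0" if "j < q" for j x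
    using that by (simp add: br_star_0[OF fun_in_B[OF f] gens_in_B(2) U_in_B] br_mv_gen[OF f'] br_mv_U[OF f'])
  then show ?thesis
    by (simp add: br_Pi_flip[OF fun_in_B[OF f]] br_Pi_right[OF fun_in_B[OF f]] br_mv_mv[OF f' pi])
qed

text \<open>For general \<open>w\<close> there is no closed form of \<open>br P w\<close>. The
  induction therefore runs over \<open>z\<close>, and on each generator \<open>derived_swap\<close>
  exchanges the arguments, so that the generator stands next to \<open>P\<close>. Its bracket with
  \<open>P\<close> is then explicit: a vector field, a combination of \<open>\<nu>\<close>, or one
  of \<open>u\<close>, and a bracket with any of these maps \<K> to itself by
  \<open>br_homogeneous_K\<close>.\<close>

lemma derived_homogeneous_K:
  assumes w: "homogeneous_K \<A> p q k w" and z: "homogeneous_K \<A> p q l z"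
  shows "homogeneous_K \<A> p q (k + l) (br (br P w) z)"
proof -
  have "fun": "homogeneous_K \<A> p q (0 + n) (br (br P (bfv_mv (mv_of_fun f))) y)"
    if f: "f \<in> smooth_functions \<A>" and y: "homogeneous_K \<A> p q n y" for f n y
  proof -
    let ?Y = "schouten (mv_of_fun f) \<pi>"
    have Y: "?Y \<in> multivector_fields \<A> 1"
      using schouten_in_multivector_fields[OF mv_of_fun_in_multivector_fields[OF f] pi] by simp
    have "homogeneous_K \<A> p q (n + 1 - 1) (br (bfv_mv ?Y) y)"
    proof (rule br_homogeneous_K[OF mv_in_B[OF Y] _ _ _ y])
      fix g assume "g \<in> smooth_functions \<A>"
      note g' = mv_of_fun_in_multivector_fields[OF this]
      have "schouten ?Y (mv_of_fun g) \<in> multivector_fields \<A> 0"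
        using schouten_in_multivector_fields[OF Y g'] by simp
      then show "homogeneous_K \<A> p q (1 - 1) (br (bfv_mv ?Y) (bfv_mv (mv_of_fun g)))"
        by (simp add: br_mv_mv[OF Y g'] homogeneous_K_bfv_mv)
    qed (simp_all add: br_mv_gen[OF Y] homogeneous_K.zero)
    then show ?thesis by (simp add: br_P_fun[OF f])
  qed
  have eta: "homogeneous_K \<A> p q (1 + n) (br (br P (\<eta> k)) y)"
    if k: "k < p" and y: "homogeneous_K \<A> p q n y" for k n y
  proof -
    have "homogeneous_K \<A> p q (n + 2 - 1) (br (\<nu> j) y)" if "j < q" for j
      by (rule br_homogeneous_K[OF gens_in_B(2)[OF that] _ _ _ y])
        (use that in \<open>simp_all add: br_gen_mv[OF mv_of_fun_in_multivector_fields] br_gen_gen_0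
          br_VStar_VGen homogeneous_K.zero homogeneous_K_one\<close>)
    then have "homogeneous_K \<A> p q (1 + n) (\<Sum>j<q. a j k *\<^sub>R br (\<nu> j) y)"
      by (intro homogeneous_K_sum homogeneous_K.scale) (simp add: add.commute)
    moreover have "br (\<Sum>j<q. a j k *\<^sub>R \<nu> j) y = (\<Sum>j<q. br (a j k *\<^sub>R \<nu> j) y)"
      by (rule br_sum_left[OF homogeneous_K_in_bfv_space[OF y], where k=2])
        (simp add: subspace_scale subspace_B gens_in_B)
    moreover have "\<dots> = (\<Sum>j<q. a j k *\<^sub>R br (\<nu> j) y)"
      by (intro sum.cong refl br_scaleR_left[OF gens_in_B(2) homogeneous_K_in_bfv_space[OF y]]) simp
    ultimately show ?thesis unfolding br_P_eta[OF k] by (simp only:)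
  qed
  have V: "homogeneous_K \<A> p q (-1 + n) (br (br P (bfv_gen (VGen k))) y)"
    if k: "k < q" and y: "homogeneous_K \<A> p q n y" for k n y
  proof -
    have U: "homogeneous_K \<A> p q (n + 0 - 1) (br (bfv_gen (UGen i)) y)" if "i < p" for i
      by (rule br_homogeneous_K[OF gens_in_B(3)[OF that] _ _ _ y])
        (use that in \<open>simp_all add: br_gen_mv[OF mv_of_fun_in_multivector_fields] br_gen_gen_0
          br_UGen_UStar homogeneous_K.zero homogeneous_K_one homogeneous_K_minus\<close>)
    obtain r where "- \<delta> (v k) = (\<Sum>k<p. r k *\<^sub>R u k)" using expand_u by blast
    then have "U (- \<delta> (v k)) = (\<Sum>k<p. r k *\<^sub>R bfv_gen (UGen k))"
      by (simp add: linear_sum[OF linear_U] linear_scale[OF linear_U] U_u)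
    then have "br P (bfv_gen (VGen k)) = (\<Sum>k<p. r k *\<^sub>R bfv_gen (UGen k))"
      unfolding br_P_V[OF k] by (simp only: linear_neg[OF linear_U])
    moreover have "br (\<Sum>k<p. r k *\<^sub>R bfv_gen (UGen k)) y = (\<Sum>k<p. br (r k *\<^sub>R bfv_gen (UGen k)) y)"
      by (rule br_sum_left[OF homogeneous_K_in_bfv_space[OF y], where k=0])
        (simp add: subspace_scale subspace_B gens_in_B)
    moreover have "\<dots> = (\<Sum>k<p. r k *\<^sub>R br (bfv_gen (UGen k)) y)"
      by (intro sum.cong refl br_scaleR_left[OF gens_in_B(3) homogeneous_K_in_bfv_space[OF y]]) simp
    moreover have "homogeneous_K \<A> p q (-1 + n) \<dots>"
      using U by (intro homogeneous_K_sum homogeneous_K.scale) simp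
    ultimately show ?thesis by (simp only:)
  qed
  have wB: "br P w \<in> B (k + 1)"
    using br_closed[OF Pi_in_B homogeneous_K_in_bfv_space[OF w]] by (simp add: add.commute)
  have "homogeneous_K \<A> p q (l + (k + 1) - 1) (br (br P w) z)"
  proof (rule br_homogeneous_K[OF wB _ _ _ z])
    fix f assume f: "f \<in> smooth_functions \<A>"
    show "homogeneous_K \<A> p q (k + 1 - 1) (br (br P w) (bfv_mv (mv_of_fun f)))"
      using "fun"[OF f w] by (simp add: derived_swap[OF w homogeneous_K.fun[OF f]] homogeneous_K.scale)
  next
    fix i assume i: "i < p"
    show "homogeneous_K \<A> p q (k + 1) (br (br P w) (\<eta> i))"
      using eta[OF i w] by (simp add: derived_swap[OF w homogeneous_K.ustar[OF i]] homogeneous_K.scale add.commute)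
  next
    fix j assume j: "j < q"
    show "homogeneous_K \<A> p q (k + 1 - 2) (br (br P w) (bfv_gen (VGen j)))"
      using V[OF j w] by (simp add: derived_swap[OF w homogeneous_K.vgen[OF j]] homogeneous_K.scale)
  qed
  then show ?thesis by (simp add: add.commute)
qed

text \<open>\<open>D\<close> has shifted degree 1, so the Jacobi identity reads
  \<open>{D, {D, x}} = {{D, D}, x} - {D, {D, x}}\<close>.\<close>

lemma square_0:
  assumes D: "D \<in> B 2" "br D D = 0" and x: "x \<in> B k"
  shows "br D (br D x) = 0"
proof -
  have "br D (br D x) = - br D (br D x)"
    using br_jacobi[OF D(1) D(1) x] by (simp add: D(2) br_0_left[OF x] koszul_def)
  then have "2 *\<^sub>R br D (br D x) = 0"
    by (simp only: scaleR_2 eq_neg_iff_add_eq_0)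
  then show ?thesis by (simp only: scaleR_eq_0_iff) simp
qed

lemma dg_poisson_algebra_K:
  "dg_poisson_algebra (bfv_K_space \<A> p q) (\<star>) bfv_one (br Q) (\<lambda>k l f g. koszul k *\<^sub>R br (br P f) g)"
  unfolding dg_poisson_algebra_def graded_poisson_bracket_def graded_lie_algebra_def
proof (intro conjI allI ballI graded_comm_algebra_bfv_K)
  note in_B = homogeneous_K_in_bfv_space
  have P_in_B: "br P x \<in> B (k + 1)" if "x \<in> B k" for x k
    using br_closed[OF Pi_in_B that] by (simp add: add.commute)
  show "graded_space (bfv_K_space \<A> p q)"
    using graded_comm_algebra_bfv_K[of \<A> p q] unfolding graded_comm_algebra_def by blast
  show "lin_on (bfv_K_space \<A> p q k) (br Q)" for k
    unfolding lin_on_def bfv_K_space_def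
    using br_add_right[OF Q_in_B] br_scaleR_right[OF Q_in_B] by blast
  show "bilin_on (bfv_K_space \<A> p q k) (bfv_K_space \<A> p q l) (\<lambda>f g. koszul k *\<^sub>R br (br P f) g)" for k l
    unfolding bilin_on_def lin_on_def
  proof (intro conjI ballI allI)
    fix x y z r
    assume x: "x \<in> bfv_K_space \<A> p q k" and y: "y \<in> bfv_K_space \<A> p q l"
    note xB = in_B[OF x[unfolded mem_bfv_K_space_iff]]
    note yB = in_B[OF y[unfolded mem_bfv_K_space_iff]]
    show "koszul k *\<^sub>R br (br P x) (r *\<^sub>R y) = r *\<^sub>R koszul k *\<^sub>R br (br P x) y"
      by (simp add: br_scaleR_right[OF P_in_B[OF xB] yB] mult.commute)
    show "koszul k *\<^sub>R br (br P (r *\<^sub>R x)) y = r *\<^sub>R koszul k *\<^sub>R br (br P x) y"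
      by (simp add: br_scaleR_right[OF Pi_in_B xB] br_scaleR_left[OF P_in_B[OF xB] yB] mult.commute)
    show "koszul k *\<^sub>R br (br P x) (y + z) = koszul k *\<^sub>R br (br P x) y + koszul k *\<^sub>R br (br P x) z"
      if z: "z \<in> bfv_K_space \<A> p q l"
      unfolding br_add_right[OF P_in_B[OF xB] yB in_B[OF z[unfolded mem_bfv_K_space_iff]]]
      by (rule scaleR_right_distrib)
    show "koszul k *\<^sub>R br (br P (x + z)) y = koszul k *\<^sub>R br (br P x) y + koszul k *\<^sub>R br (br P z) y"
      if z: "z \<in> bfv_K_space \<A> p q k"
    proof -
      note zB = in_B[OF z[unfolded mem_bfv_K_space_iff]]
      show ?thesis
        unfolding br_add_right[OF Pi_in_B xB zB] br_add_left[OF P_in_B[OF xB] P_in_B[OF zB] yB]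
        by (rule scaleR_right_distrib)
    qed
  qed
  fix k x assume "x \<in> bfv_K_space \<A> p q k"
  then have x: "homogeneous_K \<A> p q k x" by (simp add: mem_bfv_K_space_iff)
  note xB = in_B[OF x]
  show "br Q x \<in> bfv_K_space \<A> p q (k + 1)"
    unfolding mem_bfv_K_space_iff by (rule br_Q_homogeneous_K[OF x])
  show "br Q (br Q x) = 0"
    by (rule square_0[OF Q_in_B br_Q_Q xB])
  fix l y assume "y \<in> bfv_K_space \<A> p q l"
  then have y: "homogeneous_K \<A> p q l y" by (simp add: mem_bfv_K_space_iff)
  note yB = in_B[OF y]
  show "br Q (x \<star> y) = br Q x \<star> y + koszul k *\<^sub>R (x \<star> br Q y)"
    by (rule br_Q_star[OF xB yB])
  show "koszul k *\<^sub>R br (br P x) y \<in> bfv_K_space \<A> p q (k + l + 0)"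
    unfolding mem_bfv_K_space_iff by (simp add: derived_homogeneous_K[OF x y] homogeneous_K.scale)
  \<comment> \<open>Modulo 2 the exponent \<open>k + (k - 1) * (l + 1)\<close> is
    \<open>k * l + l + 1\<close>. The sign \<open>koszul k\<close> in the bracket thus turns
    \<open>derived_swap\<close> into graded antisymmetry.\<close>
  have "koszul k * koszul ((k - 1) * (l + 1)) = - (koszul ((k + 0) * (l + 0)) * koszul l)"
    by (simp add: koszul_def)
  then show "koszul k *\<^sub>R br (br P x) y =
      - (koszul ((k + 0) * (l + 0)) *\<^sub>R koszul l *\<^sub>R br (br P y) x)"
    by (subst derived_swap[OF x y]) (simp only: scaleR_scaleR scaleR_minus_left)
  show "br Q (koszul k *\<^sub>R br (br P x) y) =
      koszul (k + 1) *\<^sub>R br (br P (br Q x)) y + koszul k *\<^sub>R koszul k *\<^sub>R br (br P x) (br Q y)"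
  proof -
    have QxB: "br Q x \<in> B (k + 1)"
      by (rule in_B[OF br_Q_homogeneous_K[OF x]])
    \<comment> \<open>Both operators have odd degree and \<open>{Q, P} = 0\<close>, so they
      anticommute; the sign \<open>koszul (k + 1)\<close> belonging to \<open>br Q x\<close>
      compensates for the minus.\<close>
    have "br Q (br P x) = - br P (br Q x)"
      using br_jacobi[OF Q_in_B Pi_in_B xB] by (simp add: br_Q_P br_0_left[OF xB] koszul_def)
    then have "br (br Q (br P x)) y = - br (br P (br Q x)) y"
      by (simp only: br_minus_left[OF P_in_B[OF QxB] yB])
    then have "br Q (br (br P x) y) = - br (br P (br Q x)) y + koszul k *\<^sub>R br (br P x) (br Q y)"
      using br_jacobi[OF Q_in_B P_in_B[OF xB] yB] by simp
    then show ?thesis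
      using br_scaleR_right[OF Q_in_B in_B[OF derived_homogeneous_K[OF x y]]]
      by (simp add: scaleR_right_distrib koszul_add koszul_def)
  qed
  fix m z assume "z \<in> bfv_K_space \<A> p q m"
  then have z: "homogeneous_K \<A> p q m z" by (simp add: mem_bfv_K_space_iff)
  note zB = in_B[OF z]
  show "koszul k *\<^sub>R br (br P x) (y \<star> z) =
      (koszul k *\<^sub>R br (br P x) y) \<star> z + koszul ((k + 0) * l) *\<^sub>R (y \<star> (koszul k *\<^sub>R br (br P x) z))"
    using br_leibniz[OF P_in_B[OF xB] yB zB] by (simp add: star_linear scaleR_right_distrib mult.commute)
  have xyB: "br (br P x) y \<in> B (k + l)" and yzB: "br (br P y) z \<in> B (l + m)"
    and xzB: "br (br P x) z \<in> B (k + m)"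
    using derived_homogeneous_K x y z in_B by blast+
  \<comment> \<open>As \<open>{P, {P, x}} = 0\<close>, applying \<open>{P, \<cdot>}\<close> to the
    derived bracket differentiates only its second argument. The Jacobi identity for the derived
    bracket thereby becomes that of \<open>br\<close> for \<open>br P x\<close>,
    \<open>br P y\<close> and \<open>z\<close>.\<close>
  have PP: "br P (br (br P x) y) = koszul k *\<^sub>R br (br P x) (br P y)"
    using br_jacobi[OF Pi_in_B P_in_B[OF xB] yB] square_0[OF Pi_in_B br_P_P xB]
    by (simp add: br_0_left[OF yB])
  have "br (br P x) (br (br P y) z) =
      br (br (br P x) (br P y)) z + koszul (k * l) *\<^sub>R br (br P y) (br (br P x) z)"
    using br_jacobi[OF P_in_B[OF xB] P_in_B[OF yB] zB] by simp
  moreover have "br (br P (br (br P x) y)) z = koszul k *\<^sub>R br (br (br P x) (br P y)) z"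
    unfolding PP by (rule br_scaleR_left[OF br_closed[OF P_in_B[OF xB] P_in_B[OF yB]] zB])
  ultimately show "koszul k *\<^sub>R br (br P x) (koszul l *\<^sub>R br (br P y) z) =
      koszul (k + l + 0) *\<^sub>R br (br P (koszul k *\<^sub>R br (br P x) y)) z
      + koszul ((k + 0) * (l + 0)) *\<^sub>R koszul l *\<^sub>R br (br P y) (koszul k *\<^sub>R br (br P x) z)"
    by (simp add: br_scaleR_right[OF P_in_B[OF xB] yzB] br_scaleR_right[OF P_in_B[OF yB] xzB]
        br_scaleR_right[OF Pi_in_B xyB] br_scaleR_left[OF P_in_B[OF xyB] zB]
        scaleR_right_distrib koszul_add mult_ac)
      (simp add: koszul_def)
qed

end

section \<open>Bases and structure equations\<close>

lemma gbar_mem: "(0, x) \<in> gbar 0" "(y, 0) \<in> gbar (-1)"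
  by (simp_all add: gbar_def)

lemma is_basis_expand:
  assumes "is_basis n b"
  shows "\<exists>r. x = (\<Sum>k<n. r k *\<^sub>R b k)"
proof -
  have "x \<in> span (b ` {..<n})" using assms by (simp add: is_basis_def)
  then obtain r where "x = (\<Sum>y\<in>b ` {..<n}. r y *\<^sub>R y)"
    by (auto simp: span_finite)
  also have "\<dots> = (\<Sum>k<n. r (b k) *\<^sub>R b k)"
    using assms by (simp add: sum.reindex is_basis_def)
  finally show ?thesis by (rule exI[of _ "\<lambda>k. r (b k)"])
qed

text \<open>Linear extension prescribes values on vectors, so the index is recovered with
  \<open>inv_into\<close>, using injectivity of \<open>b\<close>.\<close>

lemma is_basis_linear_extend:
  fixes f :: "nat \<Rightarrow> 'b::real_vector"
  assumes "is_basis n b"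
  shows "\<exists>g. linear g \<and> (\<forall>i<n. g (b i) = f i)"
proof -
  have "independent (b ` {..<n})" and inj: "inj_on b {..<n}"
    using assms by (auto simp: is_basis_def)
  then obtain g where "linear g" and g: "\<forall>x\<in>b ` {..<n}. g x = f (inv_into {..<n} b x)"
    using linear_independent_extend[of "b ` {..<n}" "\<lambda>x. f (inv_into {..<n} b x)"] by blast
  moreover have "g (b i) = f i" if "i < n" for i
    using g that inj by (simp add: inv_into_f_f)
  ultimately show ?thesis by blast
qed

context
  fixes lie :: "'g::real_vector \<Rightarrow> 'g \<Rightarrow> 'g"
    and act :: "'g \<Rightarrow> 'h::real_vector \<Rightarrow> 'h"
    and \<delta> :: "'h \<Rightarrow> 'g"
  assumes dgla: "dg_lie_algebra gbar (gbar_bracket lie act) (gbar_diff \<delta>)"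
begin

lemma dgla_lie: "graded_lie_algebra 0 gbar (gbar_bracket lie act)"
  using dgla by (simp add: dg_lie_algebra_def)

lemma dgla_bilin: "bilin_on (gbar k) (gbar l) (gbar_bracket lie act k l)"
  using dgla_lie unfolding graded_lie_algebra_def by (elim conjE) blast

lemma dgla_antisym:
  "x \<in> gbar k \<Longrightarrow> y \<in> gbar l \<Longrightarrow>
    gbar_bracket lie act k l x y = - (koszul (k * l) *\<^sub>R gbar_bracket lie act l k y x)"
  using dgla_lie unfolding graded_lie_algebra_def add_0_right by (elim conjE) blast

lemma dgla_jacobi:
  "x \<in> gbar k \<Longrightarrow> y \<in> gbar l \<Longrightarrow> z \<in> gbar m \<Longrightarrow>
    gbar_bracket lie act k (l + m) x (gbar_bracket lie act l m y z) =
      gbar_bracket lie act (k + l) m (gbar_bracket lie act k l x y) z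
      + koszul (k * l) *\<^sub>R gbar_bracket lie act l (k + m) y (gbar_bracket lie act k m x z)"
  using dgla_lie unfolding graded_lie_algebra_def add_0_right by (elim conjE) blast

lemma dgla_lin: "lin_on (gbar k) (gbar_diff \<delta> k)"
  using dgla unfolding dg_lie_algebra_def by (elim conjE) blast

lemma dgla_deriv:
  "x \<in> gbar k \<Longrightarrow> y \<in> gbar l \<Longrightarrow>
    gbar_diff \<delta> (k + l) (gbar_bracket lie act k l x y) =
      gbar_bracket lie act (k + 1) l (gbar_diff \<delta> k x) y
      + koszul k *\<^sub>R gbar_bracket lie act k (l + 1) x (gbar_diff \<delta> l y)"
  using dgla unfolding dg_lie_algebra_def by (elim conjE) blast

lemma bilinear_lie: "linear (lie x)" "linear (\<lambda>x. lie x y)"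
proof -
  have "lin_on (gbar 0) (gbar_bracket lie act 0 0 (0, x))" for x
    using dgla_bilin[of 0 0] gbar_mem unfolding bilin_on_def by blast
  then show "linear (lie x)"
    by (auto simp: lin_on_def gbar_def gbar_bracket_def linear_iff)
  have "lin_on (gbar 0) (\<lambda>x. gbar_bracket lie act 0 0 x (0, y))" for y
    using dgla_bilin[of 0 0] gbar_mem unfolding bilin_on_def by blast
  then show "linear (\<lambda>x. lie x y)"
    by (auto simp: lin_on_def gbar_def gbar_bracket_def linear_iff)
qed

lemma bilinear_act: "linear (act x)" "linear (\<lambda>x. act x y)"
proof -
  have "lin_on (gbar (-1)) (gbar_bracket lie act 0 (-1) (0, x))" for x
    using dgla_bilin[of 0 "-1"] gbar_mem unfolding bilin_on_def by blast
  then show "linear (act x)"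
    by (auto simp: lin_on_def gbar_def gbar_bracket_def linear_iff)
  have "lin_on (gbar 0) (\<lambda>x. gbar_bracket lie act 0 (-1) x (y, 0))" for y
    using dgla_bilin[of 0 "-1"] gbar_mem unfolding bilin_on_def by blast
  then show "linear (\<lambda>x. act x y)"
    by (auto simp: lin_on_def gbar_def gbar_bracket_def linear_iff)
qed

lemma linear_delta: "linear \<delta>"
  using dgla_lin[of "-1"] by (auto simp: lin_on_def gbar_def gbar_diff_def linear_iff)

lemma lie_antisym: "lie x y = - lie y x"
  using dgla_antisym[OF gbar_mem(1) gbar_mem(1), of x y] by (simp add: gbar_bracket_def)

lemma lie_jacobi: "lie x (lie y z) = lie (lie x y) z + lie y (lie x z)"
  using dgla_jacobi[OF gbar_mem(1) gbar_mem(1) gbar_mem(1), of x y z] by (simp add: gbar_bracket_def)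

lemma act_act: "act x (act y z) = act (lie x y) z + act y (act x z)"
  using dgla_jacobi[OF gbar_mem(1) gbar_mem(1) gbar_mem(2), of x y z] by (simp add: gbar_bracket_def)

lemma delta_act: "\<delta> (act x y) = lie x (\<delta> y)"
proof -
  \<comment> \<open>The differential of the degree 0 argument sits in degree 1, where the bracket is
    zero by its default clause; only the term with \<open>\<delta> y\<close> is left.\<close>
  have "gbar_bracket lie act 1 (-1) z w = 0" for z w by (simp add: gbar_bracket_def)
  then show ?thesis
    using dgla_deriv[OF gbar_mem(1) gbar_mem(2), of x y]
    by (simp add: gbar_bracket_def gbar_diff_def)
qed

text \<open>The bracket of two elements of \<open>\<hh>[1]\<close> vanishes, hence so does its differential.\<close>

lemma act_delta: "act (\<delta> y) z = - act (\<delta> z) y"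
  using dgla_deriv[OF gbar_mem(2) gbar_mem(2), of y z]
  by (simp add: gbar_bracket_def gbar_diff_def koszul_def eq_neg_iff_add_eq_0 prod_eq_iff)

end

section \<open>From the chain map property to equations for the Poisson bivector\<close>

lemma (in bfv_poisson) moment_map_pi:
  assumes pi: "\<pi> \<in> multivector_fields \<A> 2"
    and morphism: "dgla_morphism gbar (gbar_bracket lie act) (gbar_diff \<delta>)
      (derivations \<A>) commutator (\<lambda>k. commutator 1 k (hamiltonian \<A> \<pi>)) \<Psi>"
    and moment: "moment_map \<A> lie act \<Psi> J1 J0"
  shows "schouten \<pi> (J1 x) = 0" "schouten \<pi> (mv_of_fun (J0 y)) = J1 (\<delta> y)"
proof -
  have all: "P \<in> all_multivector_fields \<A>" if "P \<in> multivector_fields \<A> r" for P r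
    using that unfolding all_multivector_fields_def by (blast intro: span_base)
  have J1: "J1 x \<in> multivector_fields \<A> 1" and J0: "mv_of_fun (J0 y) \<in> multivector_fields \<A> 0"
    and \<Psi>: "\<Psi> (0, x) = hamiltonian \<A> (J1 x)" "\<Psi> (y, 0) = hamiltonian \<A> (mv_of_fun (J0 y))"
    and J1_0: "J1 0 = 0" for x y
    using moment mv_of_fun_in_multivector_fields linear_0[of J1] unfolding moment_map_def by blast+
  have comm: "\<Psi> (gbar_diff \<delta> k z) = commutator 1 k (hamiltonian \<A> \<pi>) (\<Psi> z)" if "z \<in> gbar k" for k z
    using morphism that unfolding dgla_morphism_def by blast
  \<comment> \<open>The Jacobi identity of the Schouten bracket is that of \<open>br\<close>,
    carried over by the injective map \<open>bfv_mv\<close>.\<close>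
  have jac: "schouten \<pi> (schouten R S) =
      schouten (schouten \<pi> R) S + koszul (r - 1) *\<^sub>R schouten R (schouten \<pi> S)"
    if R: "R \<in> multivector_fields \<A> r" and S: "S \<in> multivector_fields \<A> s" for R S r s
  proof (rule bfv_mv_inject)
    show "bfv_mv (schouten \<pi> (schouten R S)) =
      bfv_mv (schouten (schouten \<pi> R) S + koszul (r - 1) *\<^sub>R schouten R (schouten \<pi> S))"
      using br_jacobi[OF mv_in_B[OF pi] mv_in_B[OF R] mv_in_B[OF S]]
        schouten_in_multivector_fields[OF R S] schouten_in_multivector_fields[OF pi R]
        schouten_in_multivector_fields[OF pi S]
      by (simp add: br_mv_mv[OF R S] br_mv_mv[OF pi R] br_mv_mv[OF pi S]
          br_mv_mv[OF pi] br_mv_mv[OF R] br_mv_mv[OF _ S] bfv_mv_add bfv_mv_scaleR)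
  qed
  \<comment> \<open>The commutator of Hamiltonian derivations is the Hamiltonian derivation of the
    bracket. A field of degree \<open>r\<close> acts with degree \<open>r - 1\<close>, so
    \<open>k\<close> is 0 for \<open>J1\<close> and -1 for \<open>J0\<close>. Outside
    \<open>all_multivector_fields\<close> a \<open>hamiltonian\<close> is zero, hence the membership
    facts.\<close>
  have commutator: "commutator 1 k (hamiltonian \<A> \<pi>) (hamiltonian \<A> R) S = schouten (schouten \<pi> R) S"
    if R: "R \<in> multivector_fields \<A> r" and S: "S \<in> multivector_fields \<A> s" and k: "k = r - 1"
    for R S r s k
    using jac[OF R S] all[OF S] all[OF schouten_in_multivector_fields[OF R S]]
      all[OF schouten_in_multivector_fields[OF pi S]]
    by (simp add: commutator_def hamiltonian_def k)
  show "schouten \<pi> (J1 x) = 0"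
  proof (rule bivector_field_eq_0I)
    show "schouten \<pi> (J1 x) \<in> multivector_fields \<A> 2"
      using schouten_in_multivector_fields[OF pi J1] by simp
    fix f assume "f \<in> smooth_functions \<A>"
    then have f: "mv_of_fun f \<in> multivector_fields \<A> 0" by (rule mv_of_fun_in_multivector_fields)
    \<comment> \<open>The zero vector is written as a pair with zero in \<hh>, so that \<Psi> sends
      it to the Hamiltonian derivation of \<open>J1 0 = 0\<close>.\<close>
    have "gbar_diff \<delta> 0 (0, x) = (0, 0)" by (simp add: gbar_diff_def zero_prod_def)
    then have "hamiltonian \<A> (J1 0) = commutator 1 0 (hamiltonian \<A> \<pi>) (hamiltonian \<A> (J1 x))"
      using comm[OF gbar_mem(1), of x] by (simp only: \<Psi>(1))
    then have "schouten (schouten \<pi> (J1 x)) (mv_of_fun f) = hamiltonian \<A> (J1 0) (mv_of_fun f)"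
      using commutator[OF J1 f, of 0] by simp
    also have "\<dots> = schouten 0 (mv_of_fun f)"
      using all[OF f] by (simp add: hamiltonian_def J1_0)
    \<comment> \<open>That the bracket with zero vanishes follows from linearity of
      \<open>br\<close> in its first argument.\<close>
    also have "\<dots> = 0"
    proof (rule bfv_mv_inject)
      show "bfv_mv (schouten 0 (mv_of_fun f)) = bfv_mv 0"
        using br_mv_mv[OF subspace_0[OF subspace_multivector_fields] f] br_0_left[OF mv_in_B[OF f]] by simp
    qed
    finally show "schouten (schouten \<pi> (J1 x)) (mv_of_fun f) = 0" .
  qed
  show "schouten \<pi> (mv_of_fun (J0 y)) = J1 (\<delta> y)"
  proof (rule vector_field_eqI[OF _ J1])
    show "schouten \<pi> (mv_of_fun (J0 y)) \<in> multivector_fields \<A> 1"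
      using schouten_in_multivector_fields[OF pi J0] by simp
    fix f assume "f \<in> smooth_functions \<A>"
    then have f: "mv_of_fun f \<in> multivector_fields \<A> 0" by (rule mv_of_fun_in_multivector_fields)
    have "gbar_diff \<delta> (-1) (y, 0) = (0, \<delta> y)" by (simp add: gbar_diff_def)
    then have "hamiltonian \<A> (J1 (\<delta> y)) =
        commutator 1 (-1) (hamiltonian \<A> \<pi>) (hamiltonian \<A> (mv_of_fun (J0 y)))"
      using comm[OF gbar_mem(2), of y] by (simp only: \<Psi>)
    then have "schouten (schouten \<pi> (mv_of_fun (J0 y))) (mv_of_fun f) =
        hamiltonian \<A> (J1 (\<delta> y)) (mv_of_fun f)"
      using commutator[OF J0 f, of "-1"] by simp
    also have "\<dots> = schouten (J1 (\<delta> y)) (mv_of_fun f)"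
      using all[OF f] by (simp add: hamiltonian_def)
    finally show "schouten (schouten \<pi> (mv_of_fun (J0 y))) (mv_of_fun f) =
        schouten (J1 (\<delta> y)) (mv_of_fun f)" .
  qed
qed

section \<open>Assembling the theorem\<close>

theorem mainTheorem4:
  fixes \<A> :: "('m::{t2_space, second_countable_topology}, 'e::real_normed_vector) chart set"
    and \<pi> :: "'m mv"
    and lie :: "'g::real_vector \<Rightarrow> 'g \<Rightarrow> 'g"
    and act :: "'g \<Rightarrow> 'h::real_vector \<Rightarrow> 'h"
    and \<delta> :: "'h \<Rightarrow> 'g"
    and \<Psi> :: "'h \<times> 'g \<Rightarrow> 'm mv \<Rightarrow> 'm mv"
    and J1 :: "'g \<Rightarrow> 'm mv"
    and J0 :: "'h \<Rightarrow> 'm \<Rightarrow> real"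
    and p q :: nat
    and u :: "nat \<Rightarrow> 'g"
    and v :: "nat \<Rightarrow> 'h"
    and c d :: "nat \<Rightarrow> nat \<Rightarrow> nat \<Rightarrow> real"
    and a :: "nat \<Rightarrow> nat \<Rightarrow> real"
    and br :: "'m bfv \<Rightarrow> 'm bfv \<Rightarrow> 'm bfv"
  assumes manifold: "smooth_manifold \<A>"
    and poisson: "poisson_structure \<A> \<pi>"
    and dgla: "dg_lie_algebra gbar (gbar_bracket lie act) (gbar_diff \<delta>)"
    and morphism: "dgla_morphism gbar (gbar_bracket lie act) (gbar_diff \<delta>)
      (derivations \<A>) commutator (\<lambda>k. commutator 1 k (hamiltonian \<A> \<pi>)) \<Psi>"
    and moment: "moment_map \<A> lie act \<Psi> J1 J0"
    and basis_g: "is_basis p u"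
    and basis_h: "is_basis q v"
    and c: "\<And>i j. i < p \<Longrightarrow> j < p \<Longrightarrow> lie (u i) (u j) = (\<Sum>k<p. c i j k *\<^sub>R u k)"
    and d: "\<And>m n. m < p \<Longrightarrow> n < q \<Longrightarrow> act (u m) (v n) = (\<Sum>l<q. d m n l *\<^sub>R v l)"
    and a: "\<And>i. i < q \<Longrightarrow> \<delta> (v i) = (\<Sum>j<p. a i j *\<^sub>R u j)"
    and bracket: "bfv_bracket \<A> p q br"
  shows "let Q = bfv_Q p q J1 J0 u v c d;
             P = bfv_Pi p q \<pi> a;
             S = Q + P
         in br S S = 0 \<and>
            bfv_K \<A> p q = fun_ext_tensor \<A> p q \<and>
            dg_poisson_algebra (bfv_K_space \<A> p q) (\<star>) bfv_one
              (\<lambda>f. br Q f) (\<lambda>k l f g. koszul k *\<^sub>R br (br P f) g)"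
proof -
  interpret bfv_poisson \<A> p q br by (standard) (rule bracket)
  have pi: "\<pi> \<in> multivector_fields \<A> 2" "schouten \<pi> \<pi> = 0"
    using poisson by (simp_all add: poisson_structure_def)
  note moment' = moment[unfolded moment_map_def]
  \<comment> \<open>The embeddings of \<gg> and \<hh>[1] depend on the chosen bases: they are the
    linear extensions of \<open>u i \<mapsto> bfv_gen (UGen i)\<close> and
    \<open>v j \<mapsto> bfv_gen (VGen j)\<close>.\<close>
  obtain U where U: "linear U" "\<And>i. i < p \<Longrightarrow> U (u i) = (bfv_gen (UGen i) :: 'm bfv)"
    using is_basis_linear_extend[OF basis_g, of "\<lambda>i. bfv_gen (UGen i)"] by blast
  obtain V where V: "linear V" "\<And>j. j < q \<Longrightarrow> V (v j) = (bfv_gen (VGen j) :: 'm bfv)"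
    using is_basis_linear_extend[OF basis_h, of "\<lambda>j. bfv_gen (VGen j)"] by blast
  interpret bfv_moment_data \<A> p q br \<pi> lie act \<delta> J1 J0 u v c d a U V
  proof (intro bfv_moment_data.intro bfv_moment_data_axioms.intro)
    show "\<exists>r. x = (\<Sum>k<p. r k *\<^sub>R u k)" for x by (rule is_basis_expand[OF basis_g])
    show "\<exists>r. y = (\<Sum>k<q. r k *\<^sub>R v k)" for y by (rule is_basis_expand[OF basis_h])
    show "lie x x' = - lie x' x" for x x' by (rule lie_antisym[OF dgla])
    show "lie x (lie x' x'') = lie (lie x x') x'' + lie x' (lie x x'')" for x x' x''
      by (rule lie_jacobi[OF dgla])
    show "act x (act x' y) = act (lie x x') y + act x' (act x y)" for x x' y
      by (rule act_act[OF dgla])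
    show "\<delta> (act x y) = lie x (\<delta> y)" for x y by (rule delta_act[OF dgla])
    show "act (\<delta> y) y' = - act (\<delta> y') y" for y y' by (rule act_delta[OF dgla])
    show "schouten \<pi> (J1 x) = 0" "schouten \<pi> (mv_of_fun (J0 y)) = J1 (\<delta> y)" for x y
      by (rule moment_map_pi[OF pi(1) morphism moment])+
  qed (use pi moment' in \<open>simp_all only: bfv_poisson_axioms bilinear_lie[OF dgla] bilinear_act[OF dgla]
      linear_delta[OF dgla] c d a U V simp_thms\<close>)
  have "br P Q = 0"
    by (rule br_swap_0[OF Pi_in_B Q_in_B br_Q_P])
  then have "br (Q + P) (Q + P) = 0"
    unfolding br_add_right[OF subspace_add[OF subspace_B Q_in_B Pi_in_B] Q_in_B Pi_in_B]
      br_add_left[OF Q_in_B Pi_in_B Q_in_B] br_add_left[OF Q_in_B Pi_in_B Pi_in_B]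
    by (simp only: br_Q_Q br_Q_P br_P_P add_0)
  then show ?thesis
    unfolding Let_def using bfv_K_eq_fun_ext_tensor dg_poisson_algebra_K by blast
qed

end
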